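(* Let $p=4m+3$ be a prime with $m\ge\max\{5T(1/4),23\}$ and let $n\ge1$. If $A\subset\mathbb F_p^n$ is a nontrivial $(3,1)$-sum-free set with $|A|\ge mp^{n-1}$, then $A$ is either normal or of type 5.
   Context: Here $(k,\ell)=(3,1)$, $p=(k+\ell)m+2+\lambda$ with $\lambda=1$. For a set $X$ in an abelian group and $h\ge1$, $hX=\{x_1+\dots+x_h:x_i\in X\}$. A nonempty $A\subseteq\mathbb F_p^n$ is $(3,1)$-sum-free if $3A\cap A=\emptyset$. Subsets of $\mathbb F_p^n$ are isomorphic if an automorphism of the additive group $\mathbb F_p^n$ maps one onto the other. For $a,b\in\mathbb F_p$, $[a,b]=\{a,a+1,\dots,b\}\subseteq\mathbb F_p$ (cyclic interval). The extremal cuboid is $[a_0,a_0+m]\times\mathbb F_p^{n-1}$ with $a_0=-(3m+1)2^{-1}\in\mathbb F_p$; a $(3,1)$-sum-free set is trivial if it is isomorphic to a subset of it, nontrivial otherwise. Types (for $A$ with $|A|=mp^{n-1}$): type 1: $A$ is isomorphic to $[a,a+m-1]\times\mathbb F_p^{n-1}$ for some $a\in\mathbb F_p$ with $a-3(a+m-1)\in[1,1]=\{1\}$ (the other option $[\lambda+\ell+2,k]=[4,3]$ is void). Type 2: $n\ge2$ and $A$ is isomorphic to $(\{a\}\times(\mathbb F_p^{n-1}\setminus V))\sqcup([a+1,a+m-1]\times\mathbb F_p^{n-1})\sqcup(\{a+m\}\times V)$ with $a=3m(1-3)^{-1}\in\mathbb F_p$ and $V$ a proper subspace of $\mathbb F_p^{n-1}$.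 Normal means type 1 or 2. Type 5: there exist an integer $s\in[0,n-1]$ and a nonempty $P\subseteq\mathbb F_p^s$ with $0\notin 3P$ such that $A$ is isomorphic to $A_0\times\mathbb F_p^{n-1-s}$, where, with $a=(m+2)/2\in\mathbb F_p$, $A_0\subseteq\mathbb F_p\times\mathbb F_p^s$ is $\{(a-1,0)\}\sqcup(\{a\}\times(\mathbb F_p^s\setminus P))\sqcup([a+1,a+m-2]\times\mathbb F_p^s)\sqcup(\{a+m-1\}\times(\mathbb F_p^s\setminus\{0\}))\sqcup(\{a+m\}\times P)$. The function $T$: a finite $X\subseteq\mathbb F_p$ has the covering property if it is contained in an arithmetic progression of length $|X+X|-|X|+1$. For $c\in(0,1)$, $\tau\in(0,1]$ is feasible for $c$ if (for every prime $p$) every $X\subseteq\mathbb F_p$ with $|X|\le cp$ and $|X+X|\le(2+\tau)|X|-3$ has the covering property; $\tau(c)$ is the supremum of feasible $\tau$ and $T(c)=1/\tau(c)$. *)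

theory Defs
  imports
    "HOL-Library.Extended_Nonnegative_Real"
    "HOL-Algebra.Module"
    "HOL-Number_Theory.Number_Theory"
begin

section \<open>The spaces $F_p^n$\<close>

abbreviation F :: "nat \<Rightarrow> int ring" where
  "F p \<equiv> residue_ring (int p)"

text \<open>
  Vectors of $F_p^n$ are lists of length \<open>n\<close> of residues, so that
  $F_p^i \times F_p^j$ is identified with $F_p^{i+j}$ by concatenation.  Only the
  \<open>F p\<close>-module structure is used below; the componentwise \<open>mult\<close> and \<open>one\<close> merely
  fill the record.
\<close>

definition Fvec :: "nat \<Rightarrow> nat \<Rightarrow> (int, int list) module" where
  "Fvec p n =
    \<lparr>carrier = {x. length x = n \<and> set x \<subseteq> carrier (F p)},
     monoid.mult = map2 (monoid.mult (F p)),
     one = replicate n \<one>\<^bsub>F p\<^esub>,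
     zero = replicate n \<zero>\<^bsub>F p\<^esub>,
     add = map2 (add (F p)),
     smult = (\<lambda>c. map (monoid.mult (F p) c))\<rparr>"

definition append_prod :: "int list set \<Rightarrow> int list set \<Rightarrow> int list set" where
  "append_prod B C = {x @ y | x y. x \<in> B \<and> y \<in> C}"

definition cons_prod :: "int set \<Rightarrow> int list set \<Rightarrow> int list set" where
  "cons_prod S C = {t # y | t y. t \<in> S \<and> y \<in> C}"

text \<open>
  The cyclic interval \<open>[a, b]\<close>, which starts at \<open>a\<close> and stops when \<open>b\<close> is first
  reached; \<open>a\<close> and \<open>b\<close> may be arbitrary integer representatives.
\<close>

definition cyc_interval :: "nat \<Rightarrow> int \<Rightarrow> int \<Rightarrow> int set" where
  "cyc_interval p a b = (\<lambda>i. (a + i) mod int p) ` {0..(b - a) mod int p}"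

definition F_isomorphic :: "nat \<Rightarrow> nat \<Rightarrow> int list set \<Rightarrow> int list set \<Rightarrow> bool" where
  "F_isomorphic p n A B \<longleftrightarrow>
    (\<exists>\<phi> \<in> iso (add_monoid (Fvec p n)) (add_monoid (Fvec p n)). \<phi> ` A = B)"

section \<open>Sum-free sets\<close>

definition hfold_sumset :: "('a, 'b) ring_scheme \<Rightarrow> nat \<Rightarrow> 'a set \<Rightarrow> 'a set" where
  "hfold_sumset G h X = {finsum G x {1..h} | x. \<forall>i\<in>{1..h}. x i \<in> X}"

definition sum_free_3_1 :: "nat \<Rightarrow> nat \<Rightarrow> int list set \<Rightarrow> bool" where
  "sum_free_3_1 p n A \<longleftrightarrow>
    A \<noteq> {} \<and> A \<subseteq> carrier (Fvec p n) \<and> hfold_sumset (Fvec p n) 3 A \<inter> A = {}"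

definition extremal_cuboid :: "nat \<Rightarrow> nat \<Rightarrow> nat \<Rightarrow> int list set" where
  "extremal_cuboid p m n =
    (let a0 = (- (3 * int m + 1) * modular_inverse (int p) 2) mod int p
     in cons_prod (cyc_interval p a0 (a0 + int m)) (carrier (Fvec p (n - 1))))"

definition trivial_sum_free :: "nat \<Rightarrow> nat \<Rightarrow> nat \<Rightarrow> int list set \<Rightarrow> bool" where
  "trivial_sum_free p m n A \<longleftrightarrow>
    sum_free_3_1 p n A \<and> (\<exists>B. B \<subseteq> extremal_cuboid p m n \<and> F_isomorphic p n A B)"

definition nontrivial_sum_free :: "nat \<Rightarrow> nat \<Rightarrow> nat \<Rightarrow> int list set \<Rightarrow> bool" where
  "nontrivial_sum_free p m n A \<longleftrightarrow> sum_free_3_1 p n A \<and> \<not> trivial_sum_free p m n A"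

section \<open>Types\<close>

definition type1 :: "nat \<Rightarrow> nat \<Rightarrow> nat \<Rightarrow> int list set \<Rightarrow> bool" where
  "type1 p m n A \<longleftrightarrow>
    card A = m * p ^ (n - 1) \<and>
    (\<exists>a \<in> carrier (F p).
      [a - 3 * (a + int m - 1) = 1] (mod int p) \<and>
      F_isomorphic p n A
        (cons_prod (cyc_interval p a (a + int m - 1)) (carrier (Fvec p (n - 1)))))"

definition type2 :: "nat \<Rightarrow> nat \<Rightarrow> nat \<Rightarrow> int list set \<Rightarrow> bool" where
  "type2 p m n A \<longleftrightarrow>
    card A = m * p ^ (n - 1) \<and> n \<ge> 2 \<and>
    (let W = Fvec p (n - 1); a = (3 * int m * modular_inverse (int p) (1 - 3)) mod int p
     in \<exists>V. submodule V (F p) W \<and> V \<noteq> carrier W \<and>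
          F_isomorphic p n A
            (cons_prod {a} (carrier W - V) \<union>
             cons_prod (cyc_interval p (a + 1) (a + int m - 1)) (carrier W) \<union>
             cons_prod {(a + int m) mod int p} V))"

definition normal_type :: "nat \<Rightarrow> nat \<Rightarrow> nat \<Rightarrow> int list set \<Rightarrow> bool" where
  "normal_type p m n A \<longleftrightarrow> type1 p m n A \<or> type2 p m n A"

definition type5_base :: "nat \<Rightarrow> nat \<Rightarrow> nat \<Rightarrow> int list set \<Rightarrow> int list set" where
  "type5_base p m s P =
    (let W = Fvec p s; a = ((int m + 2) * modular_inverse (int p) 2) mod int p
     in cons_prod {(a - 1) mod int p} {\<zero>\<^bsub>W\<^esub>} \<union>
        cons_prod {a} (carrier W - P) \<union>
        cons_prod (cyc_interval p (a + 1) (a + int m - 2)) (carrier W) \<union>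
        cons_prod {(a + int m - 1) mod int p} (carrier W - {\<zero>\<^bsub>W\<^esub>}) \<union>
        cons_prod {(a + int m) mod int p} P)"

definition type5 :: "nat \<Rightarrow> nat \<Rightarrow> nat \<Rightarrow> int list set \<Rightarrow> bool" where
  "type5 p m n A \<longleftrightarrow>
    card A = m * p ^ (n - 1) \<and>
    (\<exists>s P. s \<le> n - 1 \<and> P \<noteq> {} \<and> P \<subseteq> carrier (Fvec p s) \<and>
      \<zero>\<^bsub>Fvec p s\<^esub> \<notin> hfold_sumset (Fvec p s) 3 P \<and>
      F_isomorphic p n A
        (append_prod (type5_base p m s P) (carrier (Fvec p (n - 1 - s)))))"

section \<open>The function $T$\<close>

definition arith_prog :: "nat \<Rightarrow> nat \<Rightarrow> int set \<Rightarrow> bool" where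
  "arith_prog p L Q \<longleftrightarrow>
    (\<exists>a \<in> carrier (F p). \<exists>d \<in> carrier (F p). d \<noteq> 0 \<and>
      Q = {(a + int i * d) mod int p | i. i < L})"

text \<open>
  The natural-number subtraction does not truncate, since \<open>X + X\<close> has at least
  as many elements as \<open>X\<close> for every \<open>X \<subseteq> carrier (F p)\<close>.
\<close>

definition covering_property :: "nat \<Rightarrow> int set \<Rightarrow> bool" where
  "covering_property p X \<longleftrightarrow>
    (\<exists>Q. arith_prog p (card (X <+>\<^bsub>F p\<^esub> X) - card X + 1) Q \<and> X \<subseteq> Q)"

definition feasible :: "real \<Rightarrow> real \<Rightarrow> bool" where
  "feasible c \<tau> \<longleftrightarrow> 0 < \<tau> \<and> \<tau> \<le> 1 \<and>
    (\<forall>p X. prime p \<longrightarrow> X \<subseteq> carrier (F p) \<longrightarrow>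
       real (card X) \<le> c * real p \<longrightarrow>
       real (card (X <+>\<^bsub>F p\<^esub> X)) \<le> (2 + \<tau>) * real (card X) - 3 \<longrightarrow>
       covering_property p X)"

text \<open>
  Both functions are valued in \<open>[0, \<infinity>]\<close>, so that \<open>\<tau>(c) = 0\<close> and \<open>T(c) = \<infinity>\<close>
  would hold if no \<open>\<tau>\<close> were feasible for \<open>c\<close>; a real-valued supremum or quotient
  would take a meaningless value there.
\<close>

definition tau_sup :: "real \<Rightarrow> ennreal" where
  "tau_sup c = (SUP \<tau> \<in> {\<tau>. feasible c \<tau>}. ennreal \<tau>)"

definition T :: "real \<Rightarrow> ennreal" where
  "T c = 1 / tau_sup c"

end

theory Submission
  imports Defs "HOL-Analysis.Analysis" "HOL-Algebra.Generated_Groups" "HOL-Library.Set_Algebras"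
begin

text \<open>
Write \<open>N = p^(n-1)\<close>. As \<open>3A\<close> misses \<open>A\<close>, the sum of \<open>c^3 cnj c\<close> over all Fourier coefficients \<open>c\<close> of
the indicator of \<open>A\<close> vanishes; comparing it with Parseval's identity, some nontrivial
Fourier coefficient of \<open>A\<close> is at least \<open>|A| sqrt (m / (3m+3))\<close> in modulus. Take the corresponding
functional as first coordinate and let \<open>A_i\<close> be the fibres. If \<open>i + j + k = l\<close>, then
\<open>A_i + A_j + A_k\<close> misses \<open>A_l\<close>, whence any two of these fibres (if nonempty) have total size at most \<open>N\<close>,
and all four together at most \<open>N + 2N/p\<close>. Applying Cauchy--Davenport to the level sets of \<open>|A_i|\<close> shows,
with the large Fourier coefficient, that some fibre is more than half full and then that at most \<open>m + 2\<close>
fibres are nonempty. The large Fourier coefficient also puts many of the more than half full fibres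
into half of the cycle, where Freiman's \<open>3k-4\<close> theorem applies; after a dilation all nonempty fibres lie over
an interval of at most \<open>m + 8\<close> residues. Finally, if the nonempty fibres span the residues \<open>y, ..., y + L - 1\<close>, then a matching
argument keeps \<open>2y\<close>, \<open>2y + L - 1\<close> and \<open>2y + 2(L - 1)\<close> at distance at least \<open>m\<close> from 0, which leaves
\<open>L \<le> m + 2\<close> and a handful of positions; in each of them equality in the size conditions determines the fibres.
\<close>

section \<open>Small sumsets of integers\<close>

text \<open>Passing to fibre sizes leaves only weights on the cycle, and pigeonhole and
  Cauchy-Davenport bounds on weights say how many fibres there are, not where they lie. Position has
  to come from small doubling, and the \<open>3k-4\<close> theorem is about integers, where sums do
  not wrap around. Two estimates make it applicable. A Fourier coefficient of relative size g puts a
  share (1 + g)/2 of the weight on half of the cycle; g is near 1/sqrt 3, so the share is about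
  0.78. And the residues \<open>B\<close> of the more than half full fibres satisfy:
  \<open>B + B + Y\<close> misses the support \<open>Y\<close>, so Cauchy-Davenport gives
  \<open>|B + B| <= p + 1 - 2 |Y|\<close>, about 2m, which is below 3 times 0.78 m. Thus small
  doubling is a consequence of sum-freeness, and the part of \<open>B\<close> in one half of the
  cycle behaves like a set of integers. The remaining difficulty is that all counts must be right up
  to a bounded error: \<open>|Y|\<close> is confined to \<open>m\<close>, \<open>m + 1\<close>,
  \<open>m + 2\<close>. This is why levels of the weight are paired off instead of being estimated
  one by one, and why the oddness of \<open>N\<close> is exploited to make inequalities
  strict.\<close>

definition primitive :: "int set \<Rightarrow> bool" where
  "primitive A \<longleftrightarrow> (\<forall>d. (\<forall>x\<in>A. \<forall>y\<in>A. d dvd x - y) \<longrightarrow> \<bar>d\<bar> = 1)"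

text \<open>
  The pigeonhole principle puts \<open>x + a\<close> into \<open>A + A\<close> if the walk is negative at \<open>x + 1\<close>, and
  \<open>x + l\<close> (with \<open>l = Max A\<close>) if its value at \<open>x\<close> is at least the value at \<open>l\<close>.
\<close>

definition walk :: "int set \<Rightarrow> int \<Rightarrow> int \<Rightarrow> int" where
  "walk A a x = x - a - 2 * int (card {y\<in>A. y < x})"

text \<open>The reflection of \<open>B\<close> in the centre of \<open>[u, v]\<close> lies in the
  same interval, and two subsets of more than half its size must meet.\<close>

lemma sum_endpoints_mem:
  fixes B :: "int set"
  assumes "B \<subseteq> {u..v}" and "int (2 * card B) > v - u + 1" and "u \<le> v + 1"
  shows "u + v \<in> B + B"
proof -
  have fin: "finite B" using assms(1) finite_subset by blast
  define C where "C = (\<lambda>c. u + v - c) ` B"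
  have C: "C \<subseteq> {u..v}" using assms(1) by (force simp: C_def)
  have cC: "card C = card B" unfolding C_def by (rule card_image) (auto simp: inj_on_def)
  have "B \<inter> C \<noteq> {}"
  proof
    assume "B \<inter> C = {}"
    then have "card (B \<union> C) = 2 * card B"
      using fin cC card_Un_disjoint[of B C] by (simp add: C_def)
    moreover have "card (B \<union> C) \<le> card {u..v}" by (rule card_mono) (use assms(1) C in auto)
    ultimately show False using assms(2,3) by simp
  qed
  then obtain c where "c \<in> B" "u + v - c \<in> B" by (auto simp: C_def)
  then show ?thesis using set_plus_intro[of c B "u+v-c" B] by simp
qed

lemma walk_Suc:
  assumes "finite A"
  shows "walk A a (x + 1) = walk A a x + (if x \<in> A then -1 else 1)"
proof (cases "x \<in> A")
  case True
  then have "{y\<in>A. y < x + 1} = insert x {y\<in>A. y < x}" by auto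
  then show ?thesis using True assms by (simp add: walk_def)
next
  case False
  then have "{y\<in>A. y < x + 1} = {y\<in>A. y < x}" using order_le_less by auto
  then show ?thesis using False by (simp add: walk_def)
qed

lemma card_int_image_add: "card ((\<lambda>x::int. x + a) ` S) = card S"
  by (rule card_image) (auto simp: inj_on_def)

lemma walk_start:
  assumes "A \<subseteq> {a..l}" shows "walk A a a = 0"
proof -
  have "{y\<in>A. y < a} = {}" using assms by auto
  then show ?thesis by (simp only: walk_def card.empty)
qed

text \<open>This value is negative exactly in the dense range \<open>2 * card A >= l - a + 3\<close>
  of \<open>card_sumset_dense\<close>; its sign separates the dense case from the sparse
  one.\<close>

lemma walk_end:
  assumes "A \<subseteq> {a..l}" "l \<in> A" shows "walk A a l = l - a - 2 * int (card A) + 2"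
proof -
  have fin: "finite A" using assms(1) finite_subset by blast
  have "{y\<in>A. y < l} = A - {l}" using assms by force
  moreover have "card A \<ge> 1" using assms(2) fin by (simp add: Suc_le_eq card_gt_0_iff) blast
  ultimately show ?thesis using assms(2) fin by (simp add: walk_def card_Diff_singleton)
qed

text \<open>Reducing \<open>A + A\<close> modulo \<open>l - a\<close>: members of \<open>A\<close> are counted twice, and the
  pigeonhole principle provides one further sum for each of the listed non-members.\<close>

lemma card_sumset_ge_walk:
  assumes A: "A \<subseteq> {a..l}" "a \<in> A" "l \<in> A"
  shows "card (A + A) + 1 \<ge> 2 * card A +
    card {x\<in>{a..l}. x \<notin> A \<and> (walk A a (x + 1) < 0 \<or> walk A a x \<ge> walk A a l)}"
proof -
  have fin: "finite A" using A(1) finite_subset by blast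
  define U1 where "U1 = {x\<in>{a..l}. x \<notin> A \<and> walk A a (x + 1) < 0}"
  define U2 where "U2 = {x\<in>{a..l}. x \<notin> A \<and> walk A a x \<ge> walk A a l}"
  have al: "a \<le> l" using A by auto
  have low: "x + a \<in> A + A" if "x \<in> U1" for x
  proof -
    have "int (2 * card {y\<in>A. y < x + 1}) > x - a + 1"
      using that by (simp add: U1_def walk_def)
    moreover have sub: "{y\<in>A. y < x + 1} \<subseteq> {a..x}" using A(1) by auto
    ultimately have "a + x \<in> {y\<in>A. y < x + 1} + {y\<in>A. y < x + 1}"
      using that by (intro sum_endpoints_mem) (auto simp: U1_def)
    then show ?thesis by (auto simp: set_plus_def algebra_simps)
  qed
  have high: "x + l \<in> A + A" if "x \<in> U2" for x
  proof -
    have "card A = card {y\<in>A. y < x} + card {y\<in>A. y \<ge> x}"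
      using fin by (subst card_Un_disjoint[symmetric]) (auto intro: arg_cong[where f=card])
    then have "int (2 * card {y\<in>A. y \<ge> x}) > l - x + 1"
      using that walk_end[OF A(1,3)] by (simp add: U2_def walk_def)
    then have "x + l \<in> {y\<in>A. y \<ge> x} + {y\<in>A. y \<ge> x}"
      using that A(1) by (intro sum_endpoints_mem) (auto simp: U2_def)
    then show ?thesis by (auto simp: set_plus_def)
  qed
  \<comment> \<open>\<open>S1\<close> collects sums below \<open>a + l\<close> and \<open>S2\<close>
    sums from \<open>a + l\<close> on. The member \<open>l\<close> is left out of \<open>S1\<close>
    because \<open>l + a\<close> is already in \<open>S2\<close>.\<close>
  define S1 where "S1 = (\<lambda>x. x + a) ` ((A - {l}) \<union> U1)"
  define S2 where "S2 = (\<lambda>x. x + l) ` (A \<union> U2)"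
  have finU: "finite U1" "finite U2"
    by (auto simp: U1_def U2_def intro: finite_subset[of _ "{a..l}"])
  have disj: "S1 \<inter> S2 = {}"
  proof -
    have "x + a < a + l" if "x \<in> (A - {l}) \<union> U1" for x
    proof -
      have "x \<le> l" "x \<noteq> l" using that A by (auto simp: U1_def)
      then show ?thesis by simp
    qed
    moreover have "x + l \<ge> a + l" if "x \<in> A \<union> U2" for x
      using that A by (auto simp: U2_def)
    ultimately show ?thesis unfolding S1_def S2_def by fastforce
  qed
  have sub: "S1 \<union> S2 \<subseteq> A + A"
    using low high A(2,3) by (auto simp: S1_def S2_def intro: set_plus_intro)
  have "card S1 = card (A - {l}) + card U1"
    unfolding S1_def card_int_image_add
    by (rule card_Un_disjoint) (use fin finU in \<open>auto simp: U1_def\<close>)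
  moreover have "card S2 = card A + card U2"
    unfolding S2_def card_int_image_add
    by (rule card_Un_disjoint) (use fin finU in \<open>auto simp: U2_def\<close>)
  moreover have "card (S1 \<union> S2) = card S1 + card S2"
    by (rule card_Un_disjoint) (use disj fin finU in \<open>auto simp: S1_def S2_def\<close>)
  moreover have "card (S1 \<union> S2) \<le> card (A + A)"
    by (rule card_mono) (use sub fin in \<open>auto simp: finite_set_plus\<close>)
  moreover have "card (A - {l}) + 1 = card A"
    using A(3) fin by (metis Suc_eq_plus1 card_Suc_Diff1)
  moreover have "card {x\<in>{a..l}. x \<notin> A \<and> (walk A a (x + 1) < 0 \<or> walk A a x \<ge> walk A a l)}
      \<le> card U1 + card U2"
  proof -
    have "{x\<in>{a..l}. x \<notin> A \<and> (walk A a (x + 1) < 0 \<or> walk A a x \<ge> walk A a l)} = U1 \<union> U2"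
      by (auto simp: U1_def U2_def)
    then show ?thesis by (simp add: card_Un_le)
  qed
  ultimately show ?thesis by linarith
qed

lemma card_interval_minus:
  assumes "A \<subseteq> {a..l}" "a \<le> l + 1"
  shows "int (card {x\<in>{a..l}. x \<notin> A}) = l - a + 1 - int (card A)"
proof -
  have fin: "finite A" using assms(1) finite_subset by blast
  have "{x\<in>{a..l}. x \<notin> A} = {a..l} - A" by auto
  then have "card {x\<in>{a..l}. x \<notin> A} = card {a..l} - card A"
    using assms fin by (simp add: card_Diff_subset)
  moreover have "card A \<le> card {a..l}" using assms by (intro card_mono) auto
  ultimately show ?thesis using assms(2) by simp
qed

text \<open>The walk ends below zero. A non-member whose value is below the final one therefore
  stays negative after its upward step, so every non-member is counted in
  \<open>card_sumset_ge_walk\<close>.\<close>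

lemma card_sumset_dense:
  assumes A: "A \<subseteq> {a..l}" "a \<in> A" "l \<in> A" and "l - a + 3 \<le> 2 * int (card A)"
  shows "int (card (A + A)) \<ge> int (card A) + (l - a)"
proof -
  have fin: "finite A" using A(1) finite_subset by blast
  have "{x\<in>{a..l}. x \<notin> A \<and> (walk A a (x + 1) < 0 \<or> walk A a x \<ge> walk A a l)}
    = {x\<in>{a..l}. x \<notin> A}"
  proof -
    have "walk A a (x + 1) < 0 \<or> walk A a x \<ge> walk A a l" if "x \<notin> A" for x
      using walk_Suc[OF fin, of a x] walk_end[OF A(1,3)] that assms(4) by auto
    then show ?thesis by auto
  qed
  then show ?thesis
    using card_sumset_ge_walk[OF A] card_interval_minus[OF A(1)] A by auto
qed

text \<open>Clamp the walk to \<open>[-1, P]\<close>, where \<open>P\<close> is its final value. The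
  clamped walk rises exactly at the counted non-members and falls only at \<open>a\<close> and at
  \<open>l\<close>, because every other member lies outside the strip. Telescoping gives the
  count.\<close>

lemma walk_crossings:
  assumes A: "A \<subseteq> {a..l}" "a \<in> A" "l \<in> A" "a < l" and nn: "walk A a l \<ge> 0"
    and none: "\<And>z. z \<in> A \<Longrightarrow> a < z \<Longrightarrow> z < l \<Longrightarrow> walk A a z < 0 \<or> walk A a z > walk A a l"
  shows "int (card {x\<in>{a..l}. x \<notin> A \<and> -1 \<le> walk A a x \<and> walk A a x < walk A a l})
    = walk A a l + 1"
proof -
  have fin: "finite A" using A(1) finite_subset by blast
  let ?w = "walk A a" and ?P = "walk A a l"
  define \<tau> where "\<tau> v = max (-1) (min v ?P)" for v
  define M where "M = {x\<in>{a..l}. x \<notin> A \<and> -1 \<le> ?w x \<and> ?w x < ?P}"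
  have step: "\<tau> (?w (x + 1)) - \<tau> (?w x)
      = of_bool (x \<in> M) - of_bool (x = a) - of_bool (x = l)" if "x \<in> {a..l}" for x
  proof (cases "x \<in> A")
    case False
    then show ?thesis using that A(2,3) nn walk_Suc[OF fin, of a x]
      by (auto simp: \<tau>_def M_def)
  next
    case True
    have xM: "x \<notin> M" using True by (simp add: M_def)
    consider "x = a" | "x = l" | "a < x" "x < l" using \<open>x \<in> {a..l}\<close> by force
    then show ?thesis
    proof cases
      case 1 then show ?thesis using True xM A(4) nn walk_Suc[OF fin, of a x] walk_start[OF A(1)]
        by (simp add: \<tau>_def)
    next
      case 2 then show ?thesis using True xM A(4) nn walk_Suc[OF fin, of a x]
        by (simp add: \<tau>_def)
    next
      case 3 then show ?thesis using True xM none[OF True] nn walk_Suc[OF fin, of a x]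
        by (auto simp: \<tau>_def)
    qed
  qed
  have tel: "(\<Sum>x\<in>{a..b}. \<tau> (?w (x + 1)) - \<tau> (?w x)) = \<tau> (?w (b + 1)) - \<tau> (?w a)" if "a \<le> b" for b
    using that
  proof (induction b rule: int_ge_induct)
    case base then show ?case by simp
  next
    case (step b)
    then have "{a..b+1} = insert (b + 1) {a..b}" by auto
    then show ?case using step by simp
  qed
  have "(\<Sum>x\<in>{a..l}. \<tau> (?w (x + 1)) - \<tau> (?w x))
      = (\<Sum>x\<in>{a..l}. of_bool (x \<in> M) - of_bool (x = a) - of_bool (x = l))"
    using step by (rule sum.cong[OF refl])
  also have "\<dots> = int (card M) - 2"
  proof -
    have "M = {a..l} \<inter> M" by (auto simp: M_def)
    moreover have "a \<in> {a..l}" "l \<in> {a..l}" using A(4) by auto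
    ultimately show ?thesis by (simp add: sum_subtractf of_bool_def sum.If_cases)
  qed
  finally have "int (card M) - 2 = \<tau> (?w (l + 1)) - \<tau> (?w a)" using tel[of l] A(4) by simp
  also have "\<dots> = ?P - 1"
    using walk_start[OF A(1)] walk_Suc[OF fin, of a l] A(3) nn by (simp add: \<tau>_def)
  finally show ?thesis by (simp add: M_def)
qed

text \<open>The non-members that \<open>card_sumset_ge_walk\<close> fails to count all lie in the
  strip of \<open>walk_crossings\<close>, so exactly \<open>P + 1\<close> of them are lost; the hull
  length cancels.\<close>

lemma card_sumset_no_crossing:
  assumes A: "A \<subseteq> {a..l}" "a \<in> A" "l \<in> A" "a < l" and nn: "walk A a l \<ge> 0"
    and none: "\<And>z. z \<in> A \<Longrightarrow> a < z \<Longrightarrow> z < l \<Longrightarrow> walk A a z < 0 \<or> walk A a z > walk A a l"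
  shows "card (A + A) + 3 \<ge> 3 * card A"
proof -
  have fin: "finite A" using A(1) finite_subset by blast
  let ?w = "walk A a" and ?P = "walk A a l"
  let ?M = "{x\<in>{a..l}. x \<notin> A \<and> -1 \<le> ?w x \<and> ?w x < ?P}"
  let ?U = "{x\<in>{a..l}. x \<notin> A \<and> (?w (x + 1) < 0 \<or> ?w x \<ge> ?P)}"
  have "{x\<in>{a..l}. x \<notin> A} \<subseteq> ?M \<union> ?U"
    using walk_Suc[OF fin, of a] by auto
  moreover have "finite (?M \<union> ?U)" by (rule finite_subset[of _ "{a..l}"]) auto
  ultimately have "card {x\<in>{a..l}. x \<notin> A} \<le> card (?M \<union> ?U)" by (rule card_mono[rotated])
  also have "\<dots> \<le> card ?M + card ?U" by (rule card_Un_le)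
  finally have "card {x\<in>{a..l}. x \<notin> A} \<le> card ?M + card ?U" .
  then show ?thesis
    using walk_crossings[OF A nn none] card_sumset_ge_walk[OF A(1,2,3)] card_interval_minus[OF A(1)]
      walk_end[OF A(1,3)] A(4) by linarith
qed


lemma card_sumset_ge_doubled:
  fixes A :: "int set"
  assumes "finite A" "A \<noteq> {}"
  shows "card (A + A) + 1 \<ge> 2 * card A"
proof -
  have "A \<subseteq> {Min A..Max A}" using assms by auto
  then show ?thesis
    using card_sumset_ge_walk[of A "Min A" "Max A"] Min_in[OF assms] Max_in[OF assms] by linarith
qed

lemma primitive_less:
  assumes "primitive A" "A \<subseteq> {a..l}" "a \<in> A" shows "a < l"
proof (rule ccontr)
  assume "\<not> a < l"
  then have "A = {a}" using assms(2,3) by force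
  have "(\<forall>x\<in>A. \<forall>y\<in>A. 0 dvd x - y) \<longrightarrow> \<bar>0::int\<bar> = 1"
    using assms(1) unfolding primitive_def by (rule spec)
  then show False using \<open>A = {a}\<close> by simp
qed

lemma primitive_consecutive:
  assumes "z \<in> A" "z + 1 \<in> A" shows "primitive A"
  unfolding primitive_def
proof (intro allI impI)
  fix d assume "\<forall>x\<in>A. \<forall>y\<in>A. d dvd x - y"
  then have "d dvd (z + 1) - z" using assms by blast
  then show "\<bar>d\<bar> = 1" by simp
qed

text \<open>If the cut at \<open>z\<close> creates no new sums, then all of \<open>A\<close> lies in one residue class modulo \<open>z - x\<close>.\<close>

lemma sums_through_cut:
  fixes A :: "int set"
  assumes fin: "finite A" and z: "x \<in> A" "z \<in> A" "y \<in> A"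
    and x: "x < z" "\<And>w. w \<in> A \<Longrightarrow> w < z \<Longrightarrow> w \<le> x"
    and y: "z < y" "\<And>w. w \<in> A \<Longrightarrow> z < w \<Longrightarrow> y \<le> w"
    and cover: "A + A \<subseteq> ({w\<in>A. w \<le> z} + {w\<in>A. w \<le> z}) \<union> ({w\<in>A. z \<le> w} + {w\<in>A. z \<le> w})"
    and prim: "primitive A"
  shows "x = z - 1 \<and> y = z + 1"
proof -
  have cov: "(\<exists>p\<in>A. \<exists>q\<in>A. p \<le> z \<and> q \<le> z \<and> u + v = p + q) \<or>
      (\<exists>p\<in>A. \<exists>q\<in>A. z \<le> p \<and> z \<le> q \<and> u + v = p + q)" if "u \<in> A" "v \<in> A" for u v
  proof -
    have "u + v \<in> ({w\<in>A. w \<le> z} + {w\<in>A. w \<le> z}) \<union> ({w\<in>A. z \<le> w} + {w\<in>A. z \<le> w})"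
      using cover set_plus_intro[OF that] by blast
    then show ?thesis by (auto elim!: set_plus_elim)
  qed
  \<comment> \<open>A representation of \<open>x + y\<close> on one side of \<open>z\<close> must
    use \<open>z\<close> twice: any other summand on the left is at most \<open>x\<close> while its
    partner is below \<open>y\<close>, and symmetrically on the right.\<close>
  have xy: "x + y = 2 * z"
  proof (rule ccontr)
    assume ne: "x + y \<noteq> 2 * z"
    from cov[OF z(1) z(3)] show False
    proof (elim disjE bexE conjE)
      fix p q assume *: "p \<in> A" "q \<in> A" "p \<le> z" "q \<le> z" "x + y = p + q"
      then show False using x(2)[of p] x(2)[of q] ne y(1) by (cases "p = z"; cases "q = z") auto
    next
      fix p q assume *: "p \<in> A" "q \<in> A" "z \<le> p" "z \<le> q" "x + y = p + q"
      then show False using y(2)[of p] y(2)[of q] ne x(1) by (cases "p = z"; cases "q = z") auto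
    qed
  qed
  define d where "d = z - x"
  have d: "d > 0" "x = z - d" "y = z + d" using x(1) xy by (auto simp: d_def)
  \<comment> \<open>Adding the left neighbour \<open>x\<close> to a far member \<open>v\<close> and
    rewriting the sum to the right of \<open>z\<close> expresses \<open>v\<close> by members
    strictly closer to \<open>z\<close>, so divisibility by \<open>d\<close> propagates outwards.
    \<open>left\<close> is the mirror image.\<close>
  have right: "v \<in> A \<Longrightarrow> z \<le> v \<Longrightarrow> d dvd v - z" for v
  proof (induction "nat (v - z)" arbitrary: v rule: less_induct)
    case less
    show ?case
    proof (cases "v \<le> y")
      case True
      then have "v = z \<or> v = y" using y(2)[of v] less(2,3) by force
      then show ?thesis using d by auto
    next
      case False
      from cov[OF z(1) less(2)] obtain p q where pq: "p \<in> A" "q \<in> A" "z \<le> p" "z \<le> q" "x + v = p + q"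
      proof (elim disjE bexE conjE)
        fix p q assume *: "p \<in> A" "q \<in> A" "p \<le> z" "q \<le> z" "x + v = p + q"
        then show ?thesis using False d by auto
      qed (auto intro: that)
      then have "p < v" "q < v" using d by auto
      then have "d dvd p - z" "d dvd q - z" using less(1) pq by auto
      then have "d dvd (p - z) + (q - z) + d" by (intro dvd_add) auto
      moreover have "(p - z) + (q - z) + d = v - z" using pq d by auto
      ultimately show ?thesis by (simp only:)
    qed
  qed
  have left: "v \<in> A \<Longrightarrow> v \<le> z \<Longrightarrow> d dvd v - z" for v
  proof (induction "nat (z - v)" arbitrary: v rule: less_induct)
    case less
    show ?case
    proof (cases "x \<le> v")
      case True
      then have "v = z \<or> v = x" using x(2)[of v] less(2,3) by force
      then show ?thesis using d by auto
    next
      case False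
      from cov[OF z(3) less(2)] obtain p q where pq: "p \<in> A" "q \<in> A" "p \<le> z" "q \<le> z" "y + v = p + q"
      proof (elim disjE bexE conjE)
        fix p q assume *: "p \<in> A" "q \<in> A" "z \<le> p" "z \<le> q" "y + v = p + q"
        then show ?thesis using False d by auto
      qed (auto intro: that)
      then have "v < p" "v < q" using d by auto
      then have "d dvd p - z" "d dvd q - z" using less(1) pq by auto
      then have "d dvd (p - z) + (q - z) - d" by (rule dvd_diff[OF dvd_add dvd_refl])
      moreover have "(p - z) + (q - z) - d = v - z" using pq d by auto
      ultimately show ?thesis by (simp only:)
    qed
  qed
  have "d dvd u - v" if "u \<in> A" "v \<in> A" for u v
  proof -
    have "d dvd u - z" using left[OF that(1)] right[OF that(1)] by linarith
    moreover have "d dvd v - z" using left[OF that(2)] right[OF that(2)] by linarith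
    ultimately have "d dvd (u - z) - (v - z)" by (rule dvd_diff)
    then show ?thesis by simp
  qed
  then have "\<bar>d\<bar> = 1" using prim by (simp add: primitive_def)
  then show ?thesis using d by auto
qed

lemma card_halves:
  fixes A :: "int set"
  assumes "finite A" "z \<in> A"
  shows "card {w\<in>A. w \<le> z} + card {w\<in>A. z \<le> w} = card A + 1"
proof -
  have "{w\<in>A. w \<le> z} \<union> {w\<in>A. z \<le> w} = A" by auto
  moreover have "{w\<in>A. w \<le> z} \<inter> {w\<in>A. z \<le> w} = {z}" using assms(2) by auto
  ultimately show ?thesis
    using card_Un_Int[of "{w\<in>A. w \<le> z}" "{w\<in>A. z \<le> w}"] assms(1) by simp
qed

text \<open>The two doubled parts can share only sums in \<open>[2 z, 2 z']\<close>: one sum for a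
  cut at a single point, three if the parts overlap in two consecutive integers. \<open>E\<close>
  collects sums that neither part produces.\<close>

lemma card_sumset_split:
  fixes A A1 A2 :: "int set"
  assumes "finite A" "A1 \<subseteq> A" "A2 \<subseteq> A" and A1: "\<And>w. w \<in> A1 \<Longrightarrow> w \<le> z'" and A2: "\<And>w. w \<in> A2 \<Longrightarrow> z \<le> w"
    and E: "E \<subseteq> A + A" "E \<inter> (A1 + A1) = {}" "E \<inter> (A2 + A2) = {}"
  shows "card (A1 + A1) + card (A2 + A2) + card E \<le> card (A + A) + card {2 * z..2 * z'}"
proof -
  have fin: "finite A1" "finite A2" using assms(1-3) finite_subset by blast+
  have finA: "finite (A + A)" using assms(1) by (simp add: finite_set_plus)
  have finE: "finite E" using E(1) finA finite_subset by blast
  have "(A1 + A1) \<inter> (A2 + A2) \<subseteq> {2 * z..2 * z'}"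
  proof
    fix x assume "x \<in> (A1 + A1) \<inter> (A2 + A2)"
    then obtain p q r s where "p \<in> A1" "q \<in> A1" "x = p + q" "r \<in> A2" "s \<in> A2" "x = r + s"
      by (auto elim!: set_plus_elim)
    then show "x \<in> {2 * z..2 * z'}" using A1[of p] A1[of q] A2[of r] A2[of s] by simp
  qed
  then have "card ((A1 + A1) \<inter> (A2 + A2)) \<le> card {2 * z..2 * z'}" by (intro card_mono) auto
  moreover have "card (A1 + A1) + card (A2 + A2)
      = card ((A1 + A1) \<union> (A2 + A2)) + card ((A1 + A1) \<inter> (A2 + A2))"
    using fin by (intro card_Un_Int) (auto simp: finite_set_plus)
  moreover have "card (((A1 + A1) \<union> (A2 + A2)) \<union> E) = card ((A1 + A1) \<union> (A2 + A2)) + card E"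
    using fin finE E by (intro card_Un_disjoint) (auto simp: finite_set_plus)
  moreover have "card (((A1 + A1) \<union> (A2 + A2)) \<union> E) \<le> card (A + A)"
    using finA assms(2,3) E(1) set_plus_mono2[of A1 A A1 A] set_plus_mono2[of A2 A A2 A]
    by (intro card_mono) auto
  ultimately show ?thesis by linarith
qed

text \<open>
  The cut is made at the first interior member of \<open>A\<close> whose walk value lies between 0 and the final value;
  the lower part then satisfies the bound without any hypothesis of primitivity.
\<close>

lemma card_sumset_sparse:
  "A \<subseteq> {a..l} \<Longrightarrow> a \<in> A \<Longrightarrow> l \<in> A \<Longrightarrow> primitive A \<Longrightarrow> 2 * int (card A) \<le> l - a + 3
    \<Longrightarrow> card (A + A) + 3 \<ge> 3 * card A"
proof (induction "card A" arbitrary: A a l rule: less_induct)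
  case less
  note A = less.prems(1-3) and prim = less.prems(4)
  have fin: "finite A" using A(1) finite_subset by blast
  have al: "a < l" using primitive_less[OF prim A(1,2)] .
  let ?w = "walk A a"
  have wl: "?w l = l - a - 2 * int (card A) + 2" by (rule walk_end[OF A(1,3)])
  show ?case
  proof (cases "?w l \<ge> 0")
    case False
    then show ?thesis using card_sumset_dense[OF A] less.prems(5) wl by linarith
  next
    case nn: True
    define Z where "Z = {z\<in>A. a < z \<and> z < l \<and> 0 \<le> ?w z \<and> ?w z \<le> ?w l}"
    show ?thesis
    proof (cases "Z = {}")
      case True
      then show ?thesis by (intro card_sumset_no_crossing[OF A al nn]) (force simp: Z_def)
    next
      case False
      define z where "z = Min Z"
      have finZ: "finite Z" using fin by (simp add: Z_def)
      have zZ: "z \<in> Z" unfolding z_def using False finZ by simp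
      then have z: "z \<in> A" "a < z" "z < l" "0 \<le> ?w z" "?w z \<le> ?w l" by (auto simp: Z_def)
      have zmin: "z \<le> w" if "w \<in> Z" for w unfolding z_def using that finZ by simp
      define A1 where "A1 = {w\<in>A. w \<le> z}"
      define A2 where "A2 = {w\<in>A. z \<le> w}"
      have A1: "A1 \<subseteq> {a..z}" "a \<in> A1" "z \<in> A1" and A2: "A2 \<subseteq> {z..l}" "z \<in> A2" "l \<in> A2"
        using A z by (auto simp: A1_def A2_def)
      have sub: "A1 \<subseteq> A" "A2 \<subseteq> A" by (auto simp: A1_def A2_def)
      have card12: "card A1 + card A2 = card A + 1"
        unfolding A1_def A2_def by (rule card_halves[OF fin z(1)])
      have fin12: "finite A1" "finite A2" using fin by (auto simp: A1_def A2_def)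
      have walk1: "walk A1 a x = ?w x" if "x \<le> z" for x
      proof -
        have "{y\<in>A1. y < x} = {y\<in>A. y < x}" using that by (auto simp: A1_def)
        then show ?thesis by (simp add: walk_def)
      qed
      have wz: "?w z = z - a - 2 * int (card A1) + 2"
        using walk_end[OF A1(1,3)] walk1[of z] by simp
      \<comment> \<open>The walk value at \<open>z\<close> is at most the final one, so the upper
        part is sparse again and the induction hypothesis is available for it if it is
        primitive.\<close>
      have lz: "2 * int (card A2) \<le> l - z + 2" using wz wl z(5) card12 by linarith
      have c1: "card (A1 + A1) + 3 \<ge> 3 * card A1"
      proof (rule card_sumset_no_crossing[OF A1 z(2)])
        show "walk A1 a z \<ge> 0" using walk1 z by simp
        fix w assume w: "w \<in> A1" "a < w" "w < z"
        then have "w \<notin> Z" using zmin by force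
        then show "walk A1 a w < 0 \<or> walk A1 a w > walk A1 a z"
          using w walk1[of w] walk1[of z] z by (auto simp: Z_def A1_def)
      qed
      have less2: "card A2 < card A"
      proof (rule psubset_card_mono[OF fin])
        have "a \<notin> A2" using z by (simp add: A2_def)
        then show "A2 \<subset> A" using sub A(2) by blast
      qed
      have split: "card (A1 + A1) + card (A2 + A2) + card E \<le> card (A + A) + 1"
        if "E \<subseteq> A + A" "E \<inter> (A1 + A1) = {}" "E \<inter> (A2 + A2) = {}" for E
        using card_sumset_split[OF fin sub, of z z E] that by (simp add: A1_def A2_def)
      show ?thesis
      proof (cases "primitive A2")
        case True
        then have c2: "card (A2 + A2) + 3 \<ge> 3 * card A2"
          using less.hyps[OF less2 A2 True] lz by linarith
        \<comment> \<open>The bounds for the two parts add up to \<open>3 * card A - 3\<close> and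
          the shared sum \<open>2 * z\<close> costs one, so a single sum outside both doubled parts
          is enough.\<close>
        show ?thesis
        proof (cases "A + A \<subseteq> (A1 + A1) \<union> (A2 + A2)")
          case False
          then obtain s where "s \<in> A + A" "s \<notin> A1 + A1" "s \<notin> A2 + A2" by blast
          then show ?thesis using split[of "{s}"] c1 c2 card12 by simp
        next
          case cover: True
          define x where "x = Max {w\<in>A. w < z}"
          define y where "y = Min {w\<in>A. z < w}"
          have "x \<in> {w\<in>A. w < z}" unfolding x_def by (rule Max_in) (use fin A z in auto)
          moreover have "w \<le> x" if "w \<in> A" "w < z" for w
            unfolding x_def by (rule Max_ge) (use fin that in auto)
          moreover have "y \<in> {w\<in>A. z < w}" unfolding y_def by (rule Min_in) (use fin A z in auto)
          moreover have "y \<le> w" if "w \<in> A" "z < w" for w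
            unfolding y_def by (rule Min_le) (use fin that in auto)
          ultimately have "x = z - 1 \<and> y = z + 1"
            using cover prim unfolding A1_def A2_def by (intro sums_through_cut[OF fin _ z(1)]) auto
          then have z1: "z + 1 \<in> A" using \<open>y \<in> {w\<in>A. z < w}\<close> by auto
          \<comment> \<open>Without a new sum, \<open>z - 1\<close> and \<open>z + 1\<close> are
            members. Extending the lower part to \<open>z + 1\<close> raises its bound by 3 and the
            overlap only from one sum to three, which supplies the missing unit; the consecutive
            pair makes the enlarged part primitive.\<close>
          define A1' where "A1' = {w\<in>A. w \<le> z + 1}"
          have A1': "A1' = insert (z + 1) A1" using z1 by (auto simp: A1'_def A1_def)
          then have card1': "card A1' = card A1 + 1" using fin12 by (simp add: A1_def)
          have "z + 1 \<noteq> l"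
          proof
            assume "z + 1 = l"
            moreover have "card {z, l} \<le> card A2" by (rule card_mono) (use fin12 A2 in auto)
            ultimately show False using lz z(3) by simp
          qed
          then have "l \<notin> A1'" using z by (simp add: A1'_def)
          then have "A1' \<subset> A" using A(3) by (auto simp: A1'_def)
          then have "card A1' < card A" by (rule psubset_card_mono[OF fin])
          moreover have "A1' \<subseteq> {a..z + 1}" "a \<in> A1'" "z + 1 \<in> A1'" "z \<in> A1'"
            using A z z1 by (auto simp: A1'_def)
          moreover have "primitive A1'" using primitive_consecutive calculation by blast
          ultimately have "card (A1' + A1') + 3 \<ge> 3 * card A1'"
            using less.hyps[of A1' a "z + 1"] wz z(4) card1' by simp
          moreover have "card (A1' + A1') + card (A2 + A2) + card ({}::int set) \<le> card (A + A) + card {2 * z..2 * (z + 1)}"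
            by (rule card_sumset_split[OF fin]) (auto simp: A1'_def A2_def)
          ultimately show ?thesis using c2 card1' card12 by simp
        qed
      next
        case False
        then obtain d where d: "\<And>x y. x \<in> A2 \<Longrightarrow> y \<in> A2 \<Longrightarrow> d dvd x - y" "\<bar>d\<bar> \<noteq> 1"
          by (auto simp: primitive_def)
        define D where "D = {w\<in>A. \<not> d dvd w - z}"
        have "D \<noteq> {}"
        proof
          assume "D = {}"
          then have "d dvd u - v" if "u \<in> A" "v \<in> A" for u v
            using that dvd_diff[of d "u - z" "v - z"] by (auto simp: D_def)
          then show False using prim d(2) by (auto simp: primitive_def)
        qed
        define b where "b = Max D"
        have finD: "finite D" using fin by (simp add: D_def)
        have bD: "b \<in> D" unfolding b_def using finD \<open>D \<noteq> {}\<close> by simp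
        have bmax: "d dvd w - z" if "w \<in> A" "w > b" for w
          using that Max_ge[OF finD, of w] by (force simp: D_def b_def)
        have bz: "b < z" using bD d(1)[of b z] A2(2) by (force simp: D_def A2_def)
        \<comment> \<open>\<open>b\<close> is the largest member outside the residue class of
          \<open>A2\<close> modulo \<open>d\<close>, so these sums are not in
          \<open>A2 + A2\<close>. As a sum in \<open>A1 + A1\<close>, with both summands at most
          \<open>z < v\<close>, such a sum would need both summands above \<open>b\<close>, hence in
          the class. This gives \<open>card A2 - 1\<close> new sums, which offsets the weak bound
          \<open>2 * card A2 - 1\<close> for a part that is not primitive.\<close>
        define E where "E = (\<lambda>v. v + b) ` (A2 - {z})"
        have bA: "b \<in> A" "\<not> d dvd b - z" using bD by (auto simp: D_def)
        have "E \<subseteq> A + A" using bA sub by (auto simp: E_def intro: set_plus_intro)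
        moreover have "E \<inter> (A2 + A2) = {}"
        proof (rule ccontr)
          assume "E \<inter> (A2 + A2) \<noteq> {}"
          then obtain s where s: "s \<in> E" "s \<in> A2 + A2" by blast
          then obtain v where "v \<in> A2" "s = v + b" by (auto simp: E_def)
          moreover obtain p q where "p \<in> A2" "q \<in> A2" "s = p + q"
            using s(2) by (auto elim!: set_plus_elim)
          ultimately have *: "v \<in> A2" "p \<in> A2" "q \<in> A2" "v + b = p + q" by auto
          then have "d dvd (p - z) + (q - v)" using d(1) A2(2) by (intro dvd_add d(1))
          moreover have "(p - z) + (q - v) = b - z" using * by simp
          ultimately show False using bA by simp
        qed
        moreover have "E \<inter> (A1 + A1) = {}"
        proof (rule ccontr)
          assume "E \<inter> (A1 + A1) \<noteq> {}"
          then obtain s where s: "s \<in> E" "s \<in> A1 + A1" by blast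
          then obtain v where "v \<in> A2" "v \<noteq> z" "s = v + b" by (auto simp: E_def)
          moreover obtain p q where "p \<in> A1" "q \<in> A1" "s = p + q"
            using s(2) by (auto elim!: set_plus_elim)
          ultimately have *: "v \<in> A2" "v \<noteq> z" "p \<in> A1" "q \<in> A1" "v + b = p + q" by auto
          then have "p > b" "q > b" by (auto simp: A1_def A2_def)
          moreover have "p \<in> A" "q \<in> A" using * sub by auto
          ultimately have "d dvd (p - z) + (q - z) - (v - z)"
            using d(1)[OF *(1) A2(2)] bmax by (intro dvd_diff[OF dvd_add])
          moreover have "(p - z) + (q - z) - (v - z) = b - z" using * by simp
          ultimately show False using bA by simp
        qed
        moreover have "card E + 1 = card A2"
          unfolding E_def card_int_image_add using A2(2) fin12 by (metis Suc_eq_plus1 card_Suc_Diff1)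
        moreover have "card (A2 + A2) + 1 \<ge> 2 * card A2"
          using card_sumset_ge_doubled[OF fin12(2)] A2(2) by blast
        ultimately show ?thesis using split[of E] c1 card12 by linarith
      qed
    qed
  qed
qed

text \<open>The sparse case would give doubling at least \<open>3 * card A - 3\<close>, so the dense
  bound applies; inserting the hypothesis into that bound yields the length estimate.\<close>

theorem freiman_3k_minus_4:
  assumes "A \<subseteq> {a..l}" "a \<in> A" "l \<in> A" "primitive A" "card (A + A) + 4 \<le> 3 * card A"
  shows "int (card (A + A)) \<ge> int (card A) + (l - a)" "l - a + 4 \<le> 2 * int (card A)"
proof -
  show *: "int (card (A + A)) \<ge> int (card A) + (l - a)"
    using card_sumset_sparse[OF assms(1-4)] card_sumset_dense[OF assms(1-3)] assms(5) by linarith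
  then show "l - a + 4 \<le> 2 * int (card A)" using assms(5) by linarith
qed

section \<open>Weights on half of a cycle\<close>

lemma has_integral_sin_ge:
  assumes "0 \<le> y" "y \<le> pi / 2"
  shows "((\<lambda>t. if y \<le> t then sin t else 0) has_integral cos y) {0..pi/2}"
proof -
  have "(sin has_integral (- cos (pi/2) - - cos y)) {y..pi/2}"
    by (rule fundamental_theorem_of_calculus)
      (use assms in \<open>auto intro!: derivative_eq_intros simp flip: has_real_derivative_iff_has_vector_derivative\<close>)
  then have "(sin has_integral cos y) {y..pi/2}" by simp
  then have "((\<lambda>t. if t \<in> {y..pi/2} then sin t else 0) has_integral cos y) {0..pi/2}"
    using has_integral_restrict[of "{y..pi/2}" "{0..pi/2}" sin "cos y"] assms by simp
  moreover have "(if t \<in> {y..pi/2} then sin t else 0) = (if y \<le> t then sin t else 0)"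
    if "t \<in> {0..pi/2}" for t using that by auto
  ultimately show ?thesis by (subst has_integral_cong) auto
qed

text \<open>Layer-cake form of the cosine: for \<open>\<bar>x\<bar>\<close> up to pi/2 it is the
  integral of \<open>sin\<close> from \<open>\<bar>x\<bar>\<close> to pi/2, and beyond that it is
  minus the same formula at \<open>pi - \<bar>x\<bar>\<close>. The two indicators interfere only at
  the single point pi/2.\<close>

lemma has_integral_arc_indicators:
  assumes "\<bar>x\<bar> \<le> pi"
  shows "((\<lambda>t. (of_bool (\<bar>x\<bar> \<le> t) - of_bool (\<bar>x\<bar> \<ge> pi - t)) * sin t) has_integral cos x) {0..pi/2}"
proof (cases "\<bar>x\<bar> \<le> pi / 2")
  case True
  have "((\<lambda>t. if \<bar>x\<bar> \<le> t then sin t else 0) has_integral cos x) {0..pi/2}"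
    using has_integral_sin_ge[of "\<bar>x\<bar>"] True by simp
  then show ?thesis
  proof (rule has_integral_spike_finite[of "{pi/2}", rotated 2])
    fix t assume "t \<in> {0..pi/2} - {pi/2}"
    then show "(of_bool (\<bar>x\<bar> \<le> t) - of_bool (\<bar>x\<bar> \<ge> pi - t)) * sin t
      = (if \<bar>x\<bar> \<le> t then sin t else 0)"
      using True by auto
  qed auto
next
  case False
  have "((\<lambda>t. - (if pi - \<bar>x\<bar> \<le> t then sin t else 0)) has_integral - cos (pi - \<bar>x\<bar>)) {0..pi/2}"
    using has_integral_neg[OF has_integral_sin_ge[of "pi - \<bar>x\<bar>"]] False assms by simp
  then have "((\<lambda>t. - (if pi - \<bar>x\<bar> \<le> t then sin t else 0)) has_integral cos x) {0..pi/2}"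
    by simp
  then show ?thesis
  proof (rule has_integral_spike_finite[of "{}", rotated 2])
    fix t assume "t \<in> {0..pi/2} - {}"
    then show "(of_bool (\<bar>x\<bar> \<le> t) - of_bool (\<bar>x\<bar> \<ge> pi - t)) * sin t
      = - (if pi - \<bar>x\<bar> \<le> t then sin t else 0)"
      using False by auto
  qed auto
qed

text \<open>For odd \<open>p\<close> these are \<open>(p + 1) / 2\<close> consecutive residues, the
  most that a closed half circle can meet among \<open>p\<close> equally spaced points.\<close>

definition half_arc :: "nat \<Rightarrow> int \<Rightarrow> int set" where
  "half_arc p c = (\<lambda>j. (c + j) mod int p) ` {0..(int p - 1) div 2}"

text \<open>
  Averaged against \<open>sin t\<close>, the indicators \<open>[\<bar>x\<bar> \<le> t] - [\<bar>x\<bar> \<ge> pi - t]\<close> give \<open>cos x\<close>, and up to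
  the constant 1 they are the sum of the indicators of the half circles \<open>[-t, pi - t]\<close> and \<open>[t - pi, t]\<close>.
\<close>

lemma weight_half_arc_real:
  fixes a :: "int \<Rightarrow> real" and x :: "int \<Rightarrow> real"
  assumes p: "odd p" and a: "\<And>i. i \<in> {0..<int p} \<Longrightarrow> a i \<ge> 0"
    and x: "\<And>i. i \<in> {0..<int p} \<Longrightarrow> \<bar>x i\<bar> \<le> pi \<and> (\<exists>r. r mod int p = i \<and> x i = 2 * pi * real_of_int r / p - \<theta>)"
    and M: "\<And>c. sum a (half_arc p c) \<le> M"
  shows "(\<Sum>i\<in>{0..<int p}. a i * cos (x i)) \<le> 2 * M - sum a {0..<int p}"
proof -
  let ?I = "{0..<int p}"
  have p0: "p > 0" using p by (rule odd_pos)
  have arc: "sum a {i\<in>?I. u \<le> x i \<and> x i \<le> u + pi} \<le> M" for u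
  proof -
    \<comment> \<open>The first integer whose angle \<open>2 * pi * c / p - \<theta>\<close> is at
      least \<open>u\<close>.\<close>
    define c where "c = \<lceil>(u + \<theta>) * p / (2 * pi)\<rceil>"
    have "{i\<in>?I. u \<le> x i \<and> x i \<le> u + pi} \<subseteq> half_arc p c"
    proof clarify
      fix i assume i: "i \<in> ?I" "u \<le> x i" "x i \<le> u + pi"
      obtain r where r: "r mod int p = i" "x i = 2 * pi * real_of_int r / p - \<theta>" using x[OF i(1)] by blast
      have "(u + \<theta>) * p \<le> 2 * pi * r"
        using i(2) r(2) p0 by (simp add: field_simps)
      then have 1: "(u + \<theta>) * p / (2 * pi) \<le> r" by (simp add: field_simps)
      have "2 * pi * r \<le> (u + pi + \<theta>) * p"
        using i(3) r(2) p0 by (simp add: field_simps)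
      then have 2: "r \<le> (u + \<theta>) * p / (2 * pi) + p / 2" by (simp add: field_simps)
      have "c \<le> r" unfolding c_def using 1 by linarith
      moreover have "real_of_int (r - c) \<le> p / 2" using 2 unfolding c_def by linarith
      then have "real_of_int (2 * (r - c)) \<le> real_of_int (int p)" by simp
      then have "2 * (r - c) \<le> int p" by (simp only: of_int_le_iff)
      then have "r - c \<le> (int p - 1) div 2" using p by presburger
      ultimately show "i \<in> half_arc p c"
        unfolding half_arc_def using r(1) by (intro image_eqI[of _ _ "r - c"]) auto
    qed
    then have "sum a {i\<in>?I. u \<le> x i \<and> x i \<le> u + pi} \<le> sum a (half_arc p c)"
      by (rule sum_mono2[rotated]) (use a p0 in \<open>auto simp: half_arc_def\<close>)
    also have "\<dots> \<le> M" by (rule M)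
    finally show ?thesis .
  qed
  have indicator: "sum a {i\<in>?I. P i} = (\<Sum>i\<in>?I. a i * of_bool (P i))" for P
    by (simp add: of_bool_def if_distrib sum.If_cases Int_def)
  have "((\<lambda>t. \<Sum>i\<in>?I. a i * ((of_bool (\<bar>x i\<bar> \<le> t) - of_bool (\<bar>x i\<bar> \<ge> pi - t)) * sin t))
      has_integral (\<Sum>i\<in>?I. a i * cos (x i))) {0..pi/2}"
    by (intro has_integral_sum has_integral_mult_right has_integral_arc_indicators) (use x in auto)
  moreover have "((\<lambda>t. (2 * M - sum a ?I) * (if 0 \<le> t then sin t else 0)) has_integral (2 * M - sum a ?I) * cos 0) {0..pi/2}"
    by (intro has_integral_mult_right has_integral_sin_ge) auto
  ultimately have "(\<Sum>i\<in>?I. a i * cos (x i)) \<le> (2 * M - sum a ?I) * cos 0"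
  proof (rule has_integral_le)
    fix t :: real assume t: "t \<in> {0..pi/2}"
    have "(\<Sum>i\<in>?I. a i * (of_bool (\<bar>x i\<bar> \<le> t) - of_bool (\<bar>x i\<bar> \<ge> pi - t)))
        \<le> (\<Sum>i\<in>?I. a i * (of_bool (-t \<le> x i \<and> x i \<le> -t + pi) + of_bool (t - pi \<le> x i \<and> x i \<le> t - pi + pi) - 1))"
    proof (intro sum_mono mult_left_mono)
      fix i assume "i \<in> ?I"
      then have "\<bar>x i\<bar> \<le> pi" using x by blast
      then show "of_bool (\<bar>x i\<bar> \<le> t) - of_bool (\<bar>x i\<bar> \<ge> pi - t)
        \<le> (of_bool (-t \<le> x i \<and> x i \<le> -t + pi) + of_bool (t - pi \<le> x i \<and> x i \<le> t - pi + pi) - 1 :: real)"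
        using t by (auto simp: of_bool_def abs_if split: if_splits)
    qed (use a in auto)
    also have "\<dots> = sum a {i\<in>?I. -t \<le> x i \<and> x i \<le> -t + pi} + sum a {i\<in>?I. t - pi \<le> x i \<and> x i \<le> t - pi + pi} - sum a ?I"
      unfolding indicator by (simp add: algebra_simps sum.distrib sum_subtractf)
    also have "\<dots> \<le> 2 * M - sum a ?I" using arc[of "-t"] arc[of "t - pi"] by simp
    finally have "(\<Sum>i\<in>?I. a i * (of_bool (\<bar>x i\<bar> \<le> t) - of_bool (\<bar>x i\<bar> \<ge> pi - t))) * sin t \<le> (2 * M - sum a ?I) * sin t"
      using t by (intro mult_right_mono sin_ge_zero) auto
    then show "(\<Sum>i\<in>?I. a i * ((of_bool (\<bar>x i\<bar> \<le> t) - of_bool (\<bar>x i\<bar> \<ge> pi - t)) * sin t))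
      \<le> (2 * M - sum a ?I) * (if 0 \<le> t then sin t else 0)"
      using t by (simp add: sum_distrib_right mult.assoc)
  qed
  then show ?thesis by simp
qed

lemma representative_angle:
  assumes "p > 0"
  shows "\<exists>r. r mod int p = i mod int p \<and> \<bar>2 * pi * real_of_int r / p - \<theta>\<bar> \<le> pi"
proof -
  define k where "k = round (\<theta> / (2 * pi) - i / p)"
  define r where "r = i + k * int p"
  have "\<bar>real_of_int k - (\<theta> / (2 * pi) - i / p)\<bar> \<le> 1/2"
    unfolding k_def by (rule of_int_round_abs_le)
  moreover have "2 * pi * real_of_int r / p - \<theta> = 2 * pi * (k - (\<theta> / (2 * pi) - i / p))"
    using assms by (simp add: r_def field_simps)
  ultimately have "\<bar>2 * pi * real_of_int r / p - \<theta>\<bar> \<le> 2 * pi * (1/2)"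
    by (simp add: abs_mult)
  then show ?thesis by (intro exI[of _ r]) (simp add: r_def)
qed

text \<open>Freiman's lemma on points of a circle, with weights: a sum of relative size g puts a
  share (1 + g)/2 of the weight on a half circle. Rotating by the argument of the sum turns its
  modulus into a sum of cosines, and the best of the finitely many arcs serves as the bound in
  \<open>weight_half_arc_real\<close>.\<close>

lemma weight_half_arc:
  fixes a :: "int \<Rightarrow> real"
  assumes p: "odd p" and a: "\<And>i. i \<in> {0..<int p} \<Longrightarrow> a i \<ge> 0"
  shows "\<exists>c. 2 * sum a (half_arc p c) \<ge> sum a {0..<int p}
    + cmod (\<Sum>i\<in>{0..<int p}. of_real (a i) * cis (2 * pi * i / p))"
proof -
  let ?I = "{0..<int p}"
  have p0: "p > 0" using p by (rule odd_pos)
  define W where "W = (\<Sum>i\<in>?I. of_real (a i) * cis (2 * pi * i / p))"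
  define \<theta> where "\<theta> = Arg W"
  define rep where "rep i = (SOME r. r mod int p = i mod int p \<and> \<bar>2 * pi * real_of_int r / p - \<theta>\<bar> \<le> pi)" for i
  have rep: "rep i mod int p = i mod int p" "\<bar>2 * pi * real_of_int (rep i) / p - \<theta>\<bar> \<le> pi" for i
    using someI_ex[OF representative_angle[OF p0, of i \<theta>]] by (auto simp: rep_def)
  define x where "x i = 2 * pi * real_of_int (rep i) / p - \<theta>" for i
  have cosx: "cos (x i) = cos (2 * pi * i / p - \<theta>)" if "i \<in> ?I" for i
  proof -
    obtain k where "rep i = i + int p * k"
      using rep(1)[of i] by (metis mod_eqE add.commute)
    then have "x i = (2 * pi * i / p - \<theta>) + 2 * pi * k"
      using p0 by (simp add: x_def field_simps)
    then show ?thesis by (simp add: cos_add)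
  qed
  have "of_real (cmod W) = W * cis (-\<theta>)"
  proof -
    have "W = of_real (cmod W) * cis \<theta>"
      unfolding \<theta>_def by (metis rcis_cmod_Arg rcis_def)
    then have "W * cis (-\<theta>) = of_real (cmod W) * (cis \<theta> * cis (-\<theta>))" by (metis mult.assoc)
    then show ?thesis by (simp add: cis_mult)
  qed
  then have "cmod W = Re (W * cis (-\<theta>))" by (metis Re_complex_of_real)
  also have "\<dots> = (\<Sum>i\<in>?I. a i * cos (2 * pi * i / p - \<theta>))"
    unfolding W_def sum_distrib_right Re_sum mult.assoc cis_mult
    by (intro sum.cong) auto
  also have "\<dots> = (\<Sum>i\<in>?I. a i * cos (x i))" using cosx by simp
  finally have R: "cmod W = (\<Sum>i\<in>?I. a i * cos (x i))" .
  let ?S = "range (\<lambda>c. sum a (half_arc p c))"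
  have half_mod: "half_arc p (c mod int p) = half_arc p c" for c
    by (simp add: half_arc_def mod_add_left_eq)
  then have "?S \<subseteq> (\<lambda>c. sum a (half_arc p c)) ` ?I"
    using p0 by (auto intro!: image_eqI[of _ _ "_ mod int p"])
  then have finS: "finite ?S" by (rule finite_subset) auto
  obtain c where c: "sum a (half_arc p c) = Max ?S" using Max_in[OF finS] by auto
  have "cmod W \<le> 2 * sum a (half_arc p c) - sum a ?I"
    unfolding R
  proof (rule weight_half_arc_real[OF p a])
    fix i assume "i \<in> ?I"
    then show "\<bar>x i\<bar> \<le> pi \<and> (\<exists>r. r mod int p = i \<and> x i = 2 * pi * real_of_int r / p - \<theta>)"
      using rep[of i] by (auto simp: x_def)
  next
    fix c' show "sum a (half_arc p c') \<le> sum a (half_arc p c)" using c finS by simp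
  qed auto
  then show ?thesis by (intro exI[of _ c]) (simp add: W_def)
qed

section \<open>Threefold sumsets of dense sets of integers\<close>

text \<open>If \<open>t\<close> is not a threefold sum, then \<open>x\<close> in \<open>B\<close>
  forces \<open>t - x\<close> to be a gap of \<open>B + B\<close>; so the gaps of \<open>B\<close>
  and of \<open>B + B\<close> up to \<open>t\<close> are together at least as numerous as the points
  of \<open>[0, t]\<close>.\<close>

lemma triple_sumset_left:
  fixes B :: "int set"
  assumes B: "B \<subseteq> {0..l}" and t: "t \<in> {0..l}" "t \<notin> B + B + B"
  shows "t + 1 \<le> int (card ({0..t} - B)) + int (card ({0..t} - (B + B)))"
proof -
  have "(\<lambda>x. t - x) ` (B \<inter> {0..t}) \<subseteq> {0..t} - (B + B)"
  proof
    fix y assume "y \<in> (\<lambda>x. t - x) ` (B \<inter> {0..t})"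
    then obtain x where x: "x \<in> B" "0 \<le> x" "x \<le> t" "y = t - x" by auto
    have "y \<notin> B + B" using set_plus_intro[of y "B + B" x B] x t by auto
    then show "y \<in> {0..t} - (B + B)" using x by auto
  qed
  then have "card ((\<lambda>x. t - x) ` (B \<inter> {0..t})) \<le> card ({0..t} - (B + B))"
    by (rule card_mono[rotated]) auto
  moreover have "card ((\<lambda>x. t - x) ` (B \<inter> {0..t})) = card (B \<inter> {0..t})"
    by (rule card_image) (auto simp: inj_on_def)
  moreover have "card {0..t} = card (B \<inter> {0..t}) + card ({0..t} - B)"
  proof -
    have "card (B \<inter> {0..t} \<union> ({0..t} - B)) = card (B \<inter> {0..t}) + card ({0..t} - B)"
      by (rule card_Un_disjoint) auto
    moreover have "B \<inter> {0..t} \<union> ({0..t} - B) = {0..t}" by auto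
    ultimately show ?thesis by simp
  qed
  ultimately show ?thesis using t by simp
qed

lemma sumset_reflect:
  fixes B C :: "int set"
  shows "(\<lambda>x. u - x) ` B + (\<lambda>x. v - x) ` C = (\<lambda>x. u + v - x) ` (B + C)"
proof (intro equalityI subsetI)
  fix z assume "z \<in> (\<lambda>x. u - x) ` B + (\<lambda>x. v - x) ` C"
  then obtain b c where "b \<in> B" "c \<in> C" "z = (u - b) + (v - c)" by (auto elim!: set_plus_elim)
  then show "z \<in> (\<lambda>x. u + v - x) ` (B + C)"
    by (intro image_eqI[of _ _ "b + c"]) auto
next
  fix z assume "z \<in> (\<lambda>x. u + v - x) ` (B + C)"
  then obtain b c where "b \<in> B" "c \<in> C" "z = u + v - (b + c)" by (auto elim!: set_plus_elim)
  moreover from this have "z = (u - b) + (v - c)" by simp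
  ultimately show "z \<in> (\<lambda>x. u - x) ` B + (\<lambda>x. v - x) ` C" by (metis image_eqI set_plus_intro)
qed

lemma card_interval_diff_reflect:
  "card ({0..t} - (\<lambda>x. u - x) ` B) = card ({u - t..u} - B)" for t u :: int
proof -
  have "{0..t} - (\<lambda>x. u - x) ` B = (\<lambda>x. u - x) ` ({u - t..u} - B)"
  proof (intro equalityI subsetI)
    fix x assume x: "x \<in> {0..t} - (\<lambda>x. u - x) ` B"
    have "u - x \<notin> B"
    proof
      assume "u - x \<in> B"
      then have "u - (u - x) \<in> (\<lambda>x. u - x) ` B" by blast
      then show False using x by simp
    qed
    then have "u - x \<in> {u - t..u} - B" using x by auto
    moreover have "x = u - (u - x)" by simp
    ultimately show "x \<in> (\<lambda>x. u - x) ` ({u - t..u} - B)" by blast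
  qed auto
  then show ?thesis by (simp add: card_image inj_on_def)
qed

text \<open>\<open>B\<close> has \<open>g = l + 1 - card B\<close> gaps in its hull, and
  \<open>B + B\<close> has at most \<open>g\<close> as well. A missing sum near either end uses up
  gaps of both in proportion to its distance from that end, so the two defective ends have total
  length at most \<open>2 * g\<close>.\<close>

lemma triple_sumset_interval:
  assumes B: "B \<subseteq> {0..l}" "0 \<in> B" "l \<in> B" and dense: "l + 2 \<le> 2 * int (card B)"
    and BB: "int (card (B + B)) \<ge> int (card B) + l"
  shows "\<exists>u v. 0 \<le> u \<and> 0 \<le> v \<and> u + v \<le> 2 * (l + 1 - int (card B)) \<and> {u..3 * l - v} \<subseteq> B + B + B"
proof -
  have fin: "finite B" using B(1) finite_subset by blast
  have l: "0 \<le> l" using B by auto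
  define g where "g = l + 1 - int (card B)"
  define GB where "GB = {0..l} - B"
  define GH where "GH = {0..2 * l} - (B + B)"
  have BBsub: "B + B \<subseteq> {0..2 * l}"
  proof
    fix x assume "x \<in> B + B"
    then obtain b c where "b \<in> B" "c \<in> B" "x = b + c" by (rule set_plus_elim)
    then show "x \<in> {0..2 * l}" using subsetD[OF B(1), of b] subsetD[OF B(1), of c] by simp
  qed
  have cGB: "int (card GB) = g"
    using card_interval_minus[OF B(1)] l by (simp add: GB_def g_def set_diff_eq)
  have cGH: "int (card GH) \<le> g"
    using card_interval_minus[OF BBsub] BB l by (simp add: GH_def g_def set_diff_eq)
  have finG: "finite GB" "finite GH" by (auto simp: GB_def GH_def)
  have left: "t + 1 \<le> int (card (GB \<inter> {0..t})) + int (card (GH \<inter> {0..t}))"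
    if "t \<in> {0..l}" "t \<notin> B + B + B" for t
  proof -
    have "{0..t} - B = GB \<inter> {0..t}" "{0..t} - (B + B) = GH \<inter> {0..t}"
      using that by (auto simp: GB_def GH_def)
    then show ?thesis using triple_sumset_left[OF B(1) that] by simp
  qed
  have right: "t + 1 \<le> int (card (GB \<inter> {l - t..l})) + int (card (GH \<inter> {2 * l - t..2 * l}))"
    if "t \<in> {0..l}" "3 * l - t \<notin> B + B + B" for t
  proof -
    let ?R = "(\<lambda>x. l - x) ` B"
    have R2: "?R + ?R = (\<lambda>x. 2 * l - x) ` (B + B)" by (simp add: sumset_reflect)
    have R3: "?R + ?R + ?R = (\<lambda>x. 3 * l - x) ` (B + B + B)"
      unfolding R2 by (simp add: sumset_reflect)
    have "?R \<subseteq> {0..l}" using B(1) by auto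
    moreover have "t \<notin> ?R + ?R + ?R" unfolding R3 using that by force
    ultimately have "t + 1 \<le> int (card ({0..t} - ?R)) + int (card ({0..t} - (?R + ?R)))"
      by (intro triple_sumset_left) (use that in auto)
    moreover have "{l - t..l} - B = GB \<inter> {l - t..l}" "{2 * l - t..2 * l} - (B + B) = GH \<inter> {2 * l - t..2 * l}"
      using that by (auto simp: GB_def GH_def)
    ultimately show ?thesis unfolding R2 card_interval_diff_reflect by simp
  qed
  \<comment> \<open>All of \<open>t - B\<close> would consist of gaps of \<open>B + B\<close>, but
    \<open>card B\<close> exceeds \<open>g\<close> by the density hypothesis.\<close>
  have middle: "t \<in> B + B + B" if "t \<in> {l..2 * l}" for t
  proof (rule ccontr)
    assume t: "t \<notin> B + B + B"
    have "(\<lambda>x. t - x) ` B \<subseteq> GH"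
    proof
      fix y assume "y \<in> (\<lambda>x. t - x) ` B"
      then obtain x where x: "x \<in> B" "y = t - x" by auto
      then have "y \<notin> B + B" using set_plus_intro[of y "B + B" x B] t by auto
      then show "y \<in> GH" using x B(1) that by (auto simp: GH_def)
    qed
    then have "card ((\<lambda>x. t - x) ` B) \<le> card GH" by (rule card_mono[OF finG(2)])
    moreover have "card ((\<lambda>x. t - x) ` B) = card B" by (rule card_image) (auto simp: inj_on_def)
    ultimately show False using cGH dense by (simp add: g_def)
  qed
  have upper: "int (card (GB \<inter> S)) + int (card (GH \<inter> S')) \<le> 2 * g" for S S'
    using card_mono[OF finG(1), of "GB \<inter> S"] card_mono[OF finG(2), of "GH \<inter> S'"] cGB cGH by auto
  \<comment> \<open>The gaps of \<open>B + B\<close> used at the two ends are disjoint. Those of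
    \<open>B\<close> overlap at most in \<open>{l - t'..t}\<close>, and a nonempty overlap would
    contradict the density hypothesis.\<close>
  have both: "t + 1 + (t' + 1) \<le> 2 * g"
    if t: "t \<in> {0..<l}" "t \<notin> B + B + B" and t': "t' \<in> {0..<l}" "3 * l - t' \<notin> B + B + B" for t t'
  proof -
    have "card (GH \<inter> {0..t}) + card (GH \<inter> {2 * l - t'..2 * l})
        = card (GH \<inter> {0..t} \<union> GH \<inter> {2 * l - t'..2 * l})"
      by (rule card_Un_disjoint[symmetric]) (use t t' finG in auto)
    also have "\<dots> \<le> card GH" by (rule card_mono[OF finG(2)]) auto
    finally have H: "card (GH \<inter> {0..t}) + card (GH \<inter> {2 * l - t'..2 * l}) \<le> card GH" .
    have "card (GB \<inter> {0..t}) + card (GB \<inter> {l - t'..l})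
        = card (GB \<inter> {0..t} \<union> GB \<inter> {l - t'..l}) + card ((GB \<inter> {0..t}) \<inter> (GB \<inter> {l - t'..l}))"
      by (rule card_Un_Int) (use finG in auto)
    also have "\<dots> \<le> card GB + card {l - t'..t}"
      by (intro add_mono card_mono) (use finG in auto)
    finally have "t + 1 + (t' + 1) \<le> 2 * g + int (card {l - t'..t})"
      using H left[of t] right[of t'] t t' cGB cGH by auto
    then show ?thesis using dense by (simp add: g_def split: if_splits)
  qed
  define Ul where "Ul = {t\<in>{0..<l}. t \<notin> B + B + B}"
  define Ur where "Ur = {t\<in>{0..<l}. 3 * l - t \<notin> B + B + B}"
  have finU: "finite Ul" "finite Ur" by (auto simp: Ul_def Ur_def intro: finite_subset[of _ "{0..<l}"])
  define u where "u = (if Ul = {} then 0 else Max Ul + 1)"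
  define v where "v = (if Ur = {} then 0 else Max Ur + 1)"
  have Ul: "u - 1 \<in> Ul" if "Ul \<noteq> {}" using that Max_in[OF finU(1)] by (simp add: u_def)
  have Ur: "v - 1 \<in> Ur" if "Ur \<noteq> {}" using that Max_in[OF finU(2)] by (simp add: v_def)
  have u0: "0 \<le> u" using Ul by (cases "Ul = {}") (auto simp: u_def Ul_def)
  have v0: "0 \<le> v" using Ur by (cases "Ur = {}") (auto simp: v_def Ur_def)
  have uv: "u + v \<le> 2 * g"
  proof (cases "Ul = {}"; cases "Ur = {}")
    assume "Ul = {}" "Ur = {}"
    then show ?thesis using upper[of "{}" "{}"] by (simp add: u_def v_def)
  next
    assume *: "Ul = {}" "Ur \<noteq> {}"
    then have "v \<le> 2 * g" using Ur right[of "v - 1"] upper order_trans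
      by (fastforce simp: Ur_def)
    then show ?thesis using * by (simp add: u_def)
  next
    assume *: "Ul \<noteq> {}" "Ur = {}"
    then have "u \<le> 2 * g" using Ul left[of "u - 1"] upper order_trans
      by (fastforce simp: Ul_def)
    then show ?thesis using * by (simp add: v_def)
  next
    assume "Ul \<noteq> {}" "Ur \<noteq> {}"
    then show ?thesis using both[of "u - 1" "v - 1"] Ul Ur by (auto simp: Ul_def Ur_def)
  qed
  have "t \<in> B + B + B" if "t \<in> {u..3 * l - v}" for t
  proof (rule ccontr)
    assume t: "t \<notin> B + B + B"
    then consider "t < l" | "t > 2 * l" using middle[of t] by force
    then show False
    proof cases
      case 1
      then have "t \<in> Ul" using t that u0 by (auto simp: Ul_def)
      then have "t \<le> Max Ul" "Ul \<noteq> {}" using finU by auto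
      then show False using that by (simp add: u_def)
    next
      case 2
      then have "3 * l - t \<in> Ur" using t that v0 by (auto simp: Ur_def)
      then have "3 * l - t \<le> Max Ur" "Ur \<noteq> {}" using finU by auto
      then show False using that by (simp add: v_def)
    qed
  qed
  then show ?thesis using u0 v0 uv by (intro exI[of _ u] exI[of _ v]) (auto simp: g_def)
qed

text \<open>A translate of \<open>B + B + B\<close> covers at least \<open>3 * card B - 2\<close>
  consecutive integers, because \<open>u + v\<close> is at most twice the number of gaps and
  \<open>l >= card B - 1\<close>. What is left of the cycle for \<open>Y\<close> is one interval of
  at most \<open>p + 2 - 3 * card B\<close> residues.\<close>

lemma avoid_triple_sumset:
  fixes p :: nat
  assumes Y: "Y \<subseteq> {0..<int p}" and B: "B \<subseteq> {0..l}" "0 \<in> B" "l \<in> B" "primitive B"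
    and small: "card (B + B) + 4 \<le> 3 * card B"
    and avoid: "\<And>b b' b''. b \<in> B \<Longrightarrow> b' \<in> B \<Longrightarrow> b'' \<in> B \<Longrightarrow> (c + b + b' + b'') mod int p \<notin> Y"
  shows "\<exists>d. Y \<subseteq> (\<lambda>j. (d + j) mod int p) ` {0..int p + 1 - 3 * int (card B)}"
proof -
  note F = freiman_3k_minus_4[OF B small]
  obtain u v where uv: "0 \<le> u" "0 \<le> v" "u + v \<le> 2 * (l + 1 - int (card B))" "{u..3 * l - v} \<subseteq> B + B + B"
    using triple_sumset_interval[OF B(1-3)] F by auto
  have cl: "int (card B) \<le> l + 1"
    using card_mono[OF _ B(1)] B(1-3) by auto
  define n where "n = 3 * l - v - u + 1"
  have n: "n \<ge> 3 * int (card B) - 2" using uv cl by (simp add: n_def)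
  have "Y \<subseteq> (\<lambda>j. (c + 3 * l - v + 1 + j) mod int p) ` {0..int p + 1 - 3 * int (card B)}"
  proof
    fix i assume i: "i \<in> Y"
    define k where "k = (i - (c + u)) mod int p"
    have p0: "int p > 0" using i Y by auto
    then have k: "0 \<le> k" "k < int p" by (auto simp: k_def)
    have ik: "(c + u + k) mod int p = i"
      using i Y p0 by (auto simp: k_def mod_simps)
    have "n \<le> k"
    proof (rule ccontr)
      assume "\<not> n \<le> k"
      then have "u + k \<in> B + B + B" using uv(4) k by (intro subsetD[OF uv(4)]) (auto simp: n_def)
      then obtain b b' b'' where "b \<in> B" "b' \<in> B" "b'' \<in> B" "u + k = b + b' + b''"
        by (auto elim!: set_plus_elim)
      moreover from this have "(c + b + b' + b'') mod int p = i" using ik by (simp add: add.assoc)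
      ultimately show False using avoid i by blast
    qed
    moreover have "i = (c + 3 * l - v + 1 + (k - n)) mod int p"
      using ik by (simp add: n_def algebra_simps)
    ultimately show "i \<in> (\<lambda>j. (c + 3 * l - v + 1 + j) mod int p) ` {0..int p + 1 - 3 * int (card B)}"
      using k n by (intro image_eqI[of _ _ "k - n"]) auto
  qed
  then show ?thesis by blast
qed

section \<open>Sumsets in abelian groups\<close>

text \<open>
  Dyson's transform moves from \<open>C\<close> to \<open>B\<close> the elements whose translates by \<open>e\<close> are not in \<open>B\<close>. When no transform
  changes \<open>C\<close>, the set \<open>B\<close> is a union of cosets of the subgroup generated by the quotients of \<open>C\<close>.
\<close>

lemma (in comm_group) card_set_mult_ge_proper:
  assumes fin: "finite (carrier G)"
    and h: "\<And>H. subgroup H G \<Longrightarrow> H \<noteq> carrier G \<Longrightarrow> card H \<le> h"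
    and "B \<subseteq> carrier G" "C \<subseteq> carrier G" "B \<noteq> {}" "C \<noteq> {}"
  shows "card B + card C \<le> card (B <#> C) + h \<or> B <#> C = carrier G"
  using assms(3-)
proof (induction "card C" arbitrary: B C rule: less_induct)
  case less
  note B = less.prems(1,3) and C = less.prems(2,4)
  have finB: "finite B" and finC: "finite C" using B C fin finite_subset by auto
  have BC: "B <#> C \<subseteq> carrier G" using B C by (auto simp: set_mult_def)
  have finBC: "finite (B <#> C)" using BC fin finite_subset by blast
  obtain c0 where c0: "c0 \<in> C" using C by blast
  show ?case
  proof (cases "\<forall>b\<in>B. \<forall>c\<in>C. \<forall>c'\<in>C. b \<otimes> (c' \<otimes> inv c) \<in> B")
    case True
    define D where "D = {c' \<otimes> inv c | c c'. c \<in> C \<and> c' \<in> C}"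
    have D: "D \<subseteq> carrier G" using C by (auto simp: D_def)
    define H where "H = generate G D"
    have H: "subgroup H G" unfolding H_def using D by (rule generate_is_subgroup)
    have stab: "x \<in> H \<Longrightarrow> \<forall>b\<in>B. b \<otimes> x \<in> B" for x
      unfolding H_def
    proof (induction rule: generate.induct)
      case one then show ?case using B by auto
    next
      case (incl x) then show ?case using True by (auto simp: D_def)
    next
      case (inv x)
      then obtain c c' where "c \<in> C" "c' \<in> C" "x = c' \<otimes> inv c" by (auto simp: D_def)
      moreover from this have "inv x = c \<otimes> inv c'"
        using C by (simp add: inv_mult_group subset_eq)
      ultimately show ?case using True by auto
    next
      case (eng x y)
      then have "x \<in> carrier G" "y \<in> carrier G" using D generate_in_carrier by auto
      moreover have "b \<otimes> (x \<otimes> y) = b \<otimes> x \<otimes> y" if "b \<in> B" for b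
        using that B calculation by (simp add: m_assoc subset_eq)
      ultimately show ?case using eng by simp
    qed
    have Cc: "C \<subseteq> (\<lambda>x. x \<otimes> c0) ` H"
    proof
      fix c assume c: "c \<in> C"
      then have "c \<otimes> inv c0 \<in> H" unfolding H_def using c0 by (intro generate.incl) (auto simp: D_def)
      moreover have "c = (c \<otimes> inv c0) \<otimes> c0" using c c0 C by (simp add: m_assoc subset_eq)
      ultimately show "c \<in> (\<lambda>x. x \<otimes> c0) ` H" by blast
    qed
    have Bc0: "(\<lambda>b. b \<otimes> c0) ` B \<subseteq> B <#> C" using c0 by (auto simp: set_mult_def)
    have inj: "inj_on (\<lambda>b. b \<otimes> c0) (carrier G)"
      using c0 C by (auto simp: inj_on_def)
    have cB: "card B \<le> card (B <#> C)"
      using card_mono[OF finBC Bc0] card_image[OF inj_on_subset[OF inj B(1)]] by simp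
    show ?thesis
    proof (cases "H = carrier G")
      case True
      obtain b where b: "b \<in> B" using B by blast
      have "x \<in> B" if "x \<in> carrier G" for x
      proof -
        have bx: "inv b \<otimes> x \<in> H" using that b B True by auto
        have "b \<otimes> (inv b \<otimes> x) \<in> B" using stab[OF bx] b by blast
        then show ?thesis using that b B by (simp add: m_assoc[symmetric] subset_eq)
      qed
      then have "B = carrier G" using B by blast
      then have "card (carrier G) \<le> card (B <#> C)" using cB by simp
      then show ?thesis using BC fin by (simp add: card_subset_eq order_antisym card_mono)
    next
      case False
      have "card C \<le> card ((\<lambda>x. x \<otimes> c0) ` H)"
        by (rule card_mono[OF _ Cc]) (use H fin in \<open>meson finite_imageI finite_subset subgroup.subset\<close>)
      also have "\<dots> \<le> card H"
        by (rule card_image_le) (use H fin in \<open>meson finite_subset subgroup.subset\<close>)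
      also have "\<dots> \<le> h" using h[OF H False] .
      finally show ?thesis using cB by linarith
    qed
  next
    case False
    then obtain b c c1 where bc: "b \<in> B" "c \<in> C" "c1 \<in> C" "b \<otimes> (c1 \<otimes> inv c) \<notin> B" by blast
    \<comment> \<open>With this \<open>e\<close> the element \<open>c\<close> stays in
      \<open>C'\<close>, since \<open>c\<close> times \<open>e\<close> is \<open>b\<close>, while
      \<open>c1\<close> leaves it: the second set shrinks without becoming empty.\<close>
    define e where "e = b \<otimes> inv c"
    have e: "e \<in> carrier G" using bc B C by (auto simp: e_def)
    have cG: "b \<in> carrier G" "c \<in> carrier G" "c1 \<in> carrier G" using bc B C by auto
    have "c \<otimes> e = b \<otimes> (c \<otimes> inv c)"
      unfolding e_def using cG by (intro m_lcomm) auto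
    then have ce: "c \<otimes> e = b" using cG by simp
    have "c1 \<otimes> e = b \<otimes> (c1 \<otimes> inv c)"
      unfolding e_def using cG by (intro m_lcomm) auto
    then have c1e: "c1 \<otimes> e \<notin> B" using bc by simp
    define C' where "C' = {x\<in>C. x \<otimes> e \<in> B}"
    define B' where "B' = B \<union> (\<lambda>x. x \<otimes> e) ` (C - C')"
    have lt: "card C' < card C"
      by (rule psubset_card_mono[OF finC]) (use bc c1e in \<open>auto simp: C'_def\<close>)
    have C': "C' \<subseteq> carrier G" "C' \<noteq> {}" using C bc ce by (auto simp: C'_def)
    have B': "B' \<subseteq> carrier G" "B' \<noteq> {}" using B C e by (auto simp: B'_def)
    have "card B' = card B + card ((\<lambda>x. x \<otimes> e) ` (C - C'))"
      unfolding B'_def by (rule card_Un_disjoint) (use finB finC in \<open>auto simp: C'_def\<close>)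
    also have "card ((\<lambda>x. x \<otimes> e) ` (C - C')) = card (C - C')"
      by (rule card_image) (use C e in \<open>auto simp: inj_on_def subset_eq\<close>)
    also have "card (C - C') = card C - card C'"
      by (rule card_Diff_subset) (use finC in \<open>auto simp: C'_def\<close>)
    finally have sum: "card B' + card C' = card B + card C" using lt by simp
    have sub: "B' <#> C' \<subseteq> B <#> C"
    proof
      fix x assume "x \<in> B' <#> C'"
      then obtain y z where yz: "y \<in> B'" "z \<in> C'" "x = y \<otimes> z" by (auto simp: set_mult_def)
      show "x \<in> B <#> C"
      proof (cases "y \<in> B")
        case True then show ?thesis using yz by (auto simp: set_mult_def C'_def)
      next
        case False
        then obtain w where w: "w \<in> C" "y = w \<otimes> e" using yz by (auto simp: B'_def)
        have z: "z \<in> carrier G" "w \<in> carrier G" using yz w C by (auto simp: C'_def)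
        have "x = (z \<otimes> e) \<otimes> w" using yz(3) w(2) z e by (simp add: m_ac)
        then show ?thesis using yz w by (auto simp: set_mult_def C'_def)
      qed
    qed
    have "card (B' <#> C') \<le> card (B <#> C)" by (rule card_mono[OF finBC sub])
    then show ?thesis using less.hyps[OF lt B'(1) C'(1) B'(2) C'(2)] sum sub BC by auto
  qed
qed

text \<open>For \<open>k = 0\<close> the bound is 0, in agreement with the trivial group having no
  proper subgroup.\<close>

lemma (in group) card_proper_subgroup_prime_power:
  assumes "Factorial_Ring.prime p" "Coset.order G = p ^ k" "subgroup H G" "H \<noteq> carrier G"
  shows "card H \<le> p ^ k div p"
proof -
  have p: "p > 1" using assms(1) prime_gt_1_nat by blast
  have fin: "finite (carrier G)"
    using assms(2) p by (intro card_ge_0_finite) (simp add: Coset.order_def)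
  have "card H dvd p ^ k"
    using lagrange[OF assms(3)] assms(2) by (metis dvd_triv_right)
  then obtain i where i: "i \<le> k" "card H = p ^ i" using assms(1) divides_primepow_nat by blast
  have "card H < card (carrier G)"
    by (rule psubset_card_mono[OF fin]) (use assms(3,4) subgroup.subset in blast)
  then have "i < k" using i assms(2) p by (simp add: Coset.order_def)
  then obtain j where "k = Suc j" "i \<le> j" by (metis Suc_le_D Suc_leI Suc_le_mono less_eq_Suc_le)
  then show ?thesis using i p by (simp add: power_increasing)
qed

text \<open>The error term is the largest possible order of a proper subgroup. It is 1 for
  \<open>k = 1\<close>, which is Cauchy-Davenport.\<close>

lemma (in comm_group) card_set_mult_ge:
  assumes "Factorial_Ring.prime p" "Coset.order G = p ^ k" "B \<subseteq> carrier G" "C \<subseteq> carrier G" "B \<noteq> {}" "C \<noteq> {}"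
  shows "card B + card C \<le> card (B <#> C) + p ^ k div p \<or> B <#> C = carrier G"
proof (rule card_set_mult_ge_proper)
  show "finite (carrier G)"
    using assms(1,2) by (intro card_ge_0_finite) (simp add: Coset.order_def prime_gt_0_nat)
qed (use assms card_proper_subgroup_prime_power in auto)

section \<open>Cauchy-Davenport modulo p\<close>

abbreviation residues_below :: "nat \<Rightarrow> int set" where
  "residues_below p \<equiv> {0..<int p}"

definition msum :: "nat \<Rightarrow> int set \<Rightarrow> int set \<Rightarrow> int set" where
  "msum p B C = (\<lambda>(b, c). (b + c) mod int p) ` (B \<times> C)"

lemma msumI: "b \<in> B \<Longrightarrow> c \<in> C \<Longrightarrow> (b + c) mod int p \<in> msum p B C"
  by (force simp: msum_def)

lemma msumE:
  assumes "x \<in> msum p B C"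
  obtains b c where "b \<in> B" "c \<in> C" "x = (b + c) mod int p"
  using assms by (auto simp: msum_def)

lemma msum_subset: "p > 0 \<Longrightarrow> msum p B C \<subseteq> residues_below p"
  by (auto simp: msum_def)

lemma cauchy_davenport:
  assumes p: "Factorial_Ring.prime p" and B: "B \<subseteq> residues_below p" "B \<noteq> {}"
    and C: "C \<subseteq> residues_below p" "C \<noteq> {}"
  shows "card B + card C \<le> card (msum p B C) + 1 \<or> msum p B C = residues_below p"
proof -
  let ?R = "residue_ring (int p)"
  have p1: "p > 1" using p prime_gt_1_nat by blast
  interpret residues "int p" ?R by unfold_locales (use p1 in auto)
  have carr: "carrier (add_monoid ?R) = residues_below p" by (auto simp: residue_ring_def)
  have ord: "Coset.order (add_monoid ?R) = p ^ 1" unfolding Coset.order_def carr by simp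
  have "B <#>\<^bsub>add_monoid ?R\<^esub> C = msum p B C"
    by (auto simp: set_mult_def msum_def residue_ring_def)
  then show ?thesis
    using comm_group.card_set_mult_ge[OF a_comm_group p ord, of B C] B C p1 unfolding carr by simp
qed

text \<open>Two applications of Cauchy-Davenport; since \<open>X4\<close> is nonempty and missed, no
  intermediate sumset can be the whole cycle. The first conclusion keeps
  \<open>msum p X1 X2\<close>, which later bounds the doubling of the heavy residues.\<close>

lemma cauchy_davenport_disjoint:
  assumes p: "Factorial_Ring.prime p"
    and X: "X1 \<subseteq> residues_below p" "X2 \<subseteq> residues_below p" "X3 \<subseteq> residues_below p" "X4 \<subseteq> residues_below p"
    and ne: "X1 \<noteq> {}" "X2 \<noteq> {}" "X3 \<noteq> {}" "X4 \<noteq> {}"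
    and disj: "\<And>x y z. x \<in> X1 \<Longrightarrow> y \<in> X2 \<Longrightarrow> z \<in> X3 \<Longrightarrow> (x + y + z) mod int p \<notin> X4"
  shows "card (msum p X1 X2) + card X3 + card X4 \<le> p + 1"
    "card X1 + card X2 + card X3 + card X4 \<le> p + 2"
proof -
  have p0: "p > 0" using p prime_gt_0_nat by blast
  let ?S = "msum p X1 X2" and ?Z = "residues_below p"
  have S: "?S \<subseteq> ?Z" "?S \<noteq> {}" using msum_subset[OF p0] ne by (auto simp: msum_def)
  have *: "msum p ?S X3 \<inter> X4 = {}"
  proof (rule ccontr)
    assume "msum p ?S X3 \<inter> X4 \<noteq> {}"
    then obtain w where w: "w \<in> msum p ?S X3" "w \<in> X4" by blast
    obtain s z where sz: "s \<in> ?S" "z \<in> X3" "w = (s + z) mod int p" using w(1) by (rule msumE)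
    obtain x y where "x \<in> X1" "y \<in> X2" "s = (x + y) mod int p" using sz(1) by (rule msumE)
    then show False using disj[of x y z] w sz by (auto simp: mod_simps)
  qed
  have *: "card (msum p ?S X3) + card X4 \<le> p"
  proof -
    have fin: "finite (msum p ?S X3)" "finite X4"
      using msum_subset[OF p0, of ?S X3] X(4) finite_subset by blast+
    have "card (msum p ?S X3 \<union> X4) \<le> card ?Z"
      using X(4) msum_subset[OF p0, of ?S X3] by (intro card_mono) auto
    then show ?thesis using card_Un_disjoint[OF fin *] by simp
  qed
  moreover have "card X4 > 0" using ne(4) X(4) by (simp add: card_gt_0_iff finite_subset)
  ultimately have "msum p ?S X3 \<noteq> ?Z" by auto
  then show 1: "card ?S + card X3 + card X4 \<le> p + 1"
    using cauchy_davenport[OF p S X(3) ne(3)] * by linarith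
  have "card X3 > 0" "card X4 > 0" using ne X by (simp_all add: card_gt_0_iff finite_subset)
  then have "?S \<noteq> ?Z" using 1 by auto
  then show "card X1 + card X2 + card X3 + card X4 \<le> p + 2"
    using cauchy_davenport[OF p X(1) ne(1) X(2) ne(2)] 1 by linarith
qed

section \<open>Dilations\<close>

definition dilate :: "nat \<Rightarrow> int \<Rightarrow> int set \<Rightarrow> int set" where
  "dilate p k S = (\<lambda>i. (k * i) mod int p) ` S"

lemma inj_on_dilate:
  assumes "coprime k (int p)"
  shows "inj_on (\<lambda>i. (k * i) mod int p) (residues_below p)"
proof (rule inj_onI)
  fix i j assume ij: "i \<in> residues_below p" "j \<in> residues_below p" "(k * i) mod int p = (k * j) mod int p"
  then have "[k * i = k * j] (mod int p)" by (simp add: Cong.cong_def)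
  then have "[i = j] (mod int p)" using assms by (simp add: cong_mult_lcancel)
  then show "i = j" using ij by (simp add: Cong.cong_def)
qed

lemma dilate_mem_iff:
  assumes "coprime k (int p)" "S \<subseteq> residues_below p" "i \<in> residues_below p"
  shows "(k * i) mod int p \<in> dilate p k S \<longleftrightarrow> i \<in> S"
  unfolding dilate_def using inj_on_image_mem_iff[OF inj_on_dilate[OF assms(1)] assms(3,2)] .

lemma msum_dilate: "msum p (dilate p k B) (dilate p k C) = dilate p k (msum p B C)"
proof -
  have eq: "((k * b) mod int p + (k * c) mod int p) mod int p = (k * ((b + c) mod int p)) mod int p" for b c
    by (simp add: mod_simps distrib_left)
  have "msum p (dilate p k B) (dilate p k C)
      = (\<lambda>(b, c). ((k * b) mod int p + (k * c) mod int p) mod int p) ` (B \<times> C)"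
    by (force simp: msum_def dilate_def)
  also have "\<dots> = (\<lambda>(b, c). (k * ((b + c) mod int p)) mod int p) ` (B \<times> C)" by (simp only: eq)
  also have "\<dots> = dilate p k (msum p B C)" by (force simp: msum_def dilate_def)
  finally show ?thesis .
qed

lemma card_dilate:
  assumes "coprime k (int p)" "S \<subseteq> residues_below p"
  shows "card (dilate p k S) = card S"
  unfolding dilate_def by (rule card_image[OF inj_on_subset[OF inj_on_dilate[OF assms(1)] assms(2)]])

lemma dilate_subset: "p > 0 \<Longrightarrow> dilate p k S \<subseteq> residues_below p"
  by (auto simp: dilate_def)

section \<open>Sets inside half of the cycle\<close>

text \<open>Offsets are recorded instead of residues: two of them add up to at most
  \<open>p - 1\<close>, so for odd \<open>p\<close> the modular sumset of a half is faithfully the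
  integer sumset of its offsets.\<close>

definition half_part :: "nat \<Rightarrow> int \<Rightarrow> int set \<Rightarrow> int set" where
  "half_part p c S = {j\<in>{0..(int p - 1) div 2}. (c + j) mod int p \<in> S}"

lemma finite_half_part: "finite (half_part p c S)"
  by (auto simp: half_part_def intro: finite_subset[of _ "{0..(int p - 1) div 2}"])

lemma inj_on_shift_mod: "inj_on (\<lambda>j. (c + j) mod int p) {0..<int p}"
proof (rule inj_onI)
  fix i j assume ij: "i \<in> {0..<int p}" "j \<in> {0..<int p}" "(c + i) mod int p = (c + j) mod int p"
  then have "[c + i = c + j] (mod int p)" by (simp add: Cong.cong_def)
  then have "[i = j] (mod int p)" by (simp only: cong_add_lcancel)
  then show "i = j" using ij by (simp add: Cong.cong_def)
qed

lemma card_half_part_sumset_le: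
  assumes "p > 0"
  shows "card (half_part p c S + half_part p c S) \<le> card (msum p S S)"
proof -
  let ?H = "half_part p c S"
  have "?H + ?H \<subseteq> {0..<int p}"
  proof
    fix x assume "x \<in> ?H + ?H"
    then obtain b c where "b \<in> ?H" "c \<in> ?H" "x = b + c" by (rule set_plus_elim)
    then show "x \<in> {0..<int p}" using assms by (auto simp: half_part_def)
  qed
  then have "card (?H + ?H) = card ((\<lambda>j. (2 * c + j) mod int p) ` (?H + ?H))"
    by (intro card_image[symmetric] inj_on_subset[OF inj_on_shift_mod])
  also have "\<dots> \<le> card (msum p S S)"
  proof (rule card_mono)
    show "finite (msum p S S)" using msum_subset[OF assms] by (rule finite_subset) simp
    show "(\<lambda>j. (2 * c + j) mod int p) ` (?H + ?H) \<subseteq> msum p S S"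
    proof clarify
      fix x assume "x \<in> ?H + ?H"
      then obtain i j where ij: "i \<in> ?H" "j \<in> ?H" "x = i + j" by (rule set_plus_elim)
      then have "((c + i) mod int p + (c + j) mod int p) mod int p \<in> msum p S S"
        by (intro msumI) (auto simp: half_part_def)
      then have "((c + i) + (c + j)) mod int p \<in> msum p S S" by (simp only: mod_add_eq)
      moreover have "(c + i) + (c + j) = 2 * c + x" using ij by simp
      ultimately show "(2 * c + x) mod int p \<in> msum p S S" by (simp only:)
    qed
  qed
  finally show ?thesis .
qed

lemma card_half_part_arc:
  assumes "p > 0" "S \<subseteq> residues_below p"
  shows "card (half_part p c S) = card (S \<inter> half_arc p c)"
proof -
  have "(\<lambda>j. (c + j) mod int p) ` half_part p c S = S \<inter> half_arc p c"
    by (auto simp: half_part_def half_arc_def)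
  moreover have "inj_on (\<lambda>j. (c + j) mod int p) (half_part p c S)"
    by (rule inj_on_subset[OF inj_on_shift_mod]) (auto simp: half_part_def)
  ultimately show ?thesis by (metis card_image)
qed

lemma primitive_normalization:
  fixes A :: "int set"
  assumes fin: "finite A" and two: "card A \<ge> 2"
  shows "\<exists>a d l B. d > 0 \<and> B \<subseteq> {0..l} \<and> 0 \<in> B \<and> l \<in> B \<and> primitive B \<and>
    A = (\<lambda>q. a + d * q) ` B \<and> a \<in> A \<and> a + d * l \<in> A \<and> l > 0"
proof -
  have ne: "A \<noteq> {}" using two by auto
  define a where "a = Min A"
  define b where "b = Max A"
  have ab: "a \<in> A" "b \<in> A" and rng: "\<And>x. x \<in> A \<Longrightarrow> a \<le> x \<and> x \<le> b"
    using fin ne by (auto simp: a_def b_def)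
  have "a \<noteq> b"
  proof
    assume "a = b"
    then have "A \<subseteq> {a}" using rng by force
    then have "card A \<le> 1" using card_mono[of "{a}" A] by simp
    then show False using two by simp
  qed
  then have alb: "a < b" using rng ab by force
  define d where "d = Gcd ((\<lambda>x. x - a) ` A)"
  have dvd: "d dvd x - a" if "x \<in> A" for x unfolding d_def using that by (intro Gcd_dvd) auto
  have d0: "d > 0"
  proof -
    have "d \<noteq> 0" using dvd[OF ab(2)] alb by auto
    moreover have "d \<ge> 0" unfolding d_def by (rule Gcd_int_greater_eq_0)
    ultimately show ?thesis by simp
  qed
  define B where "B = (\<lambda>x. (x - a) div d) ` A"
  have AB: "A = (\<lambda>q. a + d * q) ` B"
  proof -
    have "(\<lambda>q. a + d * q) ` B = (\<lambda>x. x) ` A" unfolding B_def image_image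
      by (rule image_cong) (use dvd in auto)
    then show ?thesis by simp
  qed
  have Bsub: "B \<subseteq> {0..(b - a) div d}"
    using rng d0 by (auto simp: B_def intro!: zdiv_mono1 pos_imp_zdiv_nonneg_iff[THEN iffD2])
  have "primitive B"
    unfolding primitive_def
  proof (intro allI impI)
    fix e assume e: "\<forall>x\<in>B. \<forall>y\<in>B. e dvd x - y"
    have "d * e dvd y" if y: "y \<in> (\<lambda>x. x - a) ` A" for y
    proof -
      obtain x where x: "x \<in> A" "y = x - a" using y by auto
      have "e dvd (x - a) div d - (a - a) div d" using e x ab by (auto simp: B_def)
      then have "d * e dvd d * ((x - a) div d)" by simp
      then show ?thesis using dvd x by simp
    qed
    then have "d * e dvd d" unfolding d_def by (rule Gcd_greatest)
    then show "\<bar>e\<bar> = 1" using d0 by simp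
  qed
  moreover have "0 \<in> B" "(b - a) div d \<in> B" using ab by (auto simp: B_def intro: image_eqI[of _ _ a])
  moreover have "a + d * ((b - a) div d) = b" using dvd[OF ab(2)] by simp
  moreover from this have "(b - a) div d > 0" using alb d0 by (simp add: pos_imp_zdiv_pos_iff zdvd_imp_le dvd[OF ab(2)])
  ultimately show ?thesis using d0 Bsub AB ab
    by (intro exI[of _ a] exI[of _ d] exI[of _ "(b - a) div d"] exI[of _ B]) simp
qed

lemma card_affine_sumset:
  fixes B :: "int set"
  assumes "d > 0"
  shows "card ((\<lambda>q. a + d * q) ` B) = card B"
    "card ((\<lambda>q. a + d * q) ` B + (\<lambda>q. a + d * q) ` B) = card (B + B)"
proof -
  show "card ((\<lambda>q. a + d * q) ` B) = card B"
    using assms by (intro card_image) (auto simp: inj_on_def)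
  have "(\<lambda>q. a + d * q) ` B + (\<lambda>q. a + d * q) ` B = (\<lambda>q. 2 * a + d * q) ` (B + B)"
  proof (intro equalityI subsetI)
    fix x assume "x \<in> (\<lambda>q. a + d * q) ` B + (\<lambda>q. a + d * q) ` B"
    then obtain q r where "q \<in> B" "r \<in> B" "x = (a + d * q) + (a + d * r)" by (auto elim!: set_plus_elim)
    then show "x \<in> (\<lambda>q. 2 * a + d * q) ` (B + B)"
      by (intro image_eqI[of _ _ "q + r"]) (auto simp: algebra_simps)
  next
    fix x assume "x \<in> (\<lambda>q. 2 * a + d * q) ` (B + B)"
    then obtain q r where "q \<in> B" "r \<in> B" "x = 2 * a + d * (q + r)" by (auto elim!: set_plus_elim)
    moreover from this have "x = (a + d * q) + (a + d * r)" by (simp add: algebra_simps)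
    ultimately show "x \<in> (\<lambda>q. a + d * q) ` B + (\<lambda>q. a + d * q) ` B" by (metis image_eqI set_plus_intro)
  qed
  moreover have "inj_on (\<lambda>q. 2 * a + d * q) (B + B)" using assms by (auto simp: inj_on_def)
  ultimately show "card ((\<lambda>q. a + d * q) ` B + (\<lambda>q. a + d * q) ` B) = card (B + B)"
    by (simp add: card_image)
qed

text \<open>Freiman's theorem first applies to the part of \<open>B\<close> in half of the cycle; a dilation turns
  its difference into 1, and then \<open>Y\<close>, which avoids \<open>3B\<close>, lies in half of the cycle itself, so
  that the theorem applies to all of \<open>B\<close>.\<close>

lemma short_interval_of_half_part:
  assumes p: "Factorial_Ring.prime p" "odd p" and BY: "B \<subseteq> Y" and Y: "Y \<subseteq> residues_below p"
    and avoid: "\<And>b b' b''. b \<in> B \<Longrightarrow> b' \<in> B \<Longrightarrow> b'' \<in> B \<Longrightarrow> (b + b' + b'') mod int p \<notin> Y"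
    and small: "card (msum p B B) + 4 \<le> 3 * card (half_part p c B)"
    and large: "int p + 1 - 3 * int (card (half_part p c B)) \<le> (int p - 1) div 2"
  shows "\<exists>k d. coprime k (int p) \<and>
    dilate p k Y \<subseteq> (\<lambda>j. (d + j) mod int p) ` {0..int p + 1 - 3 * int (card B)}"
proof -
  have p0: "p > 0" using p prime_gt_0_nat by blast
  let ?h = "(int p - 1) div 2"
  define H where "H = half_part p c B"
  have finH: "finite H" unfolding H_def by (rule finite_half_part)
  have "card H \<ge> 2" using small unfolding H_def[symmetric] by linarith
  then obtain a e l Q where Q: "e > 0" "Q \<subseteq> {0..l}" "0 \<in> Q" "l \<in> Q" "primitive Q"
      "H = (\<lambda>q. a + e * q) ` Q" "a \<in> H" "a + e * l \<in> H" "l > 0"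
    using primitive_normalization[OF finH] by blast
  have cQ: "card Q = card H" "card (Q + Q) = card (H + H)"
    unfolding Q(6) using card_affine_sumset[OF Q(1)] by simp_all
  have smallQ: "card (Q + Q) + 4 \<le> 3 * card Q"
    using card_half_part_sumset_le[OF p0, of c B] small cQ by (simp add: H_def)
  have al: "0 \<le> a" "a + e * l \<le> ?h" using Q(7,8) by (auto simp: H_def half_part_def)
  have e_le: "e \<le> ?h"
  proof -
    have "e * 1 \<le> e * l" using Q(1,9) by (intro mult_left_mono) auto
    then show ?thesis using al by simp
  qed
  have l_le: "l \<le> ?h"
  proof -
    have "1 * l \<le> e * l" using Q(1,9) by (intro mult_right_mono) auto
    then show ?thesis using al by simp
  qed
  have "\<not> int p dvd e" using zdvd_not_zless[of e "int p"] Q(1) e_le p0 by linarith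
  then have "coprime e (int p)"
    using p(1) by (metis coprime_commute prime_imp_coprime prime_int_nat_transfer of_nat_0_le_iff nat_int)
  \<comment> \<open>\<open>k\<close> inverts the common difference \<open>e\<close> of the half
    part, so dilation by \<open>k\<close> turns the half part into a translate of the primitive set
    \<open>Q\<close>.\<close>
  then obtain k where k: "[e * k = 1] (mod int p)" using cong_solve_coprime_int by blast
  then have kcop: "coprime k (int p)" by (metis coprime_iff_invertible_int mult.commute)
  define c1 where "c1 = k * (c + a)"
  have kQ: "\<exists>i\<in>B. (k * i) mod int p = (c1 + q) mod int p" if "q \<in> Q" for q
  proof -
    have "(c + (a + e * q)) mod int p \<in> B" using that Q(6) by (auto simp: H_def half_part_def)
    moreover have "[k * (c + (a + e * q)) = c1 + q] (mod int p)"
    proof -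
      have "k * (c + (a + e * q)) = c1 + (e * k) * q" by (simp add: c1_def algebra_simps)
      also have "[c1 + (e * k) * q = c1 + 1 * q] (mod int p)"
        using k by (intro cong_add cong_mult) auto
      finally show ?thesis by simp
    qed
    ultimately show ?thesis
      by (intro bexI[of _ "(c + (a + e * q)) mod int p"]) (simp_all add: Cong.cong_def mod_mult_right_eq)
  qed
  have avoid': "(x + y + z) mod int p \<notin> dilate p k Y"
    if xyz: "x mod int p \<in> dilate p k B" "y mod int p \<in> dilate p k B" "z mod int p \<in> dilate p k B" for x y z
  proof
    assume *: "(x + y + z) mod int p \<in> dilate p k Y"
    obtain i j r where ijr: "i \<in> B" "j \<in> B" "r \<in> B" "x mod int p = (k * i) mod int p"
      "y mod int p = (k * j) mod int p" "z mod int p = (k * r) mod int p"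
      using xyz by (auto simp: dilate_def)
    have "[x + y + z = k * i + k * j + k * r] (mod int p)"
      using ijr by (intro cong_add) (auto simp: Cong.cong_def)
    then have "(x + y + z) mod int p = (k * ((i + j + r) mod int p)) mod int p"
      by (simp add: Cong.cong_def mod_simps distrib_left)
    then have "(i + j + r) mod int p \<in> Y"
      using * dilate_mem_iff[OF kcop Y, of "(i + j + r) mod int p"] p0 by simp
    then show False using avoid ijr by blast
  qed
  have dQ: "(c1 + q) mod int p \<in> dilate p k B" if "q \<in> Q" for q
    using kQ[OF that] unfolding dilate_def by (metis imageI)
  have "\<exists>d. dilate p k Y \<subseteq> (\<lambda>j. (d + j) mod int p) ` {0..int p + 1 - 3 * int (card Q)}"
  proof (rule avoid_triple_sumset[OF dilate_subset[OF p0] Q(2-5) smallQ])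
    fix b b' b'' assume "b \<in> Q" "b' \<in> Q" "b'' \<in> Q"
    then have "((c1 + b) + (c1 + b') + (c1 + b'')) mod int p \<notin> dilate p k Y"
      by (intro avoid' dQ)
    then show "(3 * c1 + b + b' + b'') mod int p \<notin> dilate p k Y" by (simp add: algebra_simps)
  qed
  then obtain d where d: "dilate p k Y \<subseteq> (\<lambda>j. (d + j) mod int p) ` {0..int p + 1 - 3 * int (card Q)}" by blast
  \<comment> \<open>By \<open>large\<close>, the interval that now contains the dilated
    \<open>Y\<close> fits into half of the cycle; thus all of the dilated \<open>B\<close> becomes a
    set of integers.\<close>
  have dY: "dilate p k Y \<subseteq> half_arc p d"
    unfolding half_arc_def using large cQ by (intro order_trans[OF d] image_mono) (auto simp: H_def)
  have dBY: "dilate p k B \<subseteq> dilate p k Y" using BY by (auto simp: dilate_def)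
  define F where "F = half_part p d (dilate p k B)"
  have cF: "card F = card B"
  proof -
    have "dilate p k B \<inter> half_arc p d = dilate p k B" using dBY dY by blast
    then show ?thesis unfolding F_def
      using card_half_part_arc[OF p0 dilate_subset[OF p0]] card_dilate[OF kcop order_trans[OF BY Y]] by simp
  qed
  have finF: "finite F" unfolding F_def by (rule finite_half_part)
  have "card H \<le> card B"
    using card_half_part_arc[OF p0 order_trans[OF BY Y], of c] BY Y
    by (simp add: H_def) (meson card_mono finite_atLeastLessThan_int finite_subset inf_le1)
  have "card (F + F) \<le> card (msum p B B)"
  proof -
    have "card (F + F) \<le> card (msum p (dilate p k B) (dilate p k B))"
      unfolding F_def by (rule card_half_part_sumset_le[OF p0])
    also have "\<dots> = card (msum p B B)"
      unfolding msum_dilate by (rule card_dilate[OF kcop msum_subset[OF p0]])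
    finally show ?thesis .
  qed
  then have smallF: "card (F + F) + 4 \<le> 3 * card F" using small \<open>card H \<le> card B\<close> cF by (simp add: H_def)
  then have Fne: "F \<noteq> {}" by auto
  define f where "f = Min F"
  have f: "f \<in> F" "\<And>x. x \<in> F \<Longrightarrow> f \<le> x" using finF Fne by (auto simp: f_def)
  define E where "E = (\<lambda>x. - f + 1 * x) ` F"
  have cE: "card E = card F" "card (E + E) = card (F + F)"
    unfolding E_def by (rule card_affine_sumset; simp)+
  define l' where "l' = Max F - f"
  have E: "E \<subseteq> {0..l'}" "0 \<in> E" "l' \<in> E"
    using f finF Fne by (auto simp: E_def l'_def intro: image_eqI[of _ _ f] image_eqI[of _ _ "Max F"])
  \<comment> \<open>\<open>F\<close>, of which \<open>E\<close> is a translate, realises all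
    differences of the primitive set \<open>Q\<close>: both sets live in windows of at most half of
    the cycle, so congruent differences are equal integers.\<close>
  have "primitive E"
    unfolding primitive_def
  proof (intro allI impI)
    fix g assume g: "\<forall>x\<in>E. \<forall>y\<in>E. g dvd x - y"
    have gF: "g dvd x - y" if "x \<in> F" "y \<in> F" for x y
    proof -
      have "- f + 1 * x \<in> E" "- f + 1 * y \<in> E" using that by (auto simp: E_def)
      then have "g dvd (- f + 1 * x) - (- f + 1 * y)" using g by blast
      then show ?thesis by simp
    qed
    have pos: "\<exists>j\<in>F. (d + j) mod int p = (c1 + q) mod int p" if "q \<in> Q" for q
    proof -
      have "(c1 + q) mod int p \<in> dilate p k B" using dQ that .
      moreover then have "(c1 + q) mod int p \<in> half_arc p d" using dBY dY by blast
      ultimately show ?thesis by (auto simp: half_arc_def F_def half_part_def)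
    qed
    have "g dvd q - r" if qr: "q \<in> Q" "r \<in> Q" for q r
    proof -
      obtain i j where ij: "i \<in> F" "j \<in> F" "(d + i) mod int p = (c1 + q) mod int p"
        "(d + j) mod int p = (c1 + r) mod int p" using pos qr by blast
      have "[(d + i) - (d + j) = (c1 + q) - (c1 + r)] (mod int p)"
        using ij by (intro cong_diff) (auto simp: Cong.cong_def)
      then have "int p dvd (i - j) - (q - r)" by (simp add: cong_iff_dvd_diff)
      moreover have "\<bar>(i - j) - (q - r)\<bar> < int p"
      proof -
        have "0 \<le> i" "i \<le> ?h" "0 \<le> j" "j \<le> ?h" using ij by (auto simp: F_def half_part_def)
        moreover have "0 \<le> q" "q \<le> ?h" "0 \<le> r" "r \<le> ?h" using qr Q(2) l_le by auto
        ultimately show ?thesis using p0 by linarith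
      qed
      ultimately have "i - j = q - r" using dvd_imp_le_int[of "(i - j) - (q - r)" "int p"] by force
      then show ?thesis using gF[OF ij(1,2)] by simp
    qed
    then show "\<bar>g\<bar> = 1" using Q(5) by (simp add: primitive_def)
  qed
  then have "\<exists>d'. dilate p k Y \<subseteq> (\<lambda>j. (d' + j) mod int p) ` {0..int p + 1 - 3 * int (card E)}"
  proof (rule avoid_triple_sumset[OF dilate_subset[OF p0] E])
    show "card (E + E) + 4 \<le> 3 * card E" using smallF cE by simp
    fix b b' b'' assume b: "b \<in> E" "b' \<in> E" "b'' \<in> E"
    have dE: "(d + f + x) mod int p \<in> dilate p k B" if "x \<in> E" for x
      using that by (auto simp: E_def F_def half_part_def)
    have "((d + f + b) + (d + f + b') + (d + f + b'')) mod int p \<notin> dilate p k Y"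
      by (intro avoid' dE b)
    then show "(3 * (d + f) + b + b' + b'') mod int p \<notin> dilate p k Y" by (simp add: algebra_simps)
  qed
  then show ?thesis using kcop cE cF by auto
qed

section \<open>Weights of fibres\<close>

definition add_char :: "nat \<Rightarrow> int \<Rightarrow> complex" where
  "add_char p x = cis (2 * pi * real_of_int x / real p)"

lemma add_char_add: "add_char p (x + y) = add_char p x * add_char p y"
  by (simp add: add_char_def cis_mult add_divide_distrib distrib_left)

lemma add_char_0 [simp]: "add_char p 0 = 1"
  by (simp add: add_char_def)

lemma norm_add_char [simp]: "cmod (add_char p x) = 1"
  by (simp add: add_char_def)

lemma cnj_add_char: "cnj (add_char p x) = add_char p (- x)"
  by (simp add: add_char_def cis_cnj)

lemma add_char_multiple: "p > 0 \<Longrightarrow> add_char p (int p * k) = 1"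
  using cis_multiple_2pi[of "real_of_int k"] by (simp add: add_char_def mult.assoc)

lemma add_char_mod: "p > 0 \<Longrightarrow> add_char p (x mod int p) = add_char p x"
proof -
  assume p: "p > 0"
  have "add_char p x = add_char p (x mod int p + int p * (x div int p))" by simp
  also have "\<dots> = add_char p (x mod int p)" unfolding add_char_add using add_char_multiple[OF p] by simp
  finally show ?thesis ..
qed

lemma add_char_eq_1_iff:
  assumes "p > 0" shows "add_char p x = 1 \<longleftrightarrow> int p dvd x"
proof
  assume "add_char p x = 1"
  then have "cos (2 * pi * real_of_int x / real p) = 1" by (metis add_char_def cis.sel(1) one_complex.sel(1))
  then obtain k :: int where "2 * pi * real_of_int x / real p = real_of_int k * 2 * pi"
    unfolding cos_one_2pi_int by blast
  then have "real_of_int x = real_of_int (k * int p)" using assms by (simp add: field_simps)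
  then have "x = k * int p" by (simp only: of_int_eq_iff)
  then show "int p dvd x" by simp
next
  assume "int p dvd x"
  then show "add_char p x = 1" using add_char_multiple[OF assms] by (elim dvdE) simp
qed

lemma add_char_power: "add_char p x ^ n = add_char p (int n * x)"
  by (induction n) (auto simp: add_char_add[symmetric] algebra_simps)

lemma sum_add_char:
  assumes p: "p > 0"
  shows "(\<Sum>c\<in>residues_below p. add_char p (c * x)) = (if int p dvd x then of_nat p else 0)"
proof -
  have "(\<Sum>c\<in>residues_below p. add_char p (c * x)) = (\<Sum>n<p. add_char p (int n * x))"
    by (rule sum.reindex_bij_witness[of _ int nat]) auto
  also have "\<dots> = (\<Sum>n<p. add_char p x ^ n)" by (simp add: add_char_power)
  also have "\<dots> = (if int p dvd x then of_nat p else 0)"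
  proof (cases "int p dvd x")
    case True
    then have "add_char p x = 1" using add_char_eq_1_iff[OF p] by simp
    then show ?thesis using True by simp
  next
    case False
    then have "add_char p x \<noteq> 1" using add_char_eq_1_iff[OF p] by simp
    moreover have "add_char p x ^ p = 1"
      unfolding add_char_power using add_char_multiple[OF p] by simp
    ultimately show ?thesis using False by (simp add: geometric_sum)
  qed
  finally show ?thesis .
qed

text \<open>
  Here \<open>a i\<close> is the size of the fibre over \<open>i\<close> in a space of \<open>N\<close> points whose proper subspaces have at most \<open>h\<close> points;
  the constant \<open>565/1000\<close> is below \<open>sqrt (m / (3m+3))\<close> for \<open>m \<ge> 25\<close>.
\<close>

locale fibre_weights =
  fixes p m N h :: nat and a :: "int \<Rightarrow> nat"
  assumes prime: "Factorial_Ring.prime p" and p_eq: "p = 4 * m + 3" and m_ge: "m \<ge> 25"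
    and odd_N: "odd N" and hp: "h * p \<le> N"
    and a_le: "i \<in> residues_below p \<Longrightarrow> a i \<le> N"
    and total: "m * N \<le> (\<Sum>i\<in>residues_below p. a i)"
    and pair: "\<lbrakk>i \<in> residues_below p; j \<in> residues_below p; k \<in> residues_below p;
      0 < a i; 0 < a j; 0 < a k; 0 < a ((i + j + k) mod int p)\<rbrakk> \<Longrightarrow> a i + a j \<le> N"
    and quad: "\<lbrakk>i \<in> residues_below p; j \<in> residues_below p; k \<in> residues_below p;
      0 < a i; 0 < a j; 0 < a k; 0 < a ((i + j + k) mod int p)\<rbrakk>
      \<Longrightarrow> a i + a j + a k + a ((i + j + k) mod int p) \<le> N + 2 * h"
    and fourier: "565 * real (\<Sum>i\<in>residues_below p. a i)
      \<le> 1000 * cmod (\<Sum>i\<in>residues_below p. of_real (real (a i)) * add_char p i)"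
begin

abbreviation "Z \<equiv> residues_below p"
definition "S = (\<Sum>i\<in>Z. a i)"
definition "X t = {i\<in>Z. t < a i}"
definition "Y = X 0"

lemma p0: "p > 0" using p_eq by simp

lemma N0: "N > 0" using odd_N by (rule odd_pos)

lemma X_subset: "X t \<subseteq> Z" by (auto simp: X_def)

lemma finite_X [simp]: "finite (X t)" by (rule finite_subset[OF X_subset]) simp

lemma X_mono: "s \<le> t \<Longrightarrow> card (X t) \<le> card (X s)"
  by (rule card_mono[OF finite_X]) (auto simp: X_def)

lemma sum_indicator: "i \<in> Z \<Longrightarrow> a i = (\<Sum>t<N. of_bool (t < a i))"
proof -
  assume "i \<in> Z"
  then have "{t\<in>{..<N}. t < a i} = {..<a i}" using a_le by fastforce
  then show ?thesis by (simp add: of_bool_def sum.If_cases Int_def)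
qed

text \<open>Layer-cake decomposition into the sets \<open>X t\<close>; it lets Cauchy-Davenport, a
  statement about sets, act on weights.\<close>

lemma layer_sum:
  fixes f :: "int \<Rightarrow> 'b::comm_semiring_1"
  shows "(\<Sum>i\<in>Z. of_nat (a i) * f i) = (\<Sum>t<N. \<Sum>i\<in>X t. f i)"
proof -
  have "(\<Sum>i\<in>Z. of_nat (a i) * f i) = (\<Sum>i\<in>Z. \<Sum>t<N. of_bool (t < a i) * f i)"
    by (rule sum.cong[OF refl], subst sum_indicator)
      (simp_all add: sum_distrib_right)
  also have "\<dots> = (\<Sum>t<N. \<Sum>i\<in>Z. of_bool (t < a i) * f i)" by (rule sum.swap)
  also have "\<dots> = (\<Sum>t<N. \<Sum>i\<in>X t. f i)"
  proof (rule sum.cong[OF refl])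
    fix t
    have "(\<Sum>i\<in>X t. f i) = (\<Sum>i\<in>Z. if i \<in> X t then f i else 0)"
      by (simp add: sum.If_cases X_def Int_def)
    also have "\<dots> = (\<Sum>i\<in>Z. of_bool (t < a i) * f i)" by (rule sum.cong) (auto simp: X_def)
    finally show "(\<Sum>i\<in>Z. of_bool (t < a i) * f i) = (\<Sum>i\<in>X t. f i)" ..
  qed
  finally show ?thesis .
qed

lemma S_layers: "S = (\<Sum>t<N. card (X t))"
  using layer_sum[of "\<lambda>_. 1::nat"] by (simp add: S_def)

text \<open>The second bound passes to the complement, since a nontrivial character sums to zero
  over the cycle; it is the better one for level sets larger than half of the cycle.\<close>

lemma norm_layer:
  "cmod (\<Sum>i\<in>X t. add_char p i) \<le> real (card (X t))"
  "cmod (\<Sum>i\<in>X t. add_char p i) \<le> real p - real (card (X t))"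
proof -
  have bound: "cmod (\<Sum>i\<in>V. add_char p i) \<le> real (card V)" for V
    using norm_sum[of "add_char p" V] by simp
  show "cmod (\<Sum>i\<in>X t. add_char p i) \<le> real (card (X t))" by (rule bound)
  have "p > 1" using p_eq by simp
  then have "\<not> int p dvd 1" by (simp add: zdvd1_eq)
  then have "(\<Sum>i\<in>Z. add_char p i) = 0" using sum_add_char[OF p0, of 1] by simp
  moreover have "(\<Sum>i\<in>Z. add_char p i) = (\<Sum>i\<in>Z - X t. add_char p i) + (\<Sum>i\<in>X t. add_char p i)"
    by (rule sum.subset_diff[OF X_subset]) simp
  ultimately have "(\<Sum>i\<in>X t. add_char p i) = - (\<Sum>i\<in>Z - X t. add_char p i)"
    by (simp add: eq_neg_iff_add_eq_0 add.commute)
  then have "cmod (\<Sum>i\<in>X t. add_char p i) \<le> real (card (Z - X t))" using bound by simp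
  also have "card (Z - X t) = p - card (X t)" by (simp add: card_Diff_subset X_subset)
  also have "real (p - card (X t)) = real p - real (card (X t))"
    using card_mono[OF _ X_subset[of t]] by (simp add: of_nat_diff)
  finally show "cmod (\<Sum>i\<in>X t. add_char p i) \<le> real p - real (card (X t))" .
qed

text \<open>From this level on four weights above the level violate \<open>quad\<close>, so
  \<open>X t\<close> is itself free of solutions of \<open>i + j + k = l\<close> in the
  cycle.\<close>

definition "t0 = (N + 2 * h) div 4"

lemma t0_bounds: "4 * t0 \<le> N + 2 * h" "N + 2 * h < 4 * t0 + 4" "2 * t0 \<le> N"
proof -
  show "4 * t0 \<le> N + 2 * h" "N + 2 * h < 4 * t0 + 4" by (auto simp: t0_def)
  have "2 * h \<le> h * p" using p_eq by simp
  then show "2 * t0 \<le> N" using \<open>4 * t0 \<le> N + 2 * h\<close> hp by linarith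
qed

lemma card_X_t0: "card (X t0) \<le> m + 1"
proof (cases "X t0 = {}")
  case False
  have "card (X t0) + card (X t0) + card (X t0) + card (X t0) \<le> p + 2"
  proof (rule cauchy_davenport_disjoint(2)[OF prime X_subset X_subset X_subset X_subset])
    fix x y z assume xyz: "x \<in> X t0" "y \<in> X t0" "z \<in> X t0"
    show "(x + y + z) mod int p \<notin> X t0"
    proof
      assume "(x + y + z) mod int p \<in> X t0"
      then have "a x + a y + a z + a ((x + y + z) mod int p) \<le> N + 2 * h"
        using xyz by (intro quad) (auto simp: X_def)
      moreover have "t0 < a x" "t0 < a y" "t0 < a z" "t0 < a ((x + y + z) mod int p)"
        using xyz \<open>(x + y + z) mod int p \<in> X t0\<close> by (auto simp: X_def)
      ultimately show False using t0_bounds(2) by linarith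
    qed
  qed (use False in auto)
  then show ?thesis using p_eq by linarith
qed simp

lemma sum_X_tail:
  assumes "t0 \<le> r" "r \<le> N" "\<And>t. r \<le> t \<Longrightarrow> X t = {}"
  shows "(\<Sum>t\<in>{t0..<N}. card (X t)) \<le> (r - t0) * (m + 1)"
proof -
  have "(\<Sum>t\<in>{t0..<N}. card (X t)) = (\<Sum>t\<in>{t0..<r}. card (X t))"
    by (rule sum.mono_neutral_right) (use assms in auto)
  also have "\<dots> \<le> (\<Sum>t\<in>{t0..<r}. m + 1)"
    by (rule sum_mono) (use X_mono[of t0] card_X_t0 in \<open>auto intro: order_trans\<close>)
  finally show ?thesis by simp
qed

lemma sum_split_t0: "S = (\<Sum>t<t0. card (X t)) + (\<Sum>t\<in>{t0..<N}. card (X t))"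
proof -
  have "t0 \<le> N" using t0_bounds(3) by simp
  then have eq: "{..<N} = {..<t0} \<union> {t0..<N}" by auto
  show ?thesis unfolding S_layers eq by (rule sum.union_disjoint) auto
qed

text \<open>If no fibre were more than half full, the Fourier coefficient would be too small.\<close>

lemma exists_large_fibre: "\<exists>i\<in>Z. N < 2 * a i"
proof (rule ccontr)
  assume "\<not> ?thesis"
  then have small: "2 * a i \<le> N" if "i \<in> Z" for i using that not_less by blast
  obtain r where r: "N = 2 * r + 1" using odd_N by (rule oddE)
  have Xr: "X t = {}" if "r \<le> t" for t
    using small r that by (fastforce simp: X_def)
  have tr: "t0 \<le> r" using t0_bounds(3) r by linarith
  let ?T = "\<Sum>t\<in>{t0..<N}. card (X t)"
  have T: "?T \<le> (r - t0) * (m + 1)" by (rule sum_X_tail) (use tr r Xr in auto)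
  have "cmod (\<Sum>i\<in>Z. of_real (real (a i)) * add_char p i) = cmod (\<Sum>t<N. \<Sum>i\<in>X t. add_char p i)"
    using layer_sum[of "add_char p"] by simp
  also have "\<dots> \<le> (\<Sum>t<N. cmod (\<Sum>i\<in>X t. add_char p i))" by (rule norm_sum)
  also have "\<dots> = (\<Sum>t<t0. cmod (\<Sum>i\<in>X t. add_char p i)) + (\<Sum>t\<in>{t0..<N}. cmod (\<Sum>i\<in>X t. add_char p i))"
  proof -
    have eq: "{..<N} = {..<t0} \<union> {t0..<N}" using tr r by auto
    show ?thesis unfolding eq by (rule sum.union_disjoint) auto
  qed
  \<comment> \<open>Below \<open>t0\<close> the level sets may be large, and the complement is used;
    from \<open>t0\<close> on they have at most \<open>m + 1\<close> elements.\<close>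
  also have "\<dots> \<le> (\<Sum>t<t0. real p - real (card (X t))) + (\<Sum>t\<in>{t0..<N}. real (card (X t)))"
    by (intro add_mono sum_mono norm_layer)
  also have "\<dots> = real t0 * real p - real S + 2 * real ?T"
    unfolding sum_split_t0 by (simp add: sum_subtractf)
  finally have W: "cmod (\<Sum>i\<in>Z. of_real (real (a i)) * add_char p i) \<le> real t0 * real p - real S + 2 * real ?T" .
  \<comment> \<open>1565 is 1000 + 565: the term \<open>- S\<close> is moved to the left of the
    Fourier hypothesis. The estimates below lead to
    \<open>1565 * m * N <= 1500 * (m + 1) * N\<close>, which fails for
    \<open>m >= 24\<close>.\<close>
  have "1565 * real S \<le> 1000 * (real t0 * real p + 2 * real ?T)"
    using fourier W unfolding S_def[symmetric] by argo
  then have "1565 * real S \<le> real (1000 * (t0 * p + 2 * ?T))" by simp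
  then have "1565 * S \<le> 1000 * (t0 * p + 2 * ?T)"
    by (metis of_nat_le_iff of_nat_mult of_nat_numeral)
  also have "\<dots> \<le> 1000 * (t0 * p + 2 * ((r - t0) * (m + 1)))" using T by simp
  finally have 1: "1565 * S \<le> 1000 * (t0 * p + 2 * ((r - t0) * (m + 1)))" .
  have "t0 * p + 2 * ((r - t0) * (m + 1)) = t0 * (2 * m + 1) + 2 * (r * (m + 1))"
  proof -
    have "t0 * p + 2 * ((r - t0) * (m + 1)) = t0 * (2 * m + 1) + 2 * ((t0 + (r - t0)) * (m + 1))"
      unfolding p_eq by (simp add: algebra_simps)
    then show ?thesis using tr by simp
  qed
  then have "1565 * S \<le> 1000 * (t0 * (2 * m + 1)) + 2000 * (r * (m + 1))" using 1 by simp
  moreover have "4 * (t0 * (2 * m + 1)) \<le> 2 * (N * (m + 1))"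
  proof -
    have "4 * t0 * (2 * m + 1) \<le> (N + 2 * h) * (2 * m + 1)"
      by (rule mult_right_mono) (use t0_bounds in auto)
    moreover have "2 * h * (2 * m + 1) \<le> h * p" unfolding p_eq by (simp add: algebra_simps)
    ultimately show ?thesis using hp by (simp add: algebra_simps)
  qed
  moreover have "2 * (r * (m + 1)) \<le> N * (m + 1)" unfolding r by simp
  moreover have "1565 * (m * N) \<le> 1565 * S" using total by (simp add: S_def)
  moreover have "N * (m + 1) = m * N + N" "25 * N \<le> m * N" using m_ge by (auto simp: algebra_simps)
  ultimately show False using N0 by linarith
qed

text \<open>With \<open>N = 2 r + 1\<close>, \<open>X r\<close> consists of the more than half full
  fibres, two of which \<open>pair\<close> forbids in a relation with two members of the support. As
  \<open>X r\<close> is nonempty, \<open>2 * card Y <= p\<close>.\<close>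

lemma card_Y_less: "card Y \<le> 2 * m + 1"
proof -
  obtain r where r: "N = 2 * r + 1" using odd_N by (rule oddE)
  obtain i where i: "i \<in> Z" "N < 2 * a i" using exists_large_fibre by blast
  then have iX: "i \<in> X r" using r by (auto simp: X_def)
  have "card (X r) + card (X r) + card Y + card Y \<le> p + 2"
  proof (rule cauchy_davenport_disjoint(2)[OF prime X_subset X_subset])
    fix x y z assume xyz: "x \<in> X r" "y \<in> X r" "z \<in> Y"
    show "(x + y + z) mod int p \<notin> Y"
    proof
      assume "(x + y + z) mod int p \<in> Y"
      then have "a x + a y \<le> N" using xyz by (intro pair[of x y z]) (auto simp: X_def Y_def)
      moreover have "r < a x" "r < a y" using xyz by (auto simp: X_def)
      ultimately show False using r by linarith
    qed
  qed (use iX i in \<open>auto simp: Y_def X_def\<close>)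
  moreover have "card (X r) > 0" using iX by (auto simp: card_gt_0_iff)
  ultimately show ?thesis using p_eq by linarith
qed

definition "M = Max (a ` Z)"

lemma M_props: "M \<le> N" "i \<in> Z \<Longrightarrow> a i \<le> M" "\<exists>i\<in>Z. a i = M"
proof -
  show "i \<in> Z \<Longrightarrow> a i \<le> M" by (simp add: M_def)
  have ne: "a ` Z \<noteq> {}" using p0 by auto
  have "M \<in> a ` Z" unfolding M_def by (rule Max_in) (use ne in auto)
  then obtain i where i: "i \<in> Z" "a i = M" by (metis imageE)
  then show "\<exists>i\<in>Z. a i = M" by blast
  show "M \<le> N" using a_le[OF i(1)] i(2) by simp
qed

lemma X_empty_iff: "X t = {} \<longleftrightarrow> M \<le> t"
  using M_props by (fastforce simp: X_def)

text \<open>Level sets have at most \<open>2 * m + 1\<close> elements below \<open>t0\<close>, at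
  most \<open>m + 1\<close> from there to \<open>M\<close>, and none above. With \<open>t0\<close>
  near N/4, a maximum of at most 2N/3 would bring the total to about 11/12 of
  \<open>m * N\<close>.\<close>

lemma M_large: "2 * N < 3 * M"
proof (rule ccontr)
  assume "\<not> ?thesis"
  then have M: "3 * M \<le> 2 * N" by simp
  have "N < 2 * M" using exists_large_fibre M_props(2) by force
  then have tM: "t0 \<le> M" using t0_bounds(3) by linarith
  have "(\<Sum>t<t0. card (X t)) \<le> (\<Sum>t<t0. 2 * m + 1)"
    by (rule sum_mono) (use X_mono[of 0] card_Y_less in \<open>force simp: Y_def intro: order_trans\<close>)
  moreover have "(\<Sum>t\<in>{t0..<N}. card (X t)) \<le> (M - t0) * (m + 1)"
    by (rule sum_X_tail[OF tM M_props(1)]) (simp add: X_empty_iff)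
  ultimately have "S \<le> t0 * (2 * m + 1) + (M - t0) * (m + 1)" unfolding sum_split_t0 by simp
  also have "\<dots> = t0 * m + (t0 + (M - t0)) * (m + 1)" by (simp add: algebra_simps)
  also have "\<dots> = t0 * m + M * (m + 1)" using tM by simp
  finally have "m * N \<le> t0 * m + M * (m + 1)" using total by (simp add: S_def)
  moreover have "4 * (t0 * m) \<le> N * m + 2 * (h * m)"
    using mult_right_mono[OF t0_bounds(1), of m] by (simp add: algebra_simps)
  moreover have "4 * (h * m) \<le> N" using hp unfolding p_eq by (simp add: algebra_simps)
  moreover have "3 * (M * (m + 1)) \<le> 2 * (N * m) + 2 * N"
    using mult_right_mono[OF M, of "m + 1"] by (simp add: algebra_simps)
  moreover have "m * N = N * m" "25 * N \<le> m * N" using m_ge by (auto simp: algebra_simps)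
  ultimately show False using N0 by linarith
qed

text \<open>Level \<open>t\<close> is paired with level \<open>N - 1 - t\<close>. In the
  \<open>D\<close> central pairs both sets are nonempty, and \<open>pair\<close> with
  Cauchy-Davenport bounds their joint size by \<open>c = p + 2 - 2 * card Y\<close>; in the
  \<open>2 * E\<close> others one set is empty and the other lies in \<open>Y\<close>. If
  \<open>card Y >= m + 3\<close>, the small central pairs cost more than the outer ones can gain,
  because \<open>M_large\<close> gives \<open>E < D\<close>.\<close>

lemma card_Y_le: "card Y \<le> m + 2"
proof (rule ccontr)
  assume big: "\<not> ?thesis"
  define z where "z = card Y - (m + 3)"
  have z: "card Y = m + 3 + z" using big by (simp add: z_def)
  define D where "D = 2 * M - N"
  define E where "E = N - M"
  have DE: "N = D + 2 * E" "M = D + E" "E < D"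
    using M_large M_props(1) by (auto simp: D_def E_def)
  define c where "c = 4 * m + 5 - 2 * card Y"
  have c: "c + 2 * card Y = p + 2" using card_Y_less p_eq by (simp add: c_def)
  have Yeq: "X s \<subseteq> Y" for s by (auto simp: X_def Y_def)
  have Yle: "card (X s) \<le> card Y" for s using X_mono[of 0 s] by (simp add: Y_def)
  have bound: "card (X t) + card (X (N - Suc t)) \<le> (if t \<in> {E..<M} then c else card Y)" if "t < N" for t
  proof (cases "t \<in> {E..<M}")
    case True
    then have ne: "X t \<noteq> {}" "X (N - Suc t) \<noteq> {}" using that DE by (auto simp: X_empty_iff)
    then have "Y \<noteq> {}" using Yeq by blast
    have "card (X t) + card (X (N - Suc t)) + card Y + card Y \<le> p + 2"
    proof (rule cauchy_davenport_disjoint(2)[OF prime X_subset X_subset])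
      fix x y w assume xyz: "x \<in> X t" "y \<in> X (N - Suc t)" "w \<in> Y"
      show "(x + y + w) mod int p \<notin> Y"
      proof
        assume "(x + y + w) mod int p \<in> Y"
        then have "a x + a y \<le> N" using xyz by (intro pair[of x y w]) (auto simp: X_def Y_def)
        moreover have "t < a x" "N - Suc t < a y" using xyz by (auto simp: X_def)
        ultimately show False using that by linarith
      qed
    qed (use ne \<open>Y \<noteq> {}\<close> in \<open>auto simp: Y_def X_subset\<close>)
    then show ?thesis using c True by simp
  next
    case False
    then have "X t = {} \<or> X (N - Suc t) = {}" using that DE unfolding X_empty_iff by auto
    then show ?thesis using False Yle[of t] Yle[of "N - Suc t"] by auto
  qed
  have "2 * S = (\<Sum>t<N. card (X t) + card (X (N - Suc t)))"
    unfolding S_layers sum.distrib using sum.nat_diff_reindex[of "\<lambda>t. card (X t)" N] by simp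
  also have "\<dots> \<le> (\<Sum>t<N. if t \<in> {E..<M} then c else card Y)"
    by (rule sum_mono) (use bound in auto)
  also have "\<dots> = card {E..<M} * c + card ({..<N} - {E..<M}) * card Y"
  proof -
    have "{..<N} \<inter> {t. t \<in> {E..<M}} = {E..<M}" "{..<N} \<inter> - {t. t \<in> {E..<M}} = {..<N} - {E..<M}"
      using DE by auto
    then show ?thesis by (simp only: sum.If_cases[OF finite_lessThan] sum_constant of_nat_id)
  qed
  also have "card ({..<N} - {E..<M}) = N - card {E..<M}"
    by (subst card_Diff_subset) (use DE in auto)
  finally have "2 * S \<le> D * c + 2 * E * card Y" using DE by simp
  then have "2 * (m * N) \<le> D * c + 2 * E * card Y" using total unfolding S_def by linarith
  then have "int (2 * (m * N)) \<le> int (D * c + 2 * E * card Y)" by (simp only: of_nat_le_iff)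
  then have le: "2 * int m * (int D + 2 * int E) \<le> int D * int c + 2 * int E * int (card Y)"
    unfolding DE(1) by (simp add: mult.assoc)
  have cc: "int c = 2 * int m - 1 - 2 * int z" using c z p_eq by linarith
  have "int D * (1 + 2 * int z) \<le> 2 * (int E * (3 + int z - int m))"
    using le unfolding cc z by (simp add: algebra_simps)
  also have "\<dots> \<le> 2 * (int E * int z)" using m_ge by (intro mult_left_mono) auto
  also have "\<dots> \<le> 2 * (int D * int z)" using DE(3) by (intro mult_left_mono mult_right_mono) auto
  finally have "int D \<le> 0" by (simp add: algebra_simps)
  then show False using DE(3) by simp
qed

lemma card_Y_ge: "m \<le> card Y"
proof -
  have "m * N \<le> S" using total by (simp add: S_def)
  also have "S = (\<Sum>i\<in>Y. a i)"
    unfolding S_def by (rule sum.mono_neutral_right) (auto simp: Y_def X_def)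
  also have "\<dots> \<le> (\<Sum>i\<in>Y. N)" by (rule sum_mono) (use a_le in \<open>auto simp: Y_def X_def\<close>)
  finally show ?thesis using N0 by simp
qed

section \<open>Heavy fibres and the short interval containing the support\<close>

definition "B = {i\<in>Z. N < 2 * a i}"

lemma B_subset: "B \<subseteq> Y" "Y \<subseteq> Z" "B \<subseteq> Z" by (auto simp: B_def Y_def X_def)

lemma finite_BY [simp]: "finite B" "finite Y"
  using B_subset finite_subset[of _ Z] by simp_all

lemma B_avoids:
  assumes "x \<in> B" "y \<in> B" "z \<in> Y" shows "(x + y + z) mod int p \<notin> Y"
proof
  assume "(x + y + z) mod int p \<in> Y"
  then have "a x + a y \<le> N" using assms by (intro pair[of x y z]) (auto simp: Y_def X_def B_def)
  then show False using assms by (simp add: B_def)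
qed

text \<open>Each light fibre lacks at least (N + 1)/2 points, as \<open>N\<close> is odd, while the
  whole support lacks at most \<open>N * (card Y - m)\<close>.\<close>

lemma card_light_fibres:
  "card (Y - B) * (N + 1) \<le> 2 * N * (card Y - m)"
proof -
  have "int (card (Y - B)) * (int N + 1) = (\<Sum>i\<in>Y - B. int N + 1)" by simp
  also have "\<dots> \<le> (\<Sum>i\<in>Y - B. 2 * (int N - int (a i)))"
  proof (rule sum_mono)
    fix i assume "i \<in> Y - B"
    then have "2 * a i \<le> N" using B_subset by (auto simp: B_def)
    moreover have "2 * a i \<noteq> N" using odd_N by auto
    ultimately have "2 * a i + 1 \<le> N" by linarith
    then show "int N + 1 \<le> 2 * (int N - int (a i))" by simp
  qed
  also have "\<dots> \<le> (\<Sum>i\<in>Y. 2 * (int N - int (a i)))"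
    by (rule sum_mono2) (use a_le B_subset in auto)
  also have "\<dots> = 2 * (int N * int (card Y) - int (\<Sum>i\<in>Y. a i))"
    by (simp add: sum_subtractf sum_distrib_left[symmetric])
  also have "(\<Sum>i\<in>Y. a i) = S"
    unfolding S_def by (rule sum.mono_neutral_left) (auto simp: Y_def X_def)
  also have "2 * (int N * int (card Y) - int S) \<le> 2 * (int N * int (card Y) - int (m * N))"
    using total by (simp add: S_def del: of_nat_mult of_nat_sum)
  also have "\<dots> = 2 * int N * (int (card Y) - int m)" by (simp add: algebra_simps)
  also have "int (card Y) - int m = int (card Y - m)" using card_Y_ge by simp
  finally have "int (card (Y - B) * (N + 1)) \<le> int (2 * N * (card Y - m))"
    unfolding of_nat_mult of_nat_add of_nat_1 of_nat_numeral .
  then show ?thesis by (simp only: of_nat_le_iff)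
qed

text \<open>The gap between \<open>N\<close> and \<open>N + 1\<close> makes the bound strict.
  Together with \<open>card_Y_le\<close> it leaves at most three light fibres.\<close>

lemma card_light_less: "card Y = m \<and> card (Y - B) = 0 \<or> card (Y - B) + 1 \<le> 2 * (card Y - m)"
proof (cases "card Y = m")
  case True then show ?thesis using card_light_fibres by simp
next
  case False
  have "2 * N * (card Y - m) < 2 * (card Y - m) * (N + 1)" using False card_Y_ge by simp
  then have "card (Y - B) * (N + 1) < 2 * (card Y - m) * (N + 1)" using card_light_fibres by linarith
  then have "card (Y - B) < 2 * (card Y - m)" by (simp only: mult_less_cancel2)
  then show ?thesis by simp
qed

text \<open>The best half carries at least 1565/2000 of the weight; there a heavy fibre contributes
  at most \<open>N\<close> and a light one at most N/2.\<close>

lemma heavy_half_part: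
  "\<exists>c. 1565 * m \<le> 2000 * card (half_part p c B) + 1000 * card (Y - B)"
proof -
  have "odd p" using p_eq by simp
  then obtain c where c: "2 * (\<Sum>i\<in>half_arc p c. real (a i)) \<ge> (\<Sum>i\<in>Z. real (a i))
      + cmod (\<Sum>i\<in>Z. of_real (real (a i)) * add_char p i)"
    using weight_half_arc[of p "\<lambda>i. real (a i)"] unfolding add_char_def by auto
  let ?I = "half_arc p c"
  have IZ: "?I \<subseteq> Z" using p0 by (auto simp: half_arc_def)
  have "2000 * (\<Sum>i\<in>?I. real (a i)) \<ge> 1565 * real S"
    using c fourier unfolding S_def[symmetric] by (simp add: S_def[symmetric] flip: of_nat_sum)
  then have "real (2000 * (\<Sum>i\<in>?I. a i)) \<ge> real (1565 * S)" by simp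
  then have 1: "2000 * (\<Sum>i\<in>?I. a i) \<ge> 1565 * S" by (simp only: of_nat_le_iff)
  have "(\<Sum>i\<in>?I. 2 * a i) = (\<Sum>i\<in>?I \<inter> Y. 2 * a i)"
    by (rule sum.mono_neutral_right) (use IZ in \<open>auto simp: Y_def X_def half_arc_def\<close>)
  also have "\<dots> = (\<Sum>i\<in>(B \<inter> ?I) \<union> ((Y - B) \<inter> ?I). 2 * a i)"
    by (rule sum.cong) (use B_subset in auto)
  also have "\<dots> = (\<Sum>i\<in>B \<inter> ?I. 2 * a i) + (\<Sum>i\<in>(Y - B) \<inter> ?I. 2 * a i)"
    by (rule sum.union_disjoint) auto
  also have "\<dots> \<le> (\<Sum>i\<in>B \<inter> ?I. 2 * N) + (\<Sum>i\<in>(Y - B) \<inter> ?I. N)"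
    by (intro add_mono sum_mono) (use a_le B_subset in \<open>auto simp: B_def\<close>)
  also have "\<dots> \<le> 2 * N * card (B \<inter> ?I) + N * card (Y - B)"
    using card_mono[of "Y - B" "(Y - B) \<inter> ?I"] by simp
  also have "card (B \<inter> ?I) = card (half_part p c B)"
    using card_half_part_arc[OF p0 B_subset(3)] by simp
  finally have "2 * (\<Sum>i\<in>?I. a i) \<le> 2 * N * card (half_part p c B) + N * card (Y - B)"
    by (simp add: sum_distrib_left)
  moreover have "1565 * (m * N) \<le> 1565 * S" using total by (simp add: S_def)
  ultimately have "1565 * (m * N) \<le> 1000 * (2 * N * card (half_part p c B) + N * card (Y - B))"
    using 1 by (simp only: distrib_left mult.assoc)
  then have "(1565 * m) * N \<le> (2000 * card (half_part p c B) + 1000 * card (Y - B)) * N"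
    by (simp add: algebra_simps)
  then show ?thesis using N0 by (auto simp only: mult_le_cancel2)
qed

theorem support_in_short_interval:
  "\<exists>k d. coprime k (int p) \<and> dilate p k Y \<subseteq> (\<lambda>j. (d + j) mod int p) ` {0..int m + 7}"
proof -
  have "odd p" using p_eq by simp
  obtain c where c: "1565 * m \<le> 2000 * card (half_part p c B) + 1000 * card (Y - B)"
    using heavy_half_part by blast
  obtain i where i: "i \<in> B" using exists_large_fibre by (auto simp: B_def)
  have "card (msum p B B) + card Y + card Y \<le> p + 1"
    by (rule cauchy_davenport_disjoint(1)[OF prime]) (use B_subset i B_avoids in auto)
  note sum_BB = this
  have cB: "card Y = card B + card (Y - B)"
    using B_subset card_mono[OF finite_BY(2) B_subset(1)] by (simp add: card_Diff_subset)
  note facts = sum_BB card_Y_le card_Y_ge card_light_less c p_eq m_ge cB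
  \<comment> \<open>With s = \<open>card Y - m\<close>, Cauchy-Davenport gives doubling at most 2m +
    4 - 2s, so this inequality is exactly the \<open>3k-4\<close> condition for the heavy half
    part.\<close>
  have key: "2 * m + 8 \<le> 3 * card (half_part p c B) + 2 * (card Y - m)"
    using facts by linarith
  have "\<exists>k d. coprime k (int p) \<and>
      dilate p k Y \<subseteq> (\<lambda>j. (d + j) mod int p) ` {0..int p + 1 - 3 * int (card B)}"
  proof (rule short_interval_of_half_part[OF prime \<open>odd p\<close> B_subset(1,2)])
    show "card (msum p B B) + 4 \<le> 3 * card (half_part p c B)" using facts key by linarith
    show "int p + 1 - 3 * int (card (half_part p c B)) \<le> (int p - 1) div 2" using facts key by linarith
    fix b b' b'' assume "b \<in> B" "b' \<in> B" "b'' \<in> B"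
    then show "(b + b' + b'') mod int p \<notin> Y" using B_avoids B_subset by blast
  qed
  then obtain k d where kd: "coprime k (int p)"
      "dilate p k Y \<subseteq> (\<lambda>j. (d + j) mod int p) ` {0..int p + 1 - 3 * int (card B)}" by blast
  \<comment> \<open>The bound on light fibres gives \<open>card B >= m - 1\<close>, and
    \<open>4 m + 4 - 3 (m - 1) = m + 7\<close>.\<close>
  have "int p + 1 - 3 * int (card B) \<le> int m + 7" using facts by linarith
  then have "{0..int p + 1 - 3 * int (card B)} \<subseteq> {0..int m + 7}" by simp
  then have "dilate p k Y \<subseteq> (\<lambda>j. (d + j) mod int p) ` {0..int m + 7}"
    using image_mono order_trans[OF kd(2)] by metis
  then show ?thesis using kd(1) by (intro exI[of _ k] exI[of _ d]) simp
qed

end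

section \<open>Vectors and fibres\<close>

lemma carrier_F: "carrier (F p) = residues_below p"
  by (auto simp: residue_ring_def)

definition vadd :: "nat \<Rightarrow> int list \<Rightarrow> int list \<Rightarrow> int list" where
  "vadd p = map2 (\<lambda>a b. (a + b) mod int p)"

definition vscale :: "nat \<Rightarrow> int \<Rightarrow> int list \<Rightarrow> int list" where
  "vscale p k = map (\<lambda>a. (k * a) mod int p)"

abbreviation vectors :: "nat \<Rightarrow> nat \<Rightarrow> int list set" where
  "vectors p n \<equiv> carrier (Fvec p n)"

abbreviation (input) vgroup where
  "vgroup p n \<equiv> add_monoid (Fvec p n)"

lemma vectors_iff: "x \<in> vectors p n \<longleftrightarrow> length x = n \<and> (\<forall>i<n. x ! i \<in> residues_below p)"
  unfolding Fvec_def carrier_F by (auto simp: set_conv_nth subset_eq)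

lemma vectors_length: "x \<in> vectors p n \<Longrightarrow> length x = n" by (simp add: vectors_iff)

lemma add_Fvec: "add (Fvec p n) = vadd p"
  by (simp add: Fvec_def vadd_def residue_ring_def)

lemma zero_Fvec: "zero (Fvec p n) = replicate n 0"
  by (simp add: Fvec_def residue_ring_def)

lemma smult_Fvec: "module.smult (Fvec p n) = vscale p"
  by (intro ext) (simp add: Fvec_def vscale_def residue_ring_def)

lemma length_vadd [simp]: "length (vadd p x y) = min (length x) (length y)"
  by (simp add: vadd_def)

lemma nth_vadd: "i < length x \<Longrightarrow> i < length y \<Longrightarrow> vadd p x y ! i = (x ! i + y ! i) mod int p"
  by (simp add: vadd_def)

lemma vadd_Cons [simp]: "vadd p (a # x) (b # y) = (a + b) mod int p # vadd p x y"
  by (simp add: vadd_def)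

lemma vscale_Cons [simp]: "vscale p k (a # x) = (k * a) mod int p # vscale p k x"
  by (simp add: vscale_def)

lemma length_vscale [simp]: "length (vscale p k x) = length x"
  by (simp add: vscale_def)

lemma nth_vscale: "i < length x \<Longrightarrow> vscale p k x ! i = (k * x ! i) mod int p"
  by (simp add: vscale_def)

lemma vectors_0: "vectors p 0 = {[]}"
  by (auto simp: vectors_iff)

lemma Cons_vectors [simp]: "a # x \<in> vectors p (Suc n) \<longleftrightarrow> a \<in> residues_below p \<and> x \<in> vectors p n"
  by (auto simp: Fvec_def carrier_F)

lemma vectors_Suc: "vectors p (Suc n) = (\<lambda>(a, x). a # x) ` (residues_below p \<times> vectors p n)"
proof (intro equalityI subsetI)
  fix x assume x: "x \<in> vectors p (Suc n)"
  then obtain a y where "x = a # y" using vectors_length by (metis length_Suc_conv)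
  then show "x \<in> (\<lambda>(a, x). a # x) ` (residues_below p \<times> vectors p n)" using x by auto
qed auto

lemma finite_vectors [simp]: "finite (vectors p n)"
  by (induction n) (simp_all add: vectors_0 vectors_Suc)

lemma card_vectors: "card (vectors p n) = p ^ n"
proof (induction n)
  case (Suc n)
  have "card (vectors p (Suc n)) = card (residues_below p \<times> vectors p n)"
    unfolding vectors_Suc by (rule card_image) (auto simp: inj_on_def)
  then show ?case using Suc by (simp add: card_cartesian_product)
qed (simp add: vectors_0)

lemma vadd_comm: "vadd p x y = vadd p y x"
  by (auto intro!: nth_equalityI simp: nth_vadd add.commute)

lemma vadd_assoc: "vadd p (vadd p x y) z = vadd p x (vadd p y z)"
  by (auto intro!: nth_equalityI simp: nth_vadd mod_simps add.assoc)

lemma (in comm_monoid) finprod_one_two_three: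
  fixes x :: "nat \<Rightarrow> 'a"
  assumes "x 1 \<in> carrier G" "x 2 \<in> carrier G" "x 3 \<in> carrier G"
  shows "finprod G x {1..3} = x 1 \<otimes> x 2 \<otimes> x 3"
proof -
  have "{1..3::nat} = insert 1 (insert 2 {3})" by auto
  then show ?thesis using assms by (simp add: m_assoc)
qed

locale fvec =
  fixes p :: nat
  assumes prime: "Factorial_Ring.prime p"
begin

lemma p_pos: "p > 0" and p_gt_1: "p > 1"
  using prime prime_gt_0_nat prime_gt_1_nat by auto

lemma vadd_closed: "x \<in> vectors p n \<Longrightarrow> y \<in> vectors p n \<Longrightarrow> vadd p x y \<in> vectors p n"
  using p_pos by (simp add: vectors_iff nth_vadd)

lemma vscale_closed: "x \<in> vectors p n \<Longrightarrow> vscale p k x \<in> vectors p n"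
  using p_pos by (simp add: vectors_iff nth_vscale)

lemma zero_closed: "replicate n 0 \<in> vectors p n"
  using p_pos by (simp add: vectors_iff)

lemma vadd_zero: "x \<in> vectors p n \<Longrightarrow> vadd p (replicate n 0) x = x"
  by (auto intro!: nth_equalityI simp: nth_vadd vectors_iff)

lemma vadd_neg: "x \<in> vectors p n \<Longrightarrow> vadd p (vscale p (-1) x) x = replicate n 0"
  by (auto intro!: nth_equalityI simp: nth_vadd nth_vscale vectors_iff mod_simps)

lemma comm_group_vgroup: "comm_group (vgroup p n)"
proof (rule comm_groupI)
  fix x assume x: "x \<in> carrier (vgroup p n)"
  show "\<exists>y\<in>carrier (vgroup p n). y \<otimes>\<^bsub>vgroup p n\<^esub> x = \<one>\<^bsub>vgroup p n\<^esub>"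
    using vadd_neg vscale_closed x by (auto simp: add_Fvec zero_Fvec intro!: bexI[of _ "vscale p (-1) x"])
next
  fix x y show "x \<otimes>\<^bsub>vgroup p n\<^esub> y = y \<otimes>\<^bsub>vgroup p n\<^esub> x" by (simp add: add_Fvec vadd_comm)
qed (auto simp: add_Fvec zero_Fvec vadd_closed zero_closed vadd_zero vadd_assoc)

lemma order_vgroup: "Coset.order (vgroup p n) = p ^ n"
  by (simp add: Coset.order_def card_vectors)

lemma inv_vgroup:
  assumes "x \<in> vectors p n" shows "inv\<^bsub>vgroup p n\<^esub> x = vscale p (-1) x"
proof -
  interpret G: comm_group "vgroup p n" by (rule comm_group_vgroup)
  show ?thesis
    by (rule G.inv_equality) (use assms vadd_neg vscale_closed in \<open>simp_all add: add_Fvec zero_Fvec\<close>)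
qed

lemma vadd_left_cancel:
  assumes "x \<in> vectors p n" "y \<in> vectors p n" "z \<in> vectors p n" "vadd p z x = vadd p z y"
  shows "x = y"
proof -
  have inv: "vadd p (vscale p (-1) z) (vadd p z w) = w" if "w \<in> vectors p n" for w
    using vadd_neg[OF assms(3)] vadd_zero[OF that] by (simp add: vadd_assoc[symmetric])
  show ?thesis using inv[OF assms(1)] inv[OF assms(2)] unfolding assms(4) by (rule trans[OF sym])
qed

lemma inj_on_vadd:
  assumes "z \<in> vectors p n" "S \<subseteq> vectors p n" shows "inj_on (vadd p z) S"
proof (rule inj_onI)
  fix x y assume "x \<in> S" "y \<in> S" "vadd p z x = vadd p z y"
  then show "x = y" using assms by (intro vadd_left_cancel[of x n y z]) auto
qed

definition sum_free :: "nat \<Rightarrow> int list set \<Rightarrow> bool" where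
  "sum_free n A \<longleftrightarrow> A \<subseteq> vectors p n \<and> (\<forall>x\<in>A. \<forall>y\<in>A. \<forall>z\<in>A. vadd p (vadd p x y) z \<notin> A)"

lemma hfold_sumset_3:
  assumes "X \<subseteq> vectors p n"
  shows "hfold_sumset (Fvec p n) 3 X = {vadd p (vadd p x y) z | x y z. x \<in> X \<and> y \<in> X \<and> z \<in> X}"
proof -
  interpret G: comm_group "vgroup p n" by (rule comm_group_vgroup)
  have fs: "finsum (Fvec p n) x {1..3} = vadd p (vadd p (x 1) (x 2)) (x 3)"
    if "x 1 \<in> X" "x 2 \<in> X" "x 3 \<in> X" for x :: "nat \<Rightarrow> int list"
  proof -
    have c: "x 1 \<in> vectors p n" "x 2 \<in> vectors p n" "x 3 \<in> vectors p n" using that assms by auto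
    have "finprod (vgroup p n) x {1..3} = x 1 \<otimes>\<^bsub>vgroup p n\<^esub> x 2 \<otimes>\<^bsub>vgroup p n\<^esub> x 3"
      by (rule G.finprod_one_two_three) (use c in simp_all)
    then show ?thesis unfolding finsum_def by (simp add: add_Fvec)
  qed
  show ?thesis
  proof (intro equalityI subsetI)
    fix s assume "s \<in> hfold_sumset (Fvec p n) 3 X"
    then obtain x :: "nat \<Rightarrow> int list" where x: "s = finsum (Fvec p n) x {1..3}" "\<forall>i\<in>{1..3}. x i \<in> X"
      unfolding hfold_sumset_def by blast
    then have "x 1 \<in> X" "x 2 \<in> X" "x 3 \<in> X" by auto
    then show "s \<in> {vadd p (vadd p x y) z | x y z. x \<in> X \<and> y \<in> X \<and> z \<in> X}"
      using fs x(1) by blast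
  next
    fix s assume "s \<in> {vadd p (vadd p x y) z | x y z. x \<in> X \<and> y \<in> X \<and> z \<in> X}"
    then obtain x y z where s: "s = vadd p (vadd p x y) z" "x \<in> X" "y \<in> X" "z \<in> X" by blast
    let ?f = "\<lambda>i::nat. if i = 1 then x else if i = 2 then y else z"
    have "finsum (Fvec p n) ?f {1..3} = s" using fs[of ?f] s by simp
    moreover have "\<forall>i\<in>{1..3}. ?f i \<in> X" using s by auto
    ultimately show "s \<in> hfold_sumset (Fvec p n) 3 X" unfolding hfold_sumset_def by blast
  qed
qed

lemma sum_free_3_1_imp:
  assumes "sum_free_3_1 p n A" shows "sum_free n A" "A \<noteq> {}"
proof -
  have sub: "A \<subseteq> vectors p n" and disj: "hfold_sumset (Fvec p n) 3 A \<inter> A = {}" and ne: "A \<noteq> {}"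
    using assms by (auto simp: sum_free_3_1_def)
  show "sum_free n A" unfolding sum_free_def
    using sub disj unfolding hfold_sumset_3[OF sub] by blast
  show "A \<noteq> {}" by (rule ne)
qed

definition aut :: "nat \<Rightarrow> (int list \<Rightarrow> int list) \<Rightarrow> bool" where
  "aut n \<phi> \<longleftrightarrow> bij_betw \<phi> (vectors p n) (vectors p n) \<and>
    (\<forall>x\<in>vectors p n. \<forall>y\<in>vectors p n. \<phi> (vadd p x y) = vadd p (\<phi> x) (\<phi> y))"

lemma aut_iso: "aut n \<phi> \<longleftrightarrow> \<phi> \<in> iso (vgroup p n) (vgroup p n)"
  by (auto simp: aut_def iso_def hom_def add_Fvec bij_betw_def)

lemma F_isomorphicI: "aut n \<phi> \<Longrightarrow> \<phi> ` A = B \<Longrightarrow> F_isomorphic p n A B"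
  unfolding F_isomorphic_def aut_iso by blast

lemma F_isomorphicE:
  assumes "F_isomorphic p n A B" obtains \<phi> where "aut n \<phi>" "\<phi> ` A = B"
  using assms unfolding F_isomorphic_def aut_iso by blast

lemma autI:
  assumes "\<And>x. x \<in> vectors p n \<Longrightarrow> \<phi> x \<in> vectors p n"
    and add: "\<And>x y. x \<in> vectors p n \<Longrightarrow> y \<in> vectors p n \<Longrightarrow> \<phi> (vadd p x y) = vadd p (\<phi> x) (\<phi> y)"
    and ker: "\<And>x. x \<in> vectors p n \<Longrightarrow> \<phi> x = replicate n 0 \<Longrightarrow> x = replicate n 0"
  shows "aut n \<phi>"
proof -
  interpret G: comm_group "vgroup p n" by (rule comm_group_vgroup)
  have h: "group_hom (vgroup p n) (vgroup p n) \<phi>"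
    by unfold_locales (use assms in \<open>auto simp: hom_def add_Fvec\<close>)
  have "inj_on \<phi> (vectors p n)"
  proof -
    have "inj_on \<phi> (carrier (vgroup p n))"
      unfolding group_hom.inj_on_one_iff[OF h] using ker by (auto simp: zero_Fvec)
    then show ?thesis by simp
  qed
  then have "bij_betw \<phi> (vectors p n) (vectors p n)"
    using assms(1) by (simp add: bij_betw_def card_image card_subset_eq image_subset_iff)
  then show ?thesis using add by (simp add: aut_def)
qed

lemma aut_comp:
  assumes "aut n \<phi>" "aut n \<psi>" shows "aut n (\<psi> \<circ> \<phi>)"
  using assms iso_set_trans[of \<phi> "vgroup p n" "vgroup p n" \<psi> "vgroup p n"]
  unfolding aut_iso comp_def compose_def by (metis (no_types, lifting) assms aut_def aut_iso)

lemma F_isomorphic_trans: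
  assumes "F_isomorphic p n A B" "F_isomorphic p n B C" shows "F_isomorphic p n A C"
proof -
  obtain \<phi> \<psi> where "aut n \<phi>" "\<phi> ` A = B" "aut n \<psi>" "\<psi> ` B = C"
    using assms by (elim F_isomorphicE)
  then show ?thesis by (intro F_isomorphicI[of n "\<psi> \<circ> \<phi>"]) (auto simp: aut_comp image_comp)
qed

lemma aut_image:
  assumes "aut n \<phi>" "A \<subseteq> vectors p n"
  shows "\<phi> ` A \<subseteq> vectors p n" "card (\<phi> ` A) = card A"
proof -
  have inj: "inj_on \<phi> (vectors p n)" and im: "\<phi> ` vectors p n = vectors p n"
    using assms(1) by (auto simp: aut_def bij_betw_def)
  show "\<phi> ` A \<subseteq> vectors p n" using im assms(2) by blast
  show "card (\<phi> ` A) = card A" by (rule card_image[OF inj_on_subset[OF inj assms(2)]])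
qed

lemma aut_sum_free:
  assumes \<phi>: "aut n \<phi>" and A: "sum_free n A" shows "sum_free n (\<phi> ` A)"
proof -
  have sub: "A \<subseteq> vectors p n" using A by (simp add: sum_free_def)
  have "vadd p (vadd p (\<phi> x) (\<phi> y)) (\<phi> z) \<notin> \<phi> ` A" if xyz: "x \<in> A" "y \<in> A" "z \<in> A" for x y z
  proof
    assume "vadd p (vadd p (\<phi> x) (\<phi> y)) (\<phi> z) \<in> \<phi> ` A"
    moreover have "vadd p (vadd p (\<phi> x) (\<phi> y)) (\<phi> z) = \<phi> (vadd p (vadd p x y) z)"
      using \<phi> xyz sub vadd_closed by (simp add: aut_def subset_eq)
    ultimately have "\<phi> (vadd p (vadd p x y) z) \<in> \<phi> ` A" by simp
    moreover have "inj_on \<phi> (vectors p n)" using \<phi> by (simp add: aut_def bij_betw_def)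
    moreover have "vadd p (vadd p x y) z \<in> vectors p n" using xyz sub vadd_closed by (simp add: subset_eq)
    ultimately have "vadd p (vadd p x y) z \<in> A" using sub by (simp add: inj_on_image_mem_iff)
    then show False using A xyz by (simp add: sum_free_def)
  qed
  then show ?thesis using aut_image(1)[OF \<phi> sub] by (auto simp: sum_free_def)
qed

lemma aut_scale:
  assumes "coprime k (int p)" shows "aut n (vscale p k)"
proof (rule autI)
  fix x y assume "x \<in> vectors p n" "y \<in> vectors p n"
  then show "vscale p k (vadd p x y) = vadd p (vscale p k x) (vscale p k y)"
    by (auto intro!: nth_equalityI simp: nth_vadd nth_vscale vectors_iff mod_simps distrib_left)
next
  fix x assume x: "x \<in> vectors p n" "vscale p k x = replicate n 0"
  show "x = replicate n 0"
  proof (rule nth_equalityI)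
    fix i assume "i < length x"
    then have i: "i < n" "x ! i \<in> residues_below p" using x(1) by (auto simp: vectors_iff)
    have "vscale p k x ! i = 0" using x(2) i by simp
    then have "(k * x ! i) mod int p = (k * 0) mod int p" using i x(1) by (simp add: nth_vscale vectors_iff)
    then have "x ! i = 0" using inj_onD[OF inj_on_dilate[OF assms], of "x ! i" 0] i p_pos by simp
    then show "x ! i = replicate n 0 ! i" using i by simp
  qed (use x in \<open>simp add: vectors_iff\<close>)
qed (rule vscale_closed)

definition fib :: "int list set \<Rightarrow> int \<Rightarrow> int list set" where
  "fib A i = {v. i # v \<in> A}"

lemma fib_subset: "A \<subseteq> vectors p (Suc n) \<Longrightarrow> fib A i \<subseteq> vectors p n"
  by (auto simp: fib_def)

lemma fib_sum:
  assumes "sum_free (Suc n) A" "x \<in> fib A i" "y \<in> fib A j" "z \<in> fib A k"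
  shows "vadd p (vadd p x y) z \<notin> fib A ((i + j + k) mod int p)"
proof -
  have "i # x \<in> A" "j # y \<in> A" "k # z \<in> A" using assms by (auto simp: fib_def)
  then have "vadd p (vadd p (i # x) (j # y)) (k # z) \<notin> A"
    using assms(1) unfolding sum_free_def by blast
  then show ?thesis by (simp add: fib_def mod_add_left_eq)
qed

lemma card_fib_sum:
  assumes "A \<subseteq> vectors p (Suc n)"
  shows "card A = (\<Sum>i\<in>residues_below p. card (fib A i))"
proof -
  have "A = (\<lambda>(i, v). i # v) ` (SIGMA i:residues_below p. fib A i)"
  proof (intro equalityI subsetI)
    fix x assume x: "x \<in> A"
    then obtain i v where "x = i # v" "i \<in> residues_below p" using assms by (force simp: vectors_Suc)
    then show "x \<in> (\<lambda>(i, v). i # v) ` (SIGMA i:residues_below p. fib A i)" using x by (force simp: fib_def)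
  qed (auto simp: fib_def)
  then have "card A = card ((\<lambda>(i, v). i # v) ` (SIGMA i:residues_below p. fib A i))" by simp
  also have "\<dots> = card (SIGMA i:residues_below p. fib A i)"
    by (rule card_image) (auto simp: inj_on_def)
  also have "\<dots> = (\<Sum>i\<in>residues_below p. card (fib A i))"
    using finite_subset[OF fib_subset[OF assms]] by (intro card_SigmaI) auto
  finally show ?thesis .
qed

text \<open>Pigeonhole with two points fixed: the translate \<open>x + y + C\<close> misses
  \<open>D\<close>, and \<open>z + A\<close> misses \<open>d - B\<close>. The first conclusion
  admits an empty \<open>D\<close>, as needed for fibres not known to be inhabited.\<close>

lemma disjoint_triple_sum_pairs:
  assumes V: "A \<subseteq> vectors p n" "B \<subseteq> vectors p n" "C \<subseteq> vectors p n" "D \<subseteq> vectors p n"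
    and ne: "A \<noteq> {}" "B \<noteq> {}" "C \<noteq> {}"
    and disj: "\<And>x y z. x \<in> A \<Longrightarrow> y \<in> B \<Longrightarrow> z \<in> C \<Longrightarrow> vadd p (vadd p x y) z \<notin> D"
  shows "card C + card D \<le> p ^ n" and "D \<noteq> {} \<Longrightarrow> card A + card B \<le> p ^ n"
proof -
  have fin: "finite A" "finite B" "finite C" "finite D"
    using V finite_vectors finite_subset by blast+
  have union: "card U + card W \<le> p ^ n" if "U \<subseteq> vectors p n" "W \<subseteq> vectors p n" "U \<inter> W = {}" for U W
  proof -
    have "card (U \<union> W) = card U + card W"
      using that finite_subset[OF _ finite_vectors] by (intro card_Un_disjoint) auto
    moreover have "card (U \<union> W) \<le> card (vectors p n)" by (rule card_mono) (use that in auto)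
    ultimately show ?thesis by (simp add: card_vectors)
  qed
  obtain x y where xy: "x \<in> A" "y \<in> B" using ne by blast
  let ?t = "vadd p x y"
  have t: "?t \<in> vectors p n" using xy V vadd_closed by blast
  have "card (vadd p ?t ` C) + card D \<le> p ^ n"
    by (rule union) (use t V vadd_closed disj xy in auto)
  then show "card C + card D \<le> p ^ n"
    by (simp add: card_image[OF inj_on_vadd[OF t V(3)]])
  assume "D \<noteq> {}"
  then obtain z d where zd: "z \<in> C" "d \<in> D" using ne by blast
  have zv: "z \<in> vectors p n" "d \<in> vectors p n" using zd V by auto
  have neg: "vscale p (-1) v \<in> vectors p n" if "v \<in> vectors p n" for v using that by (rule vscale_closed)
  let ?f = "\<lambda>y. vadd p d (vscale p (-1) y)"
  have injneg: "inj_on (vscale p (-1)) (vectors p n)"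
    using aut_scale[of "-1" n] by (simp add: aut_def bij_betw_def)
  have "inj_on ?f B"
  proof (rule inj_onI)
    fix u v assume uv: "u \<in> B" "v \<in> B" "?f u = ?f v"
    then have uvV: "u \<in> vectors p n" "v \<in> vectors p n" using V by auto
    have "vscale p (-1) u = vscale p (-1) v"
      by (rule vadd_left_cancel[OF neg[OF uvV(1)] neg[OF uvV(2)] zv(2) uv(3)])
    then show "u = v" by (rule inj_onD[OF injneg _ uvV])
  qed
  moreover have "card (vadd p z ` A) + card (?f ` B) \<le> p ^ n"
  proof (rule union)
    show "vadd p z ` A \<inter> ?f ` B = {}"
    proof (rule ccontr)
      assume "vadd p z ` A \<inter> ?f ` B \<noteq> {}"
      then obtain u v where uv: "u \<in> A" "v \<in> B" "vadd p z u = ?f v" by blast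
      have vv: "v \<in> vectors p n" "u \<in> vectors p n" using uv V by auto
      have "vadd p (vadd p u v) z = vadd p (vadd p z u) v"
        unfolding vadd_comm[of p "vadd p u v" z] by (rule vadd_assoc[symmetric])
      also have "\<dots> = vadd p d (vadd p (vscale p (-1) v) v)" unfolding uv(3) by (rule vadd_assoc)
      also have "\<dots> = d" unfolding vadd_neg[OF vv(1)] vadd_comm[of p d] by (rule vadd_zero[OF zv(2)])
      finally show False using disj[OF uv(1,2) zd(1)] zd by simp
    qed
  next
    show "vadd p z ` A \<subseteq> vectors p n" using V(1) by (auto intro!: vadd_closed zv)
    show "?f ` B \<subseteq> vectors p n" using V(2) by (auto intro!: vadd_closed zv neg)
  qed
  ultimately show "card A + card B \<le> p ^ n"
    by (simp add: card_image[OF inj_on_vadd[OF zv(1) V(1)]] card_image)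
qed

text \<open>Two applications of \<open>card_set_mult_ge\<close>, each losing at most the order of a
  maximal proper subgroup; a full sumset is excluded because \<open>D\<close> is nonempty and
  missed.\<close>

lemma disjoint_triple_sum_quad:
  assumes V: "A \<subseteq> vectors p n" "B \<subseteq> vectors p n" "C \<subseteq> vectors p n" "D \<subseteq> vectors p n"
    and ne: "A \<noteq> {}" "B \<noteq> {}" "C \<noteq> {}" "D \<noteq> {}"
    and disj: "\<And>x y z. x \<in> A \<Longrightarrow> y \<in> B \<Longrightarrow> z \<in> C \<Longrightarrow> vadd p (vadd p x y) z \<notin> D"
  shows "card A + card B + card C + card D \<le> p ^ n + 2 * (p ^ n div p)"
proof -
  interpret G: comm_group "vgroup p n" by (rule comm_group_vgroup)
  let ?AB = "A <#>\<^bsub>vgroup p n\<^esub> B"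
  let ?ABC = "?AB <#>\<^bsub>vgroup p n\<^esub> C"
  have AB: "?AB \<subseteq> vectors p n" "?AB \<noteq> {}"
    using V ne by (auto simp: set_mult_def add_Fvec intro!: vadd_closed)
  have ABC: "?ABC \<subseteq> vectors p n" using V by (auto simp: set_mult_def add_Fvec intro!: vadd_closed)
  have "?ABC \<inter> D = {}" using disj by (auto simp: set_mult_def add_Fvec)
  then have le: "card ?ABC + card D \<le> p ^ n" and "?ABC \<noteq> vectors p n"
    using card_mono[OF finite_vectors, of "?ABC \<union> D" p n] ABC V ne(4)
      card_Un_disjoint[of ?ABC D] finite_subset[OF _ finite_vectors]
    by (auto simp: card_vectors)
  then have 1: "card ?AB + card C \<le> card ?ABC + p ^ n div p"
    using G.card_set_mult_ge[OF prime order_vgroup, of ?AB C] AB V ne by auto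
  have "?AB \<noteq> vectors p n"
  proof
    assume "?AB = vectors p n"
    moreover obtain c where "c \<in> C" using ne by blast
    ultimately have "vadd p c ` vectors p n \<subseteq> ?ABC"
      by (auto simp: set_mult_def add_Fvec vadd_comm[of p c])
    moreover have "card (vadd p c ` vectors p n) = card (vectors p n)"
      using \<open>c \<in> C\<close> V by (intro card_image inj_on_vadd) auto
    ultimately have "?ABC = vectors p n"
      using ABC by (metis card_mono card_subset_eq finite_subset finite_vectors order_antisym)
    then show False using \<open>?ABC \<noteq> vectors p n\<close> by simp
  qed
  then have "card A + card B \<le> card ?AB + p ^ n div p"
    using G.card_set_mult_ge[OF prime order_vgroup, of A B] V ne by auto
  then show ?thesis using 1 le by linarith
qed

end

section \<open>A large Fourier coefficient\<close>

text \<open>Left unreduced; \<open>add_char\<close> and all later uses depend only on the class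
  modulo \<open>p\<close>.\<close>

definition dot :: "int list \<Rightarrow> int list \<Rightarrow> int" where
  "dot c x = sum_list (map2 (*) c x)"

lemma dot_Nil [simp]: "dot [] x = 0" and dot_Cons [simp]: "dot (a # c) (b # x) = a * b + dot c x"
  by (simp_all add: dot_def)

lemma dot_vadd:
  "length x = length c \<Longrightarrow> length y = length c \<Longrightarrow> [dot c (vadd p x y) = dot c x + dot c y] (mod int p)"
proof (induction c arbitrary: x y)
  case (Cons a c)
  then obtain b x' b' y' where xy: "x = b # x'" "y = b' # y'" by (metis length_Suc_conv)
  have "[a * ((b + b') mod int p) = a * b + a * b'] (mod int p)"
    by (simp add: Cong.cong_def mod_mult_right_eq distrib_left)
  moreover have "[dot c (vadd p x' y') = dot c x' + dot c y'] (mod int p)"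
    using Cons xy by simp
  ultimately have "[a * ((b + b') mod int p) + dot c (vadd p x' y') = (a * b + a * b') + (dot c x' + dot c y')] (mod int p)"
    by (rule cong_add)
  then show ?case by (simp add: xy algebra_simps)
qed simp

context fvec
begin

abbreviation "ch \<equiv> add_char p"

lemma char_cong: "[x = y] (mod int p) \<Longrightarrow> ch x = ch y"
  using add_char_mod[OF p_pos] by (metis Cong.cong_def)

lemma char_dot_vadd:
  assumes "c \<in> vectors p n" "x \<in> vectors p n" "y \<in> vectors p n"
  shows "ch (dot c (vadd p x y)) = ch (dot c x) * ch (dot c y)"
  using char_cong[OF dot_vadd[of x c y p]] assms by (simp add: vectors_iff add_char_add)

lemma char_orthogonality:
  "u \<in> vectors p n \<Longrightarrow> w \<in> vectors p n \<Longrightarrow>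
    (\<Sum>c\<in>vectors p n. ch (dot c u) * cnj (ch (dot c w))) = (if u = w then of_nat (p ^ n) else 0)"
proof (induction n arbitrary: u w)
  case 0
  then show ?case by (simp add: vectors_0)
next
  case (Suc n)
  obtain a u' where u: "u = a # u'" "a \<in> residues_below p" "u' \<in> vectors p n"
    using Suc.prems(1) by (force simp: vectors_Suc)
  obtain b w' where w: "w = b # w'" "b \<in> residues_below p" "w' \<in> vectors p n"
    using Suc.prems(2) by (force simp: vectors_Suc)
  have "(\<Sum>c\<in>vectors p (Suc n). ch (dot c u) * cnj (ch (dot c w)))
      = (\<Sum>(s, c)\<in>residues_below p \<times> vectors p n. ch (dot (s # c) u) * cnj (ch (dot (s # c) w)))"
    unfolding vectors_Suc by (subst sum.reindex) (auto simp: inj_on_def case_prod_unfold)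
  also have "\<dots> = (\<Sum>(s, c)\<in>residues_below p \<times> vectors p n. ch (s * (a - b)) * (ch (dot c u') * cnj (ch (dot c w'))))"
  proof (rule sum.cong[OF refl], clarify)
    fix s c
    have "ch (s * a) * cnj (ch (s * b)) = ch (s * (a - b))"
      by (simp add: cnj_add_char add_char_add[symmetric] algebra_simps)
    moreover have "ch (dot (s # c) u) * cnj (ch (dot (s # c) w))
        = (ch (s * a) * cnj (ch (s * b))) * (ch (dot c u') * cnj (ch (dot c w')))"
      by (simp add: u w add_char_add)
    ultimately show "ch (dot (s # c) u) * cnj (ch (dot (s # c) w)) = ch (s * (a - b)) * (ch (dot c u') * cnj (ch (dot c w')))"
      by simp
  qed
  also have "\<dots> = (\<Sum>s\<in>residues_below p. ch (s * (a - b))) * (\<Sum>c\<in>vectors p n. ch (dot c u') * cnj (ch (dot c w')))"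
    by (simp add: sum.cartesian_product[symmetric] sum_product)
  also have "(\<Sum>s\<in>residues_below p. ch (s * (a - b))) = (if a = b then of_nat p else 0)"
  proof -
    have "int p dvd a - b \<longleftrightarrow> a = b"
      using u(2) w(2) by (auto simp: mod_eq_dvd_iff[symmetric])
    then show ?thesis using sum_add_char[OF p_pos] by simp
  qed
  finally show ?case using Suc.IH[OF u(3) w(3)] by (simp add: u w)
qed

definition fc :: "int list set \<Rightarrow> int list \<Rightarrow> complex" where
  "fc A c = (\<Sum>x\<in>A. ch (dot c x))"

lemma parseval:
  assumes A: "A \<subseteq> vectors p n"
  shows "(\<Sum>c\<in>vectors p n. (cmod (fc A c))\<^sup>2) = real (p ^ n) * real (card A)"
proof -
  have fin: "finite A" using A finite_subset finite_vectors by blast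
  have "complex_of_real (\<Sum>c\<in>vectors p n. (cmod (fc A c))\<^sup>2) = (\<Sum>c\<in>vectors p n. fc A c * cnj (fc A c))"
    unfolding of_real_sum complex_norm_square ..
  also have "\<dots> = (\<Sum>c\<in>vectors p n. \<Sum>x\<in>A. \<Sum>y\<in>A. ch (dot c x) * cnj (ch (dot c y)))"
    unfolding fc_def cnj_sum sum_product ..
  also have "\<dots> = (\<Sum>x\<in>A. \<Sum>y\<in>A. \<Sum>c\<in>vectors p n. ch (dot c x) * cnj (ch (dot c y)))"
    by (subst sum.swap, rule sum.cong[OF refl], rule sum.swap)
  also have "\<dots> = (\<Sum>x\<in>A. \<Sum>y\<in>A. if x = y then of_nat (p ^ n) else 0)"
    by (intro sum.cong refl char_orthogonality) (use A in auto)
  also have "\<dots> = complex_of_real (real (p ^ n) * real (card A))" using fin by simp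
  finally show ?thesis by (simp only: of_real_eq_iff)
qed

text \<open>By orthogonality the sum is \<open>p ^ n\<close> times the number of solutions of
  \<open>x + y + z = w\<close> in \<open>A\<close>.\<close>

lemma fourth_moment_vanishes:
  assumes A: "sum_free n A"
  shows "(\<Sum>c\<in>vectors p n. fc A c ^ 3 * cnj (fc A c)) = 0"
proof -
  have sub: "A \<subseteq> vectors p n" using A by (simp add: sum_free_def)
  have cube: "fc A c ^ 3 = (\<Sum>x\<in>A. \<Sum>y\<in>A. \<Sum>z\<in>A. ch (dot c (vadd p (vadd p x y) z)))" if c: "c \<in> vectors p n" for c
  proof -
    have "fc A c ^ 3 = (\<Sum>x\<in>A. \<Sum>y\<in>A. \<Sum>z\<in>A. ch (dot c x) * ch (dot c y) * ch (dot c z))"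
    proof -
      have "fc A c ^ 3 = (\<Sum>x\<in>A. ch (dot c x) * (\<Sum>y\<in>A. ch (dot c y) * (\<Sum>z\<in>A. ch (dot c z))))"
        unfolding fc_def by (simp add: power3_eq_cube sum_distrib_right[symmetric] mult.assoc)
      then show ?thesis by (simp add: sum_distrib_left mult.assoc)
    qed
    also have "\<dots> = (\<Sum>x\<in>A. \<Sum>y\<in>A. \<Sum>z\<in>A. ch (dot c (vadd p (vadd p x y) z)))"
      by (intro sum.cong refl) (use sub c in \<open>auto simp: char_dot_vadd[OF c] vadd_closed subset_eq\<close>)
    finally show ?thesis .
  qed
  have "(\<Sum>c\<in>vectors p n. fc A c ^ 3 * cnj (fc A c))
      = (\<Sum>c\<in>vectors p n. \<Sum>x\<in>A. \<Sum>y\<in>A. \<Sum>z\<in>A. \<Sum>w\<in>A. ch (dot c (vadd p (vadd p x y) z)) * cnj (ch (dot c w)))"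
  proof (rule sum.cong[OF refl])
    fix c assume c: "c \<in> vectors p n"
    have "fc A c ^ 3 * cnj (fc A c) = (\<Sum>x\<in>A. \<Sum>y\<in>A. \<Sum>z\<in>A. ch (dot c (vadd p (vadd p x y) z))) * (\<Sum>w\<in>A. cnj (ch (dot c w)))"
      unfolding cube[OF c] by (simp add: fc_def)
    then show "fc A c ^ 3 * cnj (fc A c)
        = (\<Sum>x\<in>A. \<Sum>y\<in>A. \<Sum>z\<in>A. \<Sum>w\<in>A. ch (dot c (vadd p (vadd p x y) z)) * cnj (ch (dot c w)))"
      by (simp only: sum_distrib_right) (simp only: sum_distrib_left)
  qed
  also have "\<dots> = (\<Sum>x\<in>A. \<Sum>c\<in>vectors p n. \<Sum>y\<in>A. \<Sum>z\<in>A. \<Sum>w\<in>A. ch (dot c (vadd p (vadd p x y) z)) * cnj (ch (dot c w)))"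
    by (rule sum.swap)
  also have "\<dots> = (\<Sum>x\<in>A. \<Sum>y\<in>A. \<Sum>c\<in>vectors p n. \<Sum>z\<in>A. \<Sum>w\<in>A. ch (dot c (vadd p (vadd p x y) z)) * cnj (ch (dot c w)))"
    by (intro sum.cong refl sum.swap)
  also have "\<dots> = (\<Sum>x\<in>A. \<Sum>y\<in>A. \<Sum>z\<in>A. \<Sum>c\<in>vectors p n. \<Sum>w\<in>A. ch (dot c (vadd p (vadd p x y) z)) * cnj (ch (dot c w)))"
    by (intro sum.cong refl sum.swap)
  also have "\<dots> = (\<Sum>x\<in>A. \<Sum>y\<in>A. \<Sum>z\<in>A. \<Sum>w\<in>A. \<Sum>c\<in>vectors p n. ch (dot c (vadd p (vadd p x y) z)) * cnj (ch (dot c w)))"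
    by (intro sum.cong refl sum.swap)
  also have "\<dots> = (\<Sum>x\<in>A. \<Sum>y\<in>A. \<Sum>z\<in>A. \<Sum>w\<in>A. 0)"
  proof (intro sum.cong refl)
    fix x y z w assume *: "x \<in> A" "y \<in> A" "z \<in> A" "w \<in> A"
    then have "vadd p (vadd p x y) z \<noteq> w" using A by (auto simp: sum_free_def)
    moreover have "vadd p (vadd p x y) z \<in> vectors p n" using * sub by (intro vadd_closed) auto
    ultimately show "(\<Sum>c\<in>vectors p n. ch (dot c (vadd p (vadd p x y) z)) * cnj (ch (dot c w))) = 0"
      using char_orthogonality[of "vadd p (vadd p x y) z" n w] * sub by auto
  qed
  finally show ?thesis by simp
qed

lemma dot_zero: "dot (replicate n 0) x = 0"
  by (induction n arbitrary: x) (auto simp: dot_def zip_Cons1 split: list.splits)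

text \<open>The zero frequency contributes the fourth power of \<open>card A\<close> to the
  vanishing moment, so the other fourth powers must sum to at least as much, while Parseval fixes
  the sum of their squares. If all coefficients were smaller than claimed, nonnegative terms with
  sum at most 0 would make every nontrivial coefficient vanish. The product form covers
  \<open>q = 0\<close> without a division.\<close>

lemma large_fourier_coefficient:
  assumes A: "sum_free n A" "A \<noteq> {}"
  shows "\<exists>c\<in>vectors p n - {replicate n 0}.
    real (card A) ^ 3 \<le> (cmod (fc A c))\<^sup>2 * (real (p ^ n) - real (card A))"
proof (rule ccontr)
  assume "\<not> ?thesis"
  then have small: "(cmod (fc A c))\<^sup>2 * (real (p ^ n) - real (card A)) < real (card A) ^ 3"
    if "c \<in> vectors p n - {replicate n 0}" for c using that not_le by blast
  have sub: "A \<subseteq> vectors p n" using A by (simp add: sum_free_def)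
  have fin: "finite A" using sub finite_subset finite_vectors by blast
  let ?V = "vectors p n - {replicate n 0}"
  define q where "q = real (p ^ n) - real (card A)"
  define \<alpha> where "\<alpha> = real (card A)"
  have \<alpha>: "\<alpha> > 0" using A(2) fin by (simp add: \<alpha>_def card_gt_0_iff)
  have q: "q \<ge> 0" using card_mono[OF finite_vectors sub] by (simp add: q_def card_vectors)
  have fc0: "fc A (replicate n 0) = of_real \<alpha>" by (simp add: fc_def dot_zero \<alpha>_def)
  have split: "(\<Sum>c\<in>vectors p n. f c) = f (replicate n 0) + (\<Sum>c\<in>?V. f c)" for f :: "int list \<Rightarrow> 'x::comm_monoid_add"
    by (rule sum.remove) (use zero_closed in auto)
  have P: "(\<Sum>c\<in>?V. (cmod (fc A c))\<^sup>2) = q * \<alpha>"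
    using parseval[OF sub] split[of "\<lambda>c. (cmod (fc A c))\<^sup>2"] fc0 \<alpha>
    by (simp add: q_def \<alpha>_def power2_eq_square algebra_simps)
  have F: "(\<Sum>c\<in>?V. fc A c ^ 3 * cnj (fc A c)) = - of_real (\<alpha> ^ 4)"
    using fourth_moment_vanishes[OF A(1)] split[of "\<lambda>c. fc A c ^ 3 * cnj (fc A c)"] fc0
    by (simp add: eq_neg_iff_add_eq_0 add.commute power_numeral_reduce mult.assoc)
  have "\<alpha> ^ 4 = cmod (\<Sum>c\<in>?V. fc A c ^ 3 * cnj (fc A c))" unfolding F using \<alpha> by (simp add: norm_power)
  also have "\<dots> \<le> (\<Sum>c\<in>?V. cmod (fc A c ^ 3 * cnj (fc A c)))" by (rule norm_sum)
  also have "\<dots> = (\<Sum>c\<in>?V. (cmod (fc A c)) ^ 4)"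
    by (simp add: norm_mult norm_power power_numeral_reduce mult.assoc)
  finally have Q: "\<alpha> ^ 4 \<le> (\<Sum>c\<in>?V. (cmod (fc A c)) ^ 4)" .
  have "(\<Sum>c\<in>?V. (cmod (fc A c))\<^sup>2 * (\<alpha> ^ 3 - q * (cmod (fc A c))\<^sup>2))
      = \<alpha> ^ 3 * (\<Sum>c\<in>?V. (cmod (fc A c))\<^sup>2) - q * (\<Sum>c\<in>?V. (cmod (fc A c)) ^ 4)"
    by (simp add: sum_distrib_left sum_subtractf[symmetric] algebra_simps power_numeral_reduce)
  also have "\<dots> \<le> \<alpha> ^ 3 * (q * \<alpha>) - q * \<alpha> ^ 4"
    unfolding P using Q q by (simp add: mult_left_mono)
  also have "\<dots> = 0" by (simp add: power_numeral_reduce)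
  finally have le0: "(\<Sum>c\<in>?V. (cmod (fc A c))\<^sup>2 * (\<alpha> ^ 3 - q * (cmod (fc A c))\<^sup>2)) \<le> 0" .
  have nn: "0 \<le> (cmod (fc A c))\<^sup>2 * (\<alpha> ^ 3 - q * (cmod (fc A c))\<^sup>2)" if "c \<in> ?V" for c
    using small[OF that] by (simp add: q_def \<alpha>_def mult.commute)
  have "(cmod (fc A c))\<^sup>2 * (\<alpha> ^ 3 - q * (cmod (fc A c))\<^sup>2) = 0" if "c \<in> ?V" for c
    using le0 nn that sum_nonneg_eq_0_iff[of ?V "\<lambda>c. (cmod (fc A c))\<^sup>2 * (\<alpha> ^ 3 - q * (cmod (fc A c))\<^sup>2)"]
      sum_nonneg[of ?V "\<lambda>c. (cmod (fc A c))\<^sup>2 * (\<alpha> ^ 3 - q * (cmod (fc A c))\<^sup>2)"] by force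
  then have "fc A c = 0" if "c \<in> ?V" for c
    using small[OF that] that by (force simp: q_def \<alpha>_def mult.commute)
  then have "(\<Sum>c\<in>?V. (cmod (fc A c)) ^ 4) = 0" by simp
  then show False using Q \<alpha> by simp
qed

text \<open>Exchange step: some entry \<open>j\<close> of \<open>c\<close> is nonzero, so the
  functional together with all coordinates except the one at \<open>j\<close> is again a coordinate
  system.\<close>

lemma aut_with_first_coordinate:
  assumes c: "c \<in> vectors p (Suc n)" "c \<noteq> replicate (Suc n) 0"
  shows "\<exists>\<phi>. aut (Suc n) \<phi> \<and> (\<forall>x\<in>vectors p (Suc n). hd (\<phi> x) = dot c x mod int p)"
proof -
  obtain j where j: "j < Suc n" "c ! j \<noteq> 0"
    using c by (metis nth_equalityI length_replicate nth_replicate vectors_length)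
  define \<phi> where "\<phi> x = (dot c x mod int p) # (take j x @ drop (Suc j) x)" for x
  have len: "length (take j x @ drop (Suc j) x) = n" if "x \<in> vectors p (Suc n)" for x
    using that j by (auto simp: vectors_iff)
  have nth: "(take j x @ drop (Suc j) x) ! i = x ! (if i < j then i else Suc i)"
    if "x \<in> vectors p (Suc n)" "i < n" for x i
    using that j by (auto simp: vectors_iff nth_append min_def)
  have "aut (Suc n) \<phi>"
  proof (rule autI)
    fix x assume x: "x \<in> vectors p (Suc n)"
    then have "take j x @ drop (Suc j) x \<in> vectors p n"
      using len[OF x] nth[OF x] by (auto simp: vectors_iff)
    then show "\<phi> x \<in> vectors p (Suc n)" using p_pos by (simp add: \<phi>_def)
  next
    fix x y assume xy: "x \<in> vectors p (Suc n)" "y \<in> vectors p (Suc n)"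
    have "dot c (vadd p x y) mod int p = (dot c x mod int p + dot c y mod int p) mod int p"
      using dot_vadd[of x c y p] xy c by (simp add: vectors_length Cong.cong_def mod_simps)
    moreover have "take j (vadd p x y) @ drop (Suc j) (vadd p x y)
        = vadd p (take j x @ drop (Suc j) x) (take j y @ drop (Suc j) y)"
      using xy by (auto simp: vadd_def take_map drop_map take_zip drop_zip vectors_length)
    ultimately show "\<phi> (vadd p x y) = vadd p (\<phi> x) (\<phi> y)" by (simp add: \<phi>_def)
  next
    fix x assume x: "x \<in> vectors p (Suc n)" "\<phi> x = replicate (Suc n) 0"
    have xi: "x ! i = 0" if "i < Suc n" "i \<noteq> j" for i
    proof -
      define k where "k = (if i < j then i else i - 1)"
      have k: "k < n" "(if k < j then k else Suc k) = i" using that j by (auto simp: k_def)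
      have "\<phi> x ! Suc k = 0" using x(2) k by simp
      then show ?thesis using nth[OF x(1) k(1)] k(2) by (simp add: \<phi>_def)
    qed
    have "dot c x = (\<Sum>i<Suc n. c ! i * x ! i)"
      using c x by (simp add: dot_def sum_list_sum_nth vectors_length lessThan_atLeast0)
    also have "\<dots> = c ! j * x ! j + (\<Sum>i\<in>{..<Suc n} - {j}. c ! i * x ! i)"
      by (rule sum.remove) (use j in auto)
    also have "(\<Sum>i\<in>{..<Suc n} - {j}. c ! i * x ! i) = 0"
      by (rule sum.neutral) (use xi in auto)
    finally have "dot c x = c ! j * x ! j" by simp
    moreover have "dot c x mod int p = 0" using arg_cong[OF x(2), of hd] by (simp add: \<phi>_def)
    ultimately have "int p dvd c ! j * x ! j" by (simp add: mod_eq_0_iff_dvd)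
    then have "int p dvd c ! j \<or> int p dvd x ! j"
      using prime by (simp add: prime_dvd_mult_iff)
    moreover have "\<not> int p dvd c ! j" using c j zdvd_not_zless[of "c ! j" "int p"] by (force simp: vectors_iff)
    moreover have "x ! j \<in> residues_below p" using x j by (simp add: vectors_iff)
    ultimately have "x ! j = 0" using zdvd_not_zless[of "x ! j" "int p"] by force
    then show "x = replicate (Suc n) 0"
      using xi x by (intro nth_equalityI) (auto simp: vectors_iff simp del: replicate.simps)
  qed
  moreover have "hd (\<phi> x) = dot c x mod int p" for x by (simp add: \<phi>_def)
  ultimately show ?thesis by blast
qed

text \<open>The character is constant on each set where \<open>dot c\<close> has a given residue,
  and the automorphism turns these sets into fibres.\<close>

lemma fc_fibres:
  assumes A: "A \<subseteq> vectors p (Suc n)" and \<phi>: "aut (Suc n) \<phi>"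
    and hd: "\<And>x. x \<in> vectors p (Suc n) \<Longrightarrow> hd (\<phi> x) = dot c x mod int p"
  shows "fc A c = (\<Sum>i\<in>residues_below p. of_real (real (card (fib (\<phi> ` A) i))) * ch i)"
proof -
  have fin: "finite A" using A finite_subset finite_vectors by blast
  have inj: "inj_on \<phi> A" using \<phi> A by (auto simp: aut_def bij_betw_def inj_on_subset)
  have "card (fib (\<phi> ` A) i) = card {x\<in>A. dot c x mod int p = i}" for i
  proof -
    have "(#) i ` fib (\<phi> ` A) i = \<phi> ` {x\<in>A. dot c x mod int p = i}"
    proof (intro equalityI subsetI)
      fix y assume "y \<in> (#) i ` fib (\<phi> ` A) i"
      then obtain v where "y = i # v" "v \<in> fib (\<phi> ` A) i" by blast
      then have y: "y \<in> \<phi> ` A" "hd y = i" by (simp_all add: fib_def)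
      then obtain x where x: "x \<in> A" "\<phi> x = y" by blast
      have "dot c x mod int p = i" using hd[of x] A x y by auto
      then show "y \<in> \<phi> ` {x\<in>A. dot c x mod int p = i}" using x by blast
    next
      fix y assume "y \<in> \<phi> ` {x\<in>A. dot c x mod int p = i}"
      then obtain x where x: "x \<in> A" "\<phi> x = y" "dot c x mod int p = i" by auto
      have "y \<in> vectors p (Suc n)" using x A \<phi> by (auto simp: aut_def bij_betw_def)
      then obtain b v where "y = b # v" by (auto simp: vectors_Suc)
      moreover have "hd y = i" using hd[of x] x A by auto
      ultimately have y: "y = i # v" by simp
      have "y \<in> \<phi> ` A" using x by blast
      then have "v \<in> fib (\<phi> ` A) i" by (simp add: fib_def y)
      then show "y \<in> (#) i ` fib (\<phi> ` A) i" unfolding y by (rule imageI)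
    qed
    then have "card ((#) i ` fib (\<phi> ` A) i) = card (\<phi> ` {x\<in>A. dot c x mod int p = i})" by simp
    then show ?thesis
      using card_image[OF inj_on_subset[OF inj], of "{x\<in>A. dot c x mod int p = i}"]
      by (simp add: card_image)
  qed
  then have "(\<Sum>i\<in>residues_below p. of_real (real (card (fib (\<phi> ` A) i))) * ch i)
      = (\<Sum>i\<in>residues_below p. \<Sum>x | x \<in> A \<and> dot c x mod int p = i. ch i)" by simp
  also have "\<dots> = (\<Sum>i\<in>residues_below p. \<Sum>x | x \<in> A \<and> dot c x mod int p = i. ch (dot c x))"
    by (intro sum.cong refl) (auto simp: add_char_mod[OF p_pos])
  also have "\<dots> = (\<Sum>x\<in>A. ch (dot c x))"
    by (rule sum.group) (use fin p_pos in auto)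
  finally show ?thesis by (simp add: fc_def)
qed

lemma fibre_weights_of_sum_free:
  assumes pm: "p = 4 * m + 3" "m \<ge> 25" and A: "sum_free (Suc n) A" and big: "m * p ^ n \<le> card A"
    and R: "565 * real (card A) \<le> 1000 * cmod (\<Sum>i\<in>residues_below p. of_real (real (card (fib A i))) * ch i)"
  shows "fibre_weights p m (p ^ n) (p ^ n div p) (\<lambda>i. card (fib A i))"
proof
  have sub: "A \<subseteq> vectors p (Suc n)" using A by (simp add: sum_free_def)
  have fsub: "fib A i \<subseteq> vectors p n" for i using fib_subset[OF sub] .
  have ne: "fib A i \<noteq> {}" if "0 < card (fib A i)" for i using that by auto
  show "Factorial_Ring.prime p" by (fact prime)
  show "p = 4 * m + 3" by (fact pm(1))
  show "m \<ge> 25" by (fact pm(2))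
  show "odd (p ^ n)" using pm by simp
  show "p ^ n div p * p \<le> p ^ n" by simp
  show "card (fib A i) \<le> p ^ n" for i
    using card_mono[OF finite_vectors fsub] by (simp add: card_vectors)
  show "m * p ^ n \<le> (\<Sum>i\<in>residues_below p. card (fib A i))"
    using big card_fib_sum[OF sub] by simp
  show "565 * real (\<Sum>i\<in>residues_below p. card (fib A i))
      \<le> 1000 * cmod (\<Sum>i\<in>residues_below p. of_real (real (card (fib A i))) * add_char p i)"
    using R card_fib_sum[OF sub] by simp
  fix i j k
  assume pos: "0 < card (fib A i)" "0 < card (fib A j)" "0 < card (fib A k)" "0 < card (fib A ((i + j + k) mod int p))"
  show "card (fib A i) + card (fib A j) \<le> p ^ n"
    by (rule disjoint_triple_sum_pairs(2)[of "fib A i" n "fib A j" "fib A k" "fib A ((i + j + k) mod int p)"])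
      (use fsub ne pos fib_sum[OF A] in blast)+
  show "card (fib A i) + card (fib A j) + card (fib A k) + card (fib A ((i + j + k) mod int p))
      \<le> p ^ n + 2 * (p ^ n div p)"
    by (rule disjoint_triple_sum_quad) (use fsub ne pos fib_sum[OF A] in blast)+
qed

theorem exists_short_coordinates:
  assumes pm: "p = 4 * m + 3" "m \<ge> 25" and A: "sum_free (Suc n) A" and big: "m * p ^ n \<le> card A"
  shows "\<exists>\<phi> d. aut (Suc n) \<phi> \<and> (\<forall>x\<in>\<phi> ` A. \<exists>j\<in>{0..int m + 7}. hd x = (d + j) mod int p)"
proof -
  have sub: "A \<subseteq> vectors p (Suc n)" using A by (simp add: sum_free_def)
  have N0: "p ^ n > 0" using p_pos by simp
  have "card A > 0" using big pm N0 by (metis gr0I le_zero_eq mult_eq_0_iff not_less_zero not_numeral_le_zero)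
  then have "A \<noteq> {}" by auto
  then obtain c where c: "c \<in> vectors p (Suc n)" "c \<noteq> replicate (Suc n) 0"
    and large: "real (card A) ^ 3 \<le> (cmod (fc A c))\<^sup>2 * (real (p ^ Suc n) - real (card A))"
    using large_fourier_coefficient[OF A] by blast
  define a where "a = real (card A)"
  define R where "R = cmod (fc A c)"
  have a0: "a > 0" using \<open>card A > 0\<close> by (simp add: a_def)
  have "real (m * p ^ n) \<le> real (card A)" using big by (simp only: of_nat_le_iff)
  then have am: "real m * real (p ^ n) \<le> a" by (simp only: a_def of_nat_mult)
  have "(565 * a)\<^sup>2 \<le> (1000 * R)\<^sup>2"
  proof -
    \<comment> \<open>Since \<open>card A\<close> is at least \<open>m * p ^ n\<close>, the
      complement of \<open>A\<close> is at most (3m + 3)/m times as large as \<open>A\<close>. This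
      is the origin of the ratio m/(3m + 3) for the squared relative size of the
      coefficient.\<close>
    have "real m * (real (p ^ Suc n) - a) \<le> (3 * real m + 3) * a"
    proof -
      have "real (p ^ Suc n) = (4 * real m + 3) * real (p ^ n)" using pm by simp
      then have "real m * real (p ^ Suc n) = (4 * real m + 3) * (real m * real (p ^ n))" by simp
      also have "\<dots> \<le> (4 * real m + 3) * a" using am by (intro mult_left_mono) auto
      finally show ?thesis by (simp add: algebra_simps)
    qed
    then have "R\<^sup>2 * (real m * (real (p ^ Suc n) - a)) \<le> R\<^sup>2 * ((3 * real m + 3) * a)"
      by (intro mult_left_mono) auto
    moreover have "real m * a ^ 3 \<le> real m * (R\<^sup>2 * (real (p ^ Suc n) - a))"
      using large unfolding a_def R_def by (intro mult_left_mono) auto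
    ultimately have "real m * a ^ 3 \<le> R\<^sup>2 * ((3 * real m + 3) * a)" by (simp add: mult.left_commute)
    then have "(real m * a\<^sup>2) * a \<le> (R\<^sup>2 * (3 * real m + 3)) * a"
      by (simp add: power3_eq_cube power2_eq_square mult.assoc)
    then have 1: "real m * a\<^sup>2 \<le> R\<^sup>2 * (3 * real m + 3)" using a0 by (simp only: mult_le_cancel_right_pos)
    have "(565 * a)\<^sup>2 * (3 * real m + 3) = (319225 * (3 * real m + 3)) * a\<^sup>2" by (simp add: power2_eq_square)
    \<comment> \<open>319225 is the square of 565; the comparison of coefficients holds for
      \<open>m >= 23\<close>.\<close>
    also have "\<dots> \<le> (1000000 * real m) * a\<^sup>2" using pm(2) by (intro mult_right_mono) auto
    also have "\<dots> \<le> 1000000 * (R\<^sup>2 * (3 * real m + 3))" using 1 by simp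
    also have "\<dots> = (1000 * R)\<^sup>2 * (3 * real m + 3)" by (simp add: power2_eq_square)
    finally show ?thesis by (rule mult_right_le_imp_le) simp
  qed
  then have R: "565 * a \<le> 1000 * R" by (rule power2_le_imp_le) (simp add: R_def)
  obtain \<phi> where \<phi>: "aut (Suc n) \<phi>" and hd\<phi>: "\<And>x. x \<in> vectors p (Suc n) \<Longrightarrow> hd (\<phi> x) = dot c x mod int p"
    using aut_with_first_coordinate[OF c] by blast
  have c\<phi>: "card (\<phi> ` A) = card A" by (rule aut_image(2)[OF \<phi> sub])
  interpret W: fibre_weights p m "p ^ n" "p ^ n div p" "\<lambda>i. card (fib (\<phi> ` A) i)"
    by (rule fibre_weights_of_sum_free[OF pm aut_sum_free[OF \<phi> A]])
      (use big R fc_fibres[OF sub \<phi> hd\<phi>] in \<open>simp_all add: c\<phi> a_def R_def\<close>)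
  obtain k d where kd: "coprime k (int p)" "dilate p k W.Y \<subseteq> (\<lambda>j. (d + j) mod int p) ` {0..int m + 7}"
    using W.support_in_short_interval by blast
  have "\<exists>j\<in>{0..int m + 7}. hd (vscale p k y) = (d + j) mod int p" if "y \<in> \<phi> ` A" for y
  proof -
    have sub': "\<phi> ` A \<subseteq> vectors p (Suc n)" by (rule aut_image(1)[OF \<phi> sub])
    then obtain i v where y: "y = i # v" "i \<in> residues_below p" using \<open>y \<in> \<phi> ` A\<close> by (force simp: vectors_Suc)
    then have "v \<in> fib (\<phi> ` A) i" using that by (simp add: fib_def)
    then have "card (fib (\<phi> ` A) i) > 0"
      using finite_subset[OF fib_subset[OF sub'] finite_vectors] by (auto simp: card_gt_0_iff)
    then have "i \<in> W.Y" using y by (simp add: W.Y_def W.X_def)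
    then have "(k * i) mod int p \<in> (\<lambda>j. (d + j) mod int p) ` {0..int m + 7}"
      using kd(2) by (auto simp: dilate_def)
    then show ?thesis using y by auto
  qed
  then show ?thesis
    by (intro exI[of _ "vscale p k \<circ> \<phi>"] exI[of _ d]) (auto simp: aut_comp[OF \<phi> aut_scale[OF kd(1)]])
qed

end

context fvec
begin

section \<open>Additively closed sets and their normal form\<close>

text \<open>Closure under negation and scalars is automatic, since every multiple is a repeated sum;
  see \<open>additive_vscale\<close>.\<close>

definition additive :: "nat \<Rightarrow> int list set \<Rightarrow> bool" where
  "additive n H \<longleftrightarrow> H \<subseteq> vectors p n \<and> replicate n 0 \<in> H \<and> (\<forall>x\<in>H. \<forall>y\<in>H. vadd p x y \<in> H)"

lemma vscale_cong: "[k = l] (mod int p) \<Longrightarrow> vscale p k x = vscale p l x"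
  unfolding vscale_def by (intro map_cong refl) (metis Cong.cong_def mod_mult_left_eq)

lemma vscale_add: "vscale p (k + l) x = vadd p (vscale p k x) (vscale p l x)"
  by (auto intro!: nth_equalityI simp: nth_vscale nth_vadd mod_simps distrib_right)

lemma vscale_0: "length x = n \<Longrightarrow> vscale p 0 x = replicate n 0"
  by (auto intro!: nth_equalityI simp: nth_vscale)

lemma vscale_1: "x \<in> vectors p n \<Longrightarrow> vscale p 1 x = x"
  by (auto intro!: nth_equalityI simp: nth_vscale vectors_iff)

lemma vscale_vscale: "vscale p k (vscale p l x) = vscale p (k * l) x"
  by (auto intro!: nth_equalityI simp: nth_vscale mod_simps mult.assoc)

lemma additive_vscale:
  assumes "additive n H" "x \<in> H" shows "vscale p k x \<in> H"
proof -
  have x: "x \<in> vectors p n" using assms by (auto simp: additive_def)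
  have nat: "vscale p (int j) x \<in> H" for j
  proof (induction j)
    case 0
    then show ?case using assms(1) x by (simp add: vscale_0 vectors_length additive_def)
  next
    case (Suc j)
    have "vscale p (int (Suc j)) x = vadd p x (vscale p (int j) x)"
      using vscale_add[of 1 "int j" x] vscale_1[OF x] by simp
    then show ?case using Suc assms by (simp add: additive_def)
  qed
  have "vscale p k x = vscale p (int (nat (k mod int p))) x"
    using p_pos by (intro vscale_cong) (simp add: Cong.cong_def)
  then show ?thesis using nat by (simp only:)
qed

lemma additive_submodule:
  assumes "additive n H" shows "submodule H (F p) (Fvec p n)"
proof (intro submodule.intro subgroup.intro submodule_axioms.intro)
  show "H \<subseteq> carrier (vgroup p n)" using assms by (simp add: additive_def)
  fix x y assume xy: "x \<in> H" "y \<in> H"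
  then show "x \<otimes>\<^bsub>vgroup p n\<^esub> y \<in> H" using assms by (simp add: additive_def add_Fvec)
  show "inv\<^bsub>vgroup p n\<^esub> x \<in> H"
    using additive_vscale[OF assms xy(1), of "-1"] inv_vgroup[of x n] xy assms by (auto simp: additive_def)
next
  fix a x assume "a \<in> carrier (F p)" "x \<in> H"
  then show "a \<odot>\<^bsub>Fvec p n\<^esub> x \<in> H" using additive_vscale[OF assms] by (simp add: smult_Fvec)
qed (use assms in \<open>simp_all add: additive_def zero_Fvec\<close>)

lemma additive_image:
  assumes \<phi>: "aut n \<phi>" and H: "additive n H" shows "additive n (\<phi> ` H)"
proof -
  have sub: "H \<subseteq> vectors p n" using H by (simp add: additive_def)
  have hom: "\<phi> (vadd p x y) = vadd p (\<phi> x) (\<phi> y)" if "x \<in> H" "y \<in> H" for x y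
    using \<phi> that sub by (auto simp: aut_def)
  have "\<phi> (replicate n 0) = replicate n 0"
  proof -
    have z: "replicate n 0 \<in> H" using H by (simp add: additive_def)
    then have c: "\<phi> (replicate n 0) \<in> vectors p n" using aut_image(1)[OF \<phi> sub] by blast
    have "vadd p (\<phi> (replicate n 0)) (\<phi> (replicate n 0)) = vadd p (\<phi> (replicate n 0)) (replicate n 0)"
      using hom[OF z z] vadd_zero[OF zero_closed, of n] vadd_comm[of p "\<phi> (replicate n 0)" "replicate n 0"] vadd_zero[OF c]
      by simp
    then show ?thesis using vadd_left_cancel[OF c zero_closed c] by blast
  qed
  moreover have "\<phi> (replicate n 0) \<in> \<phi> ` H" using H by (simp add: additive_def)
  ultimately have "replicate n 0 \<in> \<phi> ` H" by simp
  moreover have "vadd p u v \<in> \<phi> ` H" if uv: "u \<in> \<phi> ` H" "v \<in> \<phi> ` H" for u v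
  proof -
    obtain x y where xy: "x \<in> H" "y \<in> H" "u = \<phi> x" "v = \<phi> y" using uv by blast
    then have "vadd p x y \<in> H" using H by (simp add: additive_def)
    then show ?thesis using hom[OF xy(1,2)] xy by (metis imageI)
  qed
  ultimately show ?thesis using aut_image(1)[OF \<phi> sub] by (auto simp: additive_def)
qed

definition lift_aut :: "(int list \<Rightarrow> int list) \<Rightarrow> int list \<Rightarrow> int list" where
  "lift_aut \<theta> x = hd x # \<theta> (tl x)"

lemma lift_aut_Cons [simp]: "lift_aut \<theta> (i # v) = i # \<theta> v"
  by (simp add: lift_aut_def)

lemma aut_zero_iff:
  assumes \<phi>: "aut n \<phi>" and x: "x \<in> vectors p n" "\<phi> x = replicate n 0" shows "x = replicate n 0"
proof -
  have "additive n {replicate n 0}" using vadd_zero[OF zero_closed] zero_closed by (auto simp: additive_def)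
  then have "additive n (\<phi> ` {replicate n 0})" by (rule additive_image[OF \<phi>])
  then have "\<phi> (replicate n 0) = replicate n 0" by (simp add: additive_def)
  moreover have "inj_on \<phi> (vectors p n)" using \<phi> by (simp add: aut_def bij_betw_def)
  ultimately show ?thesis using x zero_closed[of n] by (simp add: inj_on_def)
qed

lemma aut_closed: "aut n \<phi> \<Longrightarrow> x \<in> vectors p n \<Longrightarrow> \<phi> x \<in> vectors p n"
  by (auto simp: aut_def bij_betw_def)

lemma vectors_Suc_cases:
  assumes "x \<in> vectors p (Suc n)"
  obtains i v where "x = i # v" "i \<in> residues_below p" "v \<in> vectors p n"
  using assms by (auto simp: vectors_Suc)

lemma aut_lift:
  assumes \<theta>: "aut n \<theta>" shows "aut (Suc n) (lift_aut \<theta>)"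
proof (rule autI)
  fix x assume "x \<in> vectors p (Suc n)"
  then show "lift_aut \<theta> x \<in> vectors p (Suc n)"
    by (elim vectors_Suc_cases) (simp add: aut_closed[OF \<theta>])
next
  fix x y assume "x \<in> vectors p (Suc n)" "y \<in> vectors p (Suc n)"
  then show "lift_aut \<theta> (vadd p x y) = vadd p (lift_aut \<theta> x) (lift_aut \<theta> y)"
    by (elim vectors_Suc_cases) (use \<theta> in \<open>simp add: aut_def\<close>)
next
  fix x assume "x \<in> vectors p (Suc n)" "lift_aut \<theta> x = replicate (Suc n) 0"
  then show "x = replicate (Suc n) 0"
    by (elim vectors_Suc_cases) (use aut_zero_iff[OF \<theta>] in auto)
qed

text \<open>A shear keeps the first coordinate and translates the fibre over \<open>i\<close> by
  \<open>i\<close> times \<open>\<mu>\<close>. It straightens subspaces here and later moves a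
  chosen point of a fibre to the origin.\<close>

definition shear :: "int list \<Rightarrow> int list \<Rightarrow> int list" where
  "shear \<mu> x = hd x # vadd p (tl x) (vscale p (hd x) \<mu>)"

lemma shear_Cons [simp]: "shear \<mu> (i # v) = i # vadd p v (vscale p i \<mu>)"
  by (simp add: shear_def)

lemma vadd_swap: "vadd p (vadd p a b) (vadd p c d) = vadd p (vadd p a c) (vadd p b d)"
proof -
  have "vadd p b (vadd p c d) = vadd p c (vadd p b d)"
    using vadd_assoc vadd_comm by metis
  then show ?thesis by (simp add: vadd_assoc)
qed

lemma aut_shear:
  assumes \<mu>: "\<mu> \<in> vectors p n" shows "aut (Suc n) (shear \<mu>)"
proof (rule autI)
  fix x assume "x \<in> vectors p (Suc n)"
  then show "shear \<mu> x \<in> vectors p (Suc n)"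
    by (elim vectors_Suc_cases) (simp add: vadd_closed vscale_closed \<mu>)
next
  fix x y assume "x \<in> vectors p (Suc n)" "y \<in> vectors p (Suc n)"
  then obtain i v j w where xy: "x = i # v" "y = j # w" by (elim vectors_Suc_cases)
  have "vscale p ((i + j) mod int p) \<mu> = vadd p (vscale p i \<mu>) (vscale p j \<mu>)"
    unfolding vscale_add[symmetric] by (rule vscale_cong) (simp add: Cong.cong_def)
  then show "shear \<mu> (vadd p x y) = vadd p (shear \<mu> x) (shear \<mu> y)"
    by (simp add: xy vadd_swap)
next
  fix x assume x: "x \<in> vectors p (Suc n)" "shear \<mu> x = replicate (Suc n) 0"
  then obtain i v where iv: "x = i # v" "v \<in> vectors p n" by (elim vectors_Suc_cases)
  then have "i = 0" "vadd p v (vscale p i \<mu>) = replicate n 0" using x(2) by auto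
  then have "vadd p v (replicate n 0) = replicate n 0" using \<mu> by (simp add: vscale_0 vectors_length)
  then have "v = replicate n 0" using vadd_zero[OF iv(2)] vadd_comm by metis
  then show "x = replicate (Suc n) 0" using iv \<open>i = 0\<close> by simp
qed

lemma vadd_append:
  "length a = length c \<Longrightarrow> vadd p (a @ b) (c @ d) = vadd p a c @ vadd p b d"
  by (simp add: vadd_def)

text \<open>The normal form has its free coordinates at the end, so a coordinate found to be free is
  moved there.\<close>

definition rotate_aut :: "int list \<Rightarrow> int list" where
  "rotate_aut x = tl x @ [hd x]"

lemma snoc_vectors: "w @ [i] \<in> vectors p (Suc n) \<longleftrightarrow> i \<in> residues_below p \<and> w \<in> vectors p n"
  by (auto simp: Fvec_def carrier_F)

lemma aut_rotate: "aut (Suc n) rotate_aut"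
proof (rule autI)
  fix x assume "x \<in> vectors p (Suc n)"
  then show "rotate_aut x \<in> vectors p (Suc n)"
    by (elim vectors_Suc_cases) (auto simp: rotate_aut_def snoc_vectors)
next
  fix x y assume "x \<in> vectors p (Suc n)" "y \<in> vectors p (Suc n)"
  then show "rotate_aut (vadd p x y) = vadd p (rotate_aut x) (rotate_aut y)"
    by (elim vectors_Suc_cases) (auto simp: rotate_aut_def vadd_append vectors_length vadd_def)
next
  fix x assume "x \<in> vectors p (Suc n)" "rotate_aut x = replicate (Suc n) 0"
  then show "x = replicate (Suc n) 0"
  proof (elim vectors_Suc_cases)
    fix i v assume iv: "x = i # v"
    assume "rotate_aut x = replicate (Suc n) 0"
    then have "v @ [i] = replicate n 0 @ [0]" by (simp add: iv rotate_aut_def replicate_append_same)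
    then show "x = replicate (Suc n) 0" by (simp add: iv)
  qed
qed

lemma aut_id: "aut n (\<lambda>x. x)" by (simp add: aut_def bij_betw_def)

text \<open>Induction on the dimension. Either \<open>H\<close> lies in the hyperplane of first
  coordinate 0, or it contains a vector with first coordinate 1; a shear then makes the first
  coordinate independent of the rest, and it is rotated to the end. The number \<open>s\<close> is
  the codimension of \<open>H\<close>.\<close>

lemma subspace_normal_form:
  "additive n H \<Longrightarrow> \<exists>\<theta> s. aut n \<theta> \<and> s \<le> n \<and> \<theta> ` H = (\<lambda>v. replicate s 0 @ v) ` vectors p (n - s)"
proof (induction n arbitrary: H)
  case 0
  then have "H = {[]}" by (auto simp: additive_def vectors_0)
  then show ?case by (intro exI[of _ "\<lambda>x. x"] exI[of _ 0]) (simp add: aut_id vectors_0)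
next
  case (Suc n)
  have sub: "H \<subseteq> vectors p (Suc n)" using Suc.prems by (simp add: additive_def)
  define H0 where "H0 = fib H 0"
  have H0: "additive n H0"
  proof -
    have "vadd p v w \<in> H0" if "v \<in> H0" "w \<in> H0" for v w
    proof -
      have "vadd p (0 # v) (0 # w) \<in> H" using that Suc.prems by (simp add: H0_def fib_def additive_def del: vadd_Cons)
      then show ?thesis by (simp add: H0_def fib_def)
    qed
    then show ?thesis using fib_subset[OF sub, of 0] Suc.prems by (simp add: H0_def fib_def additive_def)
  qed
  obtain \<theta> s where \<theta>: "aut n \<theta>" "s \<le> n" "\<theta> ` H0 = (\<lambda>v. replicate s 0 @ v) ` vectors p (n - s)"
    using Suc.IH[OF H0] by blast
  show ?case
  proof (cases "\<forall>x\<in>H. hd x = 0")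
    case True
    have "H = (#) 0 ` H0"
    proof (intro equalityI subsetI)
      fix x assume x: "x \<in> H"
      then obtain i v where "x = i # v" using sub by (auto simp: vectors_Suc)
      then show "x \<in> (#) 0 ` H0" using True x by (auto simp: H0_def fib_def)
    qed (auto simp: H0_def fib_def)
    then have "lift_aut \<theta> ` H = (#) 0 ` (\<theta> ` H0)" by (simp add: image_image)
    also have "\<dots> = (\<lambda>v. replicate (Suc s) 0 @ v) ` vectors p (Suc n - Suc s)"
      unfolding \<theta>(3) by (simp add: image_image)
    finally show ?thesis using \<theta>(2) aut_lift[OF \<theta>(1)]
      by (intro exI[of _ "lift_aut \<theta>"] exI[of _ "Suc s"]) simp
  next
    case False
    then obtain x where x: "x \<in> H" "hd x \<noteq> 0" by blast
    then obtain i v where iv: "x = i # v" "i \<in> residues_below p" "v \<in> vectors p n" "i \<noteq> 0"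
      using sub by (auto simp: vectors_Suc)
    have "\<not> int p dvd i" using iv zdvd_not_zless[of i "int p"] by force
    then have "coprime i (int p)"
      using prime by (metis coprime_commute prime_imp_coprime prime_int_nat_transfer of_nat_0_le_iff nat_int)
    then obtain k where k: "[i * k = 1] (mod int p)" using cong_solve_coprime_int by blast
    define v1 where "v1 = vscale p k v"
    have v1: "v1 \<in> vectors p n" unfolding v1_def using iv by (intro vscale_closed)
    have line: "(j mod int p) # vscale p j v1 \<in> H" for j
    proof -
      have "vscale p (j * k) x \<in> H" by (rule additive_vscale[OF Suc.prems x(1)])
      moreover have "(j * k * i) mod int p = j mod int p"
      proof -
        have "[j * (i * k) = j * 1] (mod int p)" using k by (intro cong_mult) auto
        then show ?thesis by (simp add: Cong.cong_def mult.assoc mult.commute[of k i])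
      qed
      ultimately show ?thesis by (simp add: iv v1_def vscale_vscale)
    qed
    \<comment> \<open>\<open>1 # v1\<close> lies in \<open>H\<close>; shearing by \<open>-v1\<close>
      sends this line to the first coordinate axis.\<close>
    define \<mu> where "\<mu> = vscale p (-1) v1"
    have \<mu>: "\<mu> \<in> vectors p n" unfolding \<mu>_def by (rule vscale_closed[OF v1])
    have H_iff: "j # w \<in> shear \<mu> ` H \<longleftrightarrow> j \<in> residues_below p \<and> w \<in> H0" for j w
    proof
      assume "j # w \<in> shear \<mu> ` H"
      then obtain y where y: "y \<in> H" "shear \<mu> y = j # w" by (metis imageE)
      then obtain u where u: "y = j # u" "j \<in> residues_below p" "u \<in> vectors p n"
        using sub by (auto simp: vectors_Suc)
      have w: "w = vadd p u (vscale p (- j) v1)" using y u by (simp add: \<mu>_def vscale_vscale)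
      have "vadd p (j # u) ((- j) mod int p # vscale p (- j) v1) \<in> H"
        using y u line[of "- j"] Suc.prems by (simp add: additive_def del: vadd_Cons)
      then have "0 # w \<in> H" by (simp add: w mod_simps)
      then show "j \<in> residues_below p \<and> w \<in> H0" using u by (simp add: H0_def fib_def)
    next
      assume jw: "j \<in> residues_below p \<and> w \<in> H0"
      then have "vadd p (0 # w) (j mod int p # vscale p j v1) \<in> H"
        using line[of j] Suc.prems by (simp add: H0_def fib_def additive_def del: vadd_Cons)
      then have in_H: "j # vadd p w (vscale p j v1) \<in> H" using jw by simp
      have w: "w \<in> vectors p n" using jw H0 by (auto simp: additive_def)
      have "vadd p (vadd p w (vscale p j v1)) (vscale p j \<mu>) = w"
      proof -
        have "vadd p (vscale p j v1) (vscale p j \<mu>) = vscale p (j + j * (-1)) v1"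
          unfolding \<mu>_def vscale_vscale vscale_add ..
        also have "\<dots> = replicate n 0" using v1 by (simp add: vscale_0 vectors_length)
        finally show ?thesis using vadd_zero[OF w] by (simp only: vadd_assoc vadd_comm[of p w "replicate n 0"])
      qed
      then have "shear \<mu> (j # vadd p w (vscale p j v1)) = j # w" by simp
      then show "j # w \<in> shear \<mu> ` H" using in_H by (metis imageI)
    qed
    have shear_H: "shear \<mu> ` H = (\<lambda>(j, w). j # w) ` (residues_below p \<times> H0)"
    proof (intro equalityI subsetI)
      fix z assume z: "z \<in> shear \<mu> ` H"
      then have "z \<in> vectors p (Suc n)" using aut_image(1)[OF aut_shear[OF \<mu>] sub] by blast
      then obtain j w where "z = j # w" by (elim vectors_Suc_cases)
      then show "z \<in> (\<lambda>(j, w). j # w) ` (residues_below p \<times> H0)" using z H_iff by auto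
    qed (use H_iff in auto)
    define \<psi> where "\<psi> = rotate_aut \<circ> (lift_aut \<theta> \<circ> shear \<mu>)"
    have "\<psi> ` H = rotate_aut ` lift_aut \<theta> ` shear \<mu> ` H"
      unfolding \<psi>_def by (simp only: image_comp)
    also have "\<dots> = (\<lambda>(j, w). w @ [j]) ` (residues_below p \<times> (\<theta> ` H0))"
      unfolding shear_H by (force simp: rotate_aut_def image_def)
    also have "\<dots> = (\<lambda>v. replicate s 0 @ v) ` vectors p (Suc n - s)"
    proof (intro equalityI subsetI)
      fix z assume "z \<in> (\<lambda>(j, w). w @ [j]) ` (residues_below p \<times> (\<theta> ` H0))"
      then obtain j u where ju: "j \<in> residues_below p" "u \<in> vectors p (n - s)" "z = replicate s 0 @ (u @ [j])"
        unfolding \<theta>(3) by auto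
      then have "u @ [j] \<in> vectors p (Suc n - s)" using \<theta>(2) by (simp add: Suc_diff_le snoc_vectors)
      then show "z \<in> (\<lambda>v. replicate s 0 @ v) ` vectors p (Suc n - s)" using ju(3) by blast
    next
      fix z assume "z \<in> (\<lambda>v. replicate s 0 @ v) ` vectors p (Suc n - s)"
      then obtain v where v: "z = replicate s 0 @ v" "v \<in> vectors p (Suc (n - s))"
        using \<theta>(2) by (auto simp: Suc_diff_le)
      then have "v \<noteq> []" using vectors_length by fastforce
      then obtain u j where uj: "v = u @ [j]" by (metis rev_exhaust)
      then have "j \<in> residues_below p" "u \<in> vectors p (n - s)" using v(2) by (simp_all add: snoc_vectors)
      then show "z \<in> (\<lambda>(j, w). w @ [j]) ` (residues_below p \<times> (\<theta> ` H0))"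
        unfolding \<theta>(3) v(1) uj by force
    qed
    finally have "\<psi> ` H = (\<lambda>v. replicate s 0 @ v) ` vectors p (Suc n - s)" .
    moreover have "aut (Suc n) \<psi>"
      unfolding \<psi>_def by (intro aut_comp aut_rotate aut_lift \<theta>(1) aut_shear \<mu>)
    ultimately show ?thesis using \<theta>(2) by (intro exI[of _ \<psi>] exI[of _ s]) simp
  qed
qed

end

section \<open>The support is an interval\<close>

text \<open>A matching argument: no two places at distance \<open>\<delta>\<close> carry more than one full weight.\<close>

lemma weight_distance:
  fixes w :: "int \<Rightarrow> nat"
  assumes le: "\<And>q. q \<in> {0..<L} \<Longrightarrow> w q \<le> N"
    and pair: "\<And>q j. q \<in> {0..<L} \<Longrightarrow> j \<in> {0..<L} \<Longrightarrow> q = j + \<delta> \<Longrightarrow> w q + w j \<le> N"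
    and total: "m * N \<le> (\<Sum>q\<in>{0..<L}. w q)" and N: "N > 0" and L: "L \<le> int m + 8" and m: "m \<ge> 25"
  shows "int m \<le> \<bar>\<delta>\<bar>"
proof -
  define d where "d = \<bar>\<delta>\<bar>"
  have d0: "d \<ge> 0" by (simp add: d_def)
  have pair': "w j + w (j + d) \<le> N" if "j \<in> {0..<L - d}" for j
    using pair[of "j + d" j] pair[of j "j + d"] that d0 by (cases "\<delta> \<ge> 0") (auto simp: d_def)
  have sum_le: "int (\<Sum>q\<in>Q. w q) \<le> int (card Q) * int N" if "Q \<subseteq> {0..<L}" for Q
  proof -
    have "(\<Sum>q\<in>Q. w q) \<le> of_nat (card Q) * N"
      by (rule sum_bounded_above) (use le that in blast)
    then have "(\<Sum>q\<in>Q. w q) \<le> card Q * N" by simp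
    then show ?thesis by (simp only: of_nat_le_iff of_nat_mult[symmetric])
  qed
  have mL: "int m \<le> L"
  proof -
    have "int (m * N) \<le> int (card {0..<L}) * int N"
      using total sum_le[OF order_refl] by (metis (no_types) of_nat_le_iff order_trans)
    then have "int m * int N \<le> int (nat L) * int N" by simp
    then have "int m \<le> int (nat L)" using N by (simp only: mult_le_cancel_right)
    then show ?thesis using m by linarith
  qed
  have pairs: "int (\<Sum>q\<in>{0..<L - d}. w q) + int (\<Sum>q\<in>{d..<L}. w q) \<le> (L - d) * int N" if "d \<le> L"
  proof -
    have "(\<Sum>q\<in>{d..<L}. w q) = (\<Sum>q\<in>{0..<L - d}. w (q + d))"
      by (rule sum.reindex_bij_witness[of _ "\<lambda>q. q + d" "\<lambda>q. q - d"]) auto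
    then have "(\<Sum>q\<in>{0..<L - d}. w q) + (\<Sum>q\<in>{d..<L}. w q) = (\<Sum>q\<in>{0..<L - d}. w q + w (q + d))"
      by (simp add: sum.distrib)
    also have "\<dots> \<le> card {0..<L - d} * N"
      using sum_bounded_above[of "{0..<L - d}" "\<lambda>q. w q + w (q + d)" N] pair' by simp
    finally have "int ((\<Sum>q\<in>{0..<L - d}. w q) + (\<Sum>q\<in>{d..<L}. w q)) \<le> int (card {0..<L - d} * N)"
      by (simp only: of_nat_le_iff)
    then show ?thesis using that by simp
  qed
  have total': "int m * int N \<le> int (\<Sum>q\<in>{0..<L}. w q)"
    using total by (simp only: of_nat_mult[symmetric] of_nat_le_iff)
  consider "L \<le> d" | "d < L" "L \<le> 2 * d" | "2 * d < L" by linarith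
  then have "int m \<le> d"
  proof cases
    case 1 then show ?thesis using mL by simp
  next
    \<comment> \<open>The pairs \<open>j\<close>, \<open>j + d\<close> are disjoint here, and only
      the \<open>2 * d - L\<close> middle places stay unmatched, so the total is at most
      \<open>d * N\<close>.\<close>
    case 2
    have eq: "{0..<L} = {0..<L - d} \<union> ({L - d..<d} \<union> {d..<L})" using 2 d0 by auto
    have "(\<Sum>q\<in>{0..<L}. w q) = (\<Sum>q\<in>{0..<L - d}. w q) + ((\<Sum>q\<in>{L - d..<d}. w q) + (\<Sum>q\<in>{d..<L}. w q))"
      unfolding eq using 2 by (subst sum.union_disjoint; (subst sum.union_disjoint)?) auto
    moreover have "int (\<Sum>q\<in>{L - d..<d}. w q) \<le> (2 * d - L) * int N"
      using sum_le[of "{L - d..<d}"] 2 by simp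
    ultimately have "int m * int N \<le> (L - d) * int N + (2 * d - L) * int N"
      using pairs 2 total' by linarith
    also have "\<dots> = d * int N" by (simp add: algebra_simps)
    finally show ?thesis using N by simp
  next
    \<comment> \<open>The pairs overlap, so the weight is counted twice:
      \<open>2 * m <= L + d\<close>, which is below 3L/2 and contradicts \<open>L <= m + 8\<close>
      for \<open>m >= 25\<close>.\<close>
    case 3
    have "{0..<L} = {0..<L - d} \<union> {L - d..<L}" "{0..<L} = {0..<d} \<union> {d..<L}" using 3 d0 by auto
    then have "(\<Sum>q\<in>{0..<L}. w q) = (\<Sum>q\<in>{0..<L - d}. w q) + (\<Sum>q\<in>{L - d..<L}. w q)"
      "(\<Sum>q\<in>{0..<L}. w q) = (\<Sum>q\<in>{0..<d}. w q) + (\<Sum>q\<in>{d..<L}. w q)"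
      by (metis sum.union_disjoint finite_atLeastLessThan_int ivl_disj_int_two(3))+
    moreover have "int (\<Sum>q\<in>{L - d..<L}. w q) \<le> d * int N" "int (\<Sum>q\<in>{0..<d}. w q) \<le> d * int N"
      using sum_le[of "{L - d..<L}"] sum_le[of "{0..<d}"] 3 d0 by simp_all
    ultimately have "2 * (int m * int N) \<le> (L - d) * int N + 2 * (d * int N)"
      using pairs 3 d0 total' by linarith
    also have "\<dots> = (L + d) * int N" by (simp add: algebra_simps)
    finally have "(2 * int m) * int N \<le> (L + d) * int N" by (simp add: mult.assoc)
    then have "2 * int m \<le> L + d" using N by simp
    then show ?thesis using 3 L m by linarith
  qed
  then show ?thesis by (simp add: d_def)
qed

text \<open>The upper bounds, \<open>N\<close> for each place of \<open>Q\<close> and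
  \<open>k * N\<close> for all of \<open>U\<close>, add up to the lower bound on the total, so each
  of them is attained.\<close>

lemma weights_equality:
  fixes w :: "int \<Rightarrow> nat" and L :: int
  assumes le: "\<And>q. q \<in> Q \<Longrightarrow> w q \<le> N" and fin: "finite Q" "finite U" and disj: "Q \<inter> U = {}"
    and total: "(card Q + k) * N \<le> (\<Sum>q\<in>Q \<union> U. w q)" and U: "(\<Sum>q\<in>U. w q) \<le> k * N"
  shows "\<And>q. q \<in> Q \<Longrightarrow> w q = N" "(\<Sum>q\<in>U. w q) = k * N"
proof -
  have split: "(\<Sum>q\<in>Q \<union> U. w q) = (\<Sum>q\<in>Q. w q) + (\<Sum>q\<in>U. w q)"
    using fin disj by (intro sum.union_disjoint) auto
  have Q: "(\<Sum>q\<in>Q. w q) \<le> card Q * N" using sum_bounded_above[of Q w N] le by simp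
  then show "(\<Sum>q\<in>U. w q) = k * N" using total U split by (simp add: distrib_right)
  have "(\<Sum>q\<in>Q. w q) = (\<Sum>q\<in>Q. N)" using Q total U split by (simp add: distrib_right)
  then have "(\<Sum>q\<in>Q. N - w q) = 0" using sum_subtractf_nat[of Q w "\<lambda>_. N"] le by simp
  then show "w q = N" if "q \<in> Q" for q using that fin(1) le[OF that] by (auto intro: order_antisym)
qed

context fvec
begin

section \<open>Sets placed over an arc of residues\<close>

definition pos :: "int \<Rightarrow> int \<Rightarrow> int" where "pos y q = (y + q) mod int p"

lemma pos_residue [simp]: "pos y q \<in> residues_below p" using p_pos by (simp add: pos_def)

lemma pos_inj: "inj_on (pos y) {0..<int p}" unfolding pos_def by (rule inj_on_shift_mod)

text \<open>The end fibres are required to be inhabited: this makes \<open>L\<close> exact and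
  provides the two summands that every later relation uses. The bound \<open>m + 8\<close> is the
  number of residues left by \<open>support_in_short_interval\<close>.\<close>

definition placed :: "nat \<Rightarrow> nat \<Rightarrow> int list set \<Rightarrow> int \<Rightarrow> int \<Rightarrow> bool" where
  "placed m n A y L \<longleftrightarrow> sum_free (Suc n) A \<and> m * p ^ n \<le> card A \<and> 0 < L \<and> L \<le> int m + 8 \<and>
    fib A (pos y 0) \<noteq> {} \<and> fib A (pos y (L - 1)) \<noteq> {} \<and> (\<forall>x\<in>A. hd x \<in> pos y ` {0..<L})"

lemma placed_exists:
  assumes A: "sum_free (Suc n) A" "m * p ^ n \<le> card A" "A \<noteq> {}"
    and d: "\<forall>x\<in>A. \<exists>j\<in>{0..int m + 7}. hd x = (d + j) mod int p"
  shows "\<exists>y L. placed m n A y L"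
proof -
  define J where "J = {j\<in>{0..int m + 7}. fib A (pos d j) \<noteq> {}}"
  have finJ: "finite J" unfolding J_def by (rule finite_subset[of _ "{0..int m + 7}"]) auto
  have sub: "A \<subseteq> vectors p (Suc n)" using A by (simp add: sum_free_def)
  have hdJ: "\<exists>j\<in>J. hd x = pos d j" if x: "x \<in> A" for x
  proof -
    obtain j where j: "j \<in> {0..int m + 7}" "hd x = pos d j" using d x by (auto simp: pos_def)
    obtain i v where "x = i # v" using x sub by (auto simp: vectors_Suc)
    then have "v \<in> fib A (pos d j)" using x j by (simp add: fib_def)
    then show ?thesis using j by (auto simp: J_def)
  qed
  then have ne: "J \<noteq> {}" using A(3) by blast
  define a where "a = Min J"
  define b where "b = Max J"
  have ab: "a \<in> J" "b \<in> J" and range: "\<And>j. j \<in> J \<Longrightarrow> a \<le> j \<and> j \<le> b"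
    using finJ ne by (auto simp: a_def b_def)
  have shift: "pos (d + a) q = pos d (a + q)" for q by (simp add: pos_def add.assoc)
  have "hd x \<in> pos (d + a) ` {0..<b - a + 1}" if x: "x \<in> A" for x
  proof -
    obtain j where j: "j \<in> J" "hd x = pos d j" using hdJ x by blast
    then show ?thesis using range[of j] by (intro image_eqI[of _ _ "j - a"]) (auto simp: shift)
  qed
  moreover have "a \<le> b" using range ab by blast
  ultimately have "placed m n A (d + a) (b - a + 1)"
    using A ab by (auto simp: placed_def shift J_def)
  then show ?thesis by blast
qed

context
  fixes m n :: nat and A :: "int list set" and y L :: int
  assumes pl: "placed m n A y L" and pm: "p = 4 * m + 3" "m \<ge> 25"
begin

definition "wt q = card (fib A (pos y q))"

lemma sub_A: "A \<subseteq> vectors p (Suc n)" and sf: "sum_free (Suc n) A"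
  using pl by (auto simp: placed_def sum_free_def)

lemma fib_sub: "fib A i \<subseteq> vectors p n" by (rule fib_subset[OF sub_A])

lemma finite_fib: "finite (fib A i)" by (rule finite_subset[OF fib_sub finite_vectors])

lemma L_range: "0 < L" "L \<le> int m + 8" "L < int p"
proof -
  show L: "0 < L" "L \<le> int m + 8" using pl by (simp_all add: placed_def)
  have "int p = 4 * int m + 3" using pm(1) by simp
  then show "L < int p" using L pm(2) by linarith
qed

lemma wt_le: "wt q \<le> p ^ n"
  using card_mono[OF finite_vectors fib_sub] by (simp add: wt_def card_vectors)

lemma wt_pos: "fib A (pos y q) \<noteq> {} \<longleftrightarrow> 0 < wt q"
  using finite_fib by (simp add: wt_def card_gt_0_iff)

lemma fib_empty: "i \<in> residues_below p - pos y ` {0..<L} \<Longrightarrow> fib A i = {}"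
  using pl by (force simp: placed_def fib_def)

lemma card_A: "card A = (\<Sum>q\<in>{0..<L}. wt q)"
proof -
  have "card A = (\<Sum>i\<in>pos y ` {0..<L}. card (fib A i))"
    unfolding card_fib_sum[OF sub_A]
  proof (rule sum.mono_neutral_right)
    show "pos y ` {0..<L} \<subseteq> residues_below p" using pos_residue by blast
    show "\<forall>i\<in>residues_below p - pos y ` {0..<L}. card (fib A i) = 0" using fib_empty by simp
  qed simp
  also have "\<dots> = (\<Sum>q\<in>{0..<L}. wt q)"
    unfolding wt_def by (rule sum.reindex_cong[OF inj_on_subset[OF pos_inj]]) (use L_range in auto)
  finally show ?thesis .
qed

lemma fib_triple:
  assumes "[q = 2 * y + i + i' + j] (mod int p)"
    and "u \<in> fib A (pos y i)" "v \<in> fib A (pos y i')" "w \<in> fib A (pos y j)"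
  shows "vadd p (vadd p u v) w \<notin> fib A (pos y q)"
proof -
  have "(pos y i + pos y i' + pos y j) mod int p = pos y q"
  proof -
    have "[y + q = y + (2 * y + i + i' + j)] (mod int p)" using assms(1) by (intro cong_add) auto
    moreover have "y + (2 * y + i + i' + j) = (y + i) + (y + i') + (y + j)" by simp
    ultimately have "(y + q) mod int p = ((y + i) + (y + i') + (y + j)) mod int p"
      by (simp only: Cong.cong_def)
    moreover have "[pos y i + pos y i' + pos y j = (y + i) + (y + i') + (y + j)] (mod int p)"
      by (intro cong_add) (simp_all add: pos_def Cong.cong_def)
    ultimately show ?thesis by (simp only: Cong.cong_def pos_def)
  qed
  then show ?thesis using fib_sum[OF sf assms(2-4)] by simp
qed

text \<open>Only the end fibres are known to be inhabited, so two summands come from there; the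
  relation then becomes a shift of the offset by \<open>2 * y + i + i'\<close>. An empty fibre at
  \<open>j\<close> makes the bound trivial.\<close>

lemma wt_pair:
  assumes c: "[q = 2 * y + i + i' + j] (mod int p)" and i: "i \<in> {0, L - 1}" "i' \<in> {0, L - 1}"
  shows "wt q + wt j \<le> p ^ n"
proof (cases "fib A (pos y j) = {}")
  case True
  then show ?thesis using wt_le by (simp add: wt_def)
next
  case False
  have ne: "fib A (pos y i) \<noteq> {}" "fib A (pos y i') \<noteq> {}" using i pl by (auto simp: placed_def)
  have "card (fib A (pos y j)) + card (fib A (pos y q)) \<le> p ^ n"
    by (rule disjoint_triple_sum_pairs(1)[OF fib_sub fib_sub fib_sub fib_sub ne False fib_triple[OF c]])
  then show ?thesis by (simp add: wt_def)
qed

lemma distance: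
  assumes i: "i \<in> {0, L - 1}" "i' \<in> {0, L - 1}" and \<delta>: "[2 * y + i + i' = \<delta>] (mod int p)"
  shows "int m \<le> \<bar>\<delta>\<bar>"
proof (rule weight_distance[where w = wt and N = "p ^ n" and L = L])
  fix q j assume q: "q = j + \<delta>"
  show "wt q + wt j \<le> p ^ n"
  proof (rule wt_pair[OF _ i])
    have "[\<delta> + j = 2 * y + i + i' + j] (mod int p)"
      using \<delta> by (intro cong_add) (auto intro: cong_sym)
    then show "[q = 2 * y + i + i' + j] (mod int p)" by (simp add: q add.commute)
  qed
qed (use wt_le pl L_range pm(2) p_pos card_A in \<open>auto simp: placed_def\<close>)

text \<open>By \<open>distance\<close>, residues closer than \<open>m\<close> to 0 are forbidden for
  \<open>t\<close>, \<open>t + (L - 1)\<close> and \<open>t + 2 * (L - 1)\<close>. A step of at most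
  \<open>m + 7\<close> cannot jump over the forbidden zone from \<open>p - m\<close> to
  \<open>p + m\<close>, so all three stay between \<open>m\<close> and
  \<open>p - m = 3 * m + 3\<close>.\<close>

lemma position:
  defines "t \<equiv> (2 * y) mod int p"
  shows "int m \<le> t" "t + 2 * (L - 1) \<le> 3 * int m + 3" "int m \<le> L"
proof -
  have t: "0 \<le> t" "t < int p" using p_pos by (auto simp: t_def)
  have ct: "[2 * y = t] (mod int p)" by (simp add: t_def Cong.cong_def)
  have c: "[2 * y + u = t + u + k * int p] (mod int p)" for u k
    using ct by (simp add: Cong.cong_def t_def mod_simps)
  show mL: "int m \<le> L"
  proof -
    have "m * p ^ n \<le> (\<Sum>q\<in>{0..<L}. wt q)" using pl card_A by (simp add: placed_def)
    also have "\<dots> \<le> card {0..<L} * p ^ n" using sum_bounded_above[of "{0..<L}" wt "p ^ n"] wt_le by simp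
    finally show ?thesis using p_pos L_range by simp
  qed
  have d: "int m \<le> \<bar>t + (i + i') + k * int p\<bar>" if "i \<in> {0, L - 1}" "i' \<in> {0, L - 1}" for i i' k
    by (rule distance[OF that]) (use c[of "i + i'" k] in \<open>simp add: add.assoc\<close>)
  have pi: "int p = 4 * int m + 3" using pm by simp
  show 1: "int m \<le> t" using d[of 0 0 0] t by simp
  have 2: "t \<le> 3 * int m + 3" using d[of 0 0 "-1"] t pi by simp
  have 3: "t + (L - 1) \<le> 3 * int m + 3" using d[of 0 "L - 1" "-1"] 2 L_range pi pm(2) mL by auto
  show "t + 2 * (L - 1) \<le> 3 * int m + 3" using d[of "L - 1" "L - 1" "-1"] 3 L_range pi pm(2) mL by auto
qed

lemma A_eq: "A = (\<Union>q\<in>{0..<L}. cons_prod {pos y q} (fib A (pos y q)))"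
proof (intro equalityI subsetI)
  fix x assume x: "x \<in> A"
  then obtain i v where iv: "x = i # v" using sub_A by (auto simp: vectors_Suc)
  then obtain q where "q \<in> {0..<L}" "i = pos y q" using x pl by (force simp: placed_def)
  then show "x \<in> (\<Union>q\<in>{0..<L}. cons_prod {pos y q} (fib A (pos y q)))"
    using x iv by (auto simp: cons_prod_def fib_def)
qed (auto simp: cons_prod_def fib_def)

end

lemma cyc_interval_pos:
  assumes "0 \<le> b - a" "b - a < int p"
  shows "cyc_interval p (y + a) (y + b) = pos y ` {a..b}"
proof -
  have "cyc_interval p (y + a) (y + b) = (\<lambda>i. pos y (a + i)) ` {0..b - a}"
    using assms by (simp add: cyc_interval_def pos_def add.assoc)
  also have "\<dots> = pos y ` (\<lambda>i. a + i) ` {0..b - a}" by (simp only: image_image)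
  also have "(\<lambda>i. a + i) ` {0..b - a} = {a..b}" by simp
  finally show ?thesis .
qed

lemma cyc_interval_cong:
  assumes "[a = a'] (mod int p)" "[b = b'] (mod int p)"
  shows "cyc_interval p a b = cyc_interval p a' b'"
proof -
  have "(a + i) mod int p = (a' + i) mod int p" for i
    using assms(1) by (metis Cong.cong_def mod_add_left_eq)
  moreover have "(b - a) mod int p = (b' - a') mod int p"
    using cong_diff[OF assms(2,1)] by (simp add: Cong.cong_def)
  ultimately show ?thesis by (simp add: cyc_interval_def)
qed

lemma UN_cons_prod: "(\<Union>q\<in>Q. cons_prod {f q} V) = cons_prod (f ` Q) V"
  by (auto simp: cons_prod_def)

lemma placed_aut:
  assumes pl: "placed m n A y L" and \<phi>: "aut (Suc n) \<phi>"
    and hd: "\<And>x. x \<in> A \<Longrightarrow> hd (\<phi> x) = hd x"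
  shows "placed m n (\<phi> ` A) y L"
proof -
  have A: "sum_free (Suc n) A" using pl by (simp add: placed_def)
  then have sub: "A \<subseteq> vectors p (Suc n)" by (simp add: sum_free_def)
  have "fib (\<phi> ` A) i \<noteq> {}" if ne: "fib A i \<noteq> {}" for i
  proof -
    obtain v where v: "i # v \<in> A" using ne by (auto simp: fib_def)
    then have "\<phi> (i # v) \<in> vectors p (Suc n)" using aut_image(1)[OF \<phi> sub] by blast
    then obtain w where "\<phi> (i # v) = i # w" using hd[OF v] by (auto simp: vectors_Suc)
    then show ?thesis using v by (force simp: fib_def)
  qed
  moreover have "card (\<phi> ` A) = card A" by (rule aut_image(2)[OF \<phi> sub])
  ultimately show ?thesis using pl aut_sum_free[OF \<phi> A] hd by (auto simp: placed_def)
qed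

text \<open>Negation exchanges the ends of the arc, which halves the list of positions to be
  treated.\<close>

lemma placed_negate:
  assumes pl: "placed m n A y L"
  shows "placed m n (vscale p (-1) ` A) (- (y + (L - 1))) L"
proof -
  let ?A = "vscale p (-1) ` A" and ?y = "- (y + (L - 1))"
  have A: "sum_free (Suc n) A" using pl by (simp add: placed_def)
  then have sub: "A \<subseteq> vectors p (Suc n)" by (simp add: sum_free_def)
  have neg: "aut (Suc n) (vscale p (-1))" by (rule aut_scale) simp
  have pos_neg: "(- 1 * pos y q) mod int p = pos ?y (L - 1 - q)" for q
    by (simp add: pos_def mod_simps algebra_simps)
  have "fib ?A (pos ?y (L - 1 - q)) \<noteq> {}" if ne: "fib A (pos y q) \<noteq> {}" for q
  proof -
    obtain v where v: "pos y q # v \<in> A" using ne by (auto simp: fib_def)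
    then have "vscale p (-1) (pos y q # v) \<in> ?A" by blast
    then have "pos ?y (L - 1 - q) # vscale p (-1) v \<in> ?A" unfolding vscale_Cons pos_neg .
    then show ?thesis by (auto simp: fib_def)
  qed
  note ends = this[of 0] this[of "L - 1"]
  have "hd x \<in> pos ?y ` {0..<L}" if x: "x \<in> ?A" for x
  proof -
    obtain z where z: "z \<in> A" "x = vscale p (-1) z" using x by blast
    then obtain i v where iv: "z = i # v" using sub by (auto simp: vectors_Suc)
    then obtain q where q: "q \<in> {0..<L}" "i = pos y q" using z pl by (force simp: placed_def)
    then have "hd x = pos ?y (L - 1 - q)" using z iv pos_neg by simp
    then show ?thesis using q by auto
  qed
  then show ?thesis
    using pl ends aut_sum_free[OF neg A] aut_image(2)[OF neg sub] by (auto simp: placed_def)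
qed

text \<open>A shear translates the fibre over \<open>i\<close> by a multiple \<open>i\<close> of an
  arbitrary vector, so it can bring any of its points to the origin provided \<open>i\<close> is
  invertible.\<close>

lemma placed_translate:
  assumes pl: "placed m n A y L" and q: "\<not> int p dvd y + q" and ne: "fib A (pos y q) \<noteq> {}"
  shows "\<exists>\<phi>. aut (Suc n) \<phi> \<and> placed m n (\<phi> ` A) y L \<and> replicate n 0 \<in> fib (\<phi> ` A) (pos y q)"
proof -
  have sub: "A \<subseteq> vectors p (Suc n)" using pl by (simp add: placed_def sum_free_def)
  obtain v where v: "pos y q # v \<in> A" using ne by (auto simp: fib_def)
  then have vv: "v \<in> vectors p n" using sub by auto
  have "coprime (y + q) (int p)"
    using prime q by (metis coprime_commute prime_imp_coprime prime_int_nat_transfer of_nat_0_le_iff nat_int)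
  then obtain k where k: "[(y + q) * k = 1] (mod int p)" using cong_solve_coprime_int by blast
  define \<mu> where "\<mu> = vscale p (- k) v"
  have \<mu>: "\<mu> \<in> vectors p n" unfolding \<mu>_def by (rule vscale_closed[OF vv])
  have "vadd p v (vscale p (pos y q) \<mu>) = replicate n 0"
  proof -
    have "[pos y q * (- k) = -1] (mod int p)"
    proof -
      have "[pos y q * (- k) = (y + q) * (- k)] (mod int p)"
        by (intro cong_mult) (auto simp: pos_def Cong.cong_def)
      also have "(y + q) * (- k) = - ((y + q) * k)" by simp
      also have "[- ((y + q) * k) = - 1] (mod int p)" using k by (simp add: cong_minus_minus_iff)
      finally show ?thesis .
    qed
    then have "vscale p (pos y q) \<mu> = vscale p (-1) v"
      unfolding \<mu>_def vscale_vscale by (rule vscale_cong)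
    then show ?thesis using vadd_neg[OF vv] vadd_comm by metis
  qed
  then have "shear \<mu> (pos y q # v) = pos y q # replicate n 0" by simp
  then have "replicate n 0 \<in> fib (shear \<mu> ` A) (pos y q)" using v unfolding fib_def by (metis imageI mem_Collect_eq)
  moreover have "placed m n (shear \<mu> ` A) y L"
    by (rule placed_aut[OF pl aut_shear[OF \<mu>]]) (simp add: shear_def)
  ultimately show ?thesis using aut_shear[OF \<mu>] by blast
qed

text \<open>Equality case of the pigeonhole bound: as 0 is in \<open>B\<close>, already
  \<open>B\<close> and \<open>B + B\<close> miss \<open>D\<close>; the count makes \<open>D\<close>
  the full complement of \<open>B\<close>, hence \<open>B + B\<close> lies in
  \<open>B\<close>.\<close>

lemma additive_of_complement:
  assumes B: "B \<subseteq> vectors p n" "replicate n 0 \<in> B" and D: "D \<subseteq> vectors p n"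
    and card: "card B + card D = p ^ n"
    and disj: "\<And>u v w. u \<in> B \<Longrightarrow> v \<in> B \<Longrightarrow> w \<in> B \<Longrightarrow> vadd p (vadd p u v) w \<notin> D"
  shows "additive n B" "D = vectors p n - B"
proof -
  have zero: "vadd p w (replicate n 0) = w" if "w \<in> vectors p n" for w
    using vadd_zero[OF that] vadd_comm by metis
  have notD: "vadd p u v \<notin> D" if "u \<in> B" "v \<in> B" for u v
  proof -
    have "vadd p u v \<in> vectors p n" using that B by (intro vadd_closed) auto
    then show ?thesis using disj[OF that B(2)] zero by simp
  qed
  have "u \<notin> D" if "u \<in> B" for u
  proof -
    have "vadd p u (replicate n 0) \<notin> D" using notD that B(2) by blast
    then show ?thesis using zero that B(1) by (simp add: subset_eq)
  qed
  then have "B \<inter> D = {}" by blast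
  then have "card (B \<union> D) = card (vectors p n)"
    using card card_Un_disjoint[of B D] finite_subset[OF B(1)] finite_subset[OF D] by (simp add: card_vectors)
  then have un: "B \<union> D = vectors p n" using B D by (intro card_subset_eq) auto
  show "D = vectors p n - B" using un \<open>B \<inter> D = {}\<close> D by blast
  have "vadd p u v \<in> B" if "u \<in> B" "v \<in> B" for u v
    using notD[OF that] un vadd_closed[of u n v] that B by blast
  then show "additive n B" using B by (simp add: additive_def)
qed

end

section \<open>Classification\<close>

lemma cong_combination:
  fixes x c u v k l p :: int
  assumes "[x = c] (mod p)" "u - v = k * (x - c) + l * p" shows "[u = v] (mod p)"
  using assms by (simp add: cong_iff_dvd_diff)

lemma append_prod_Un: "append_prod (X \<union> Y) D = append_prod X D \<union> append_prod Y D"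
  by (auto simp: append_prod_def)

lemma append_prod_cons_prod: "append_prod (cons_prod S C) D = cons_prod S (append_prod C D)"
proof (intro equalityI subsetI)
  fix x assume "x \<in> append_prod (cons_prod S C) D"
  then obtain t y d where "x = t # (y @ d)" "t \<in> S" "y \<in> C" "d \<in> D"
    unfolding append_prod_def cons_prod_def by auto
  then show "x \<in> cons_prod S (append_prod C D)" unfolding append_prod_def cons_prod_def by blast
next
  fix x assume "x \<in> cons_prod S (append_prod C D)"
  then obtain t y d where x: "x = (t # y) @ d" "t \<in> S" "y \<in> C" "d \<in> D"
    unfolding append_prod_def cons_prod_def by auto
  then have "t # y \<in> cons_prod S C" unfolding cons_prod_def by blast
  then show "x \<in> append_prod (cons_prod S C) D" using x unfolding append_prod_def by blast
qed

context fvec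
begin

lemma append_prod_vectors: "s \<le> n \<Longrightarrow> append_prod (vectors p s) (vectors p (n - s)) = vectors p n"
proof (intro equalityI subsetI)
  fix x assume s: "s \<le> n" and x: "x \<in> vectors p n"
  have "take s x \<in> vectors p s" "drop s x \<in> vectors p (n - s)"
    using x s by (auto simp: vectors_iff)
  then show "x \<in> append_prod (vectors p s) (vectors p (n - s))"
    unfolding append_prod_def by (metis (mono_tags, lifting) append_take_drop_id mem_Collect_eq)
qed (auto simp: append_prod_def Fvec_def)

lemma append_prod_Diff:
  assumes "X \<subseteq> vectors p s" "Y \<subseteq> vectors p s"
  shows "append_prod (X - Y) D = append_prod X D - append_prod Y D"
proof -
  have uniq: "x = x'" if "x @ d = x' @ d'" "x \<in> X" "x' \<in> Y" for x x' d d'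
  proof -
    have "length x = length x'" using that(2,3) assms vectors_length by blast
    then show ?thesis using that(1) by simp
  qed
  show ?thesis
  proof (intro equalityI subsetI)
    fix z assume "z \<in> append_prod (X - Y) D"
    then obtain x d where x: "z = x @ d" "x \<in> X" "x \<notin> Y" "d \<in> D" by (auto simp: append_prod_def)
    have "z \<notin> append_prod Y D"
    proof
      assume "z \<in> append_prod Y D"
      then obtain x' d' where "z = x' @ d'" "x' \<in> Y" by (auto simp: append_prod_def)
      then show False using uniq[of x d x' d'] x by simp
    qed
    then show "z \<in> append_prod X D - append_prod Y D" using x by (auto simp: append_prod_def)
  next
    fix z assume z: "z \<in> append_prod X D - append_prod Y D"
    then obtain x d where x: "z = x @ d" "x \<in> X" "d \<in> D" by (auto simp: append_prod_def)
    then have "x \<notin> Y" using z by (auto simp: append_prod_def)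
    then show "z \<in> append_prod (X - Y) D" using x by (auto simp: append_prod_def)
  qed
qed

text \<open>Triviality is one of the outcomes, so that the statement can be carried back along
  automorphisms as a whole; nontriviality excludes it only at the very end.\<close>

definition classified :: "nat \<Rightarrow> nat \<Rightarrow> int list set \<Rightarrow> bool" where
  "classified m n A \<longleftrightarrow>
    (\<exists>B. B \<subseteq> extremal_cuboid p m (Suc n) \<and> F_isomorphic p (Suc n) A B) \<or>
    normal_type p m (Suc n) A \<or> type5 p m (Suc n) A"

lemma classified_aut:
  assumes \<phi>: "aut (Suc n) \<phi>" and A: "A \<subseteq> vectors p (Suc n)" and cl: "classified m n (\<phi> ` A)"
  shows "classified m n A"
proof -
  have iso: "F_isomorphic p (Suc n) A C" if "F_isomorphic p (Suc n) (\<phi> ` A) C" for C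
    by (rule F_isomorphic_trans[OF F_isomorphicI[OF \<phi> refl] that])
  have card: "card (\<phi> ` A) = card A" by (rule aut_image(2)[OF \<phi> A])
  from cl consider "\<exists>B. B \<subseteq> extremal_cuboid p m (Suc n) \<and> F_isomorphic p (Suc n) (\<phi> ` A) B"
    | "type1 p m (Suc n) (\<phi> ` A)" | "type2 p m (Suc n) (\<phi> ` A)" | "type5 p m (Suc n) (\<phi> ` A)"
    unfolding classified_def normal_type_def by blast
  then show ?thesis
  proof cases
    case 1 then show ?thesis unfolding classified_def using iso by blast
  next
    case 2
    then have "type1 p m (Suc n) A" unfolding type1_def card using iso by blast
    then show ?thesis by (simp add: classified_def normal_type_def)
  next
    case 3
    then have "type2 p m (Suc n) A" unfolding type2_def card Let_def using iso by blast
    then show ?thesis by (simp add: classified_def normal_type_def)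
  next
    case 4
    then have "type5 p m (Suc n) A" unfolding type5_def card using iso by blast
    then show ?thesis by (simp add: classified_def)
  qed
qed

lemma F_isomorphic_refl: "F_isomorphic p n A A"
  by (rule F_isomorphicI[OF aut_id]) simp

lemma pos_cong: "[y = y'] (mod int p) \<Longrightarrow> pos y q = pos y' q"
  unfolding pos_def by (metis Cong.cong_def mod_add_left_eq)

lemma halve_cong:
  assumes "odd p" "[2 * x = 2 * y] (mod int p)" shows "[x = y] (mod int p)"
  using assms by (simp add: cong_mult_lcancel)

lemma twice_half:
  assumes "odd p" shows "[2 * ((k * modular_inverse (int p) 2) mod int p) = k] (mod int p)"
proof -
  have "[2 * modular_inverse (int p) 2 = 1] (mod int p)"
    using assms by (intro cong_modular_inverse1) simp
  then have "[k * (2 * modular_inverse (int p) 2) = k * 1] (mod int p)" by (intro cong_mult) auto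
  then show ?thesis by (simp add: Cong.cong_def mod_mult_right_eq mult.left_commute)
qed

section \<open>The individual positions\<close>

text \<open>Since \<open>- (3 * m + 1)\<close> and \<open>m + 2\<close> differ by \<open>p\<close>,
  the hypothesis says \<open>y = a0 + e\<close>: the support starts \<open>e\<close> places into the
  base arc of the cuboid, which has \<open>m + 1\<close> residues.\<close>

lemma trivial_case:
  assumes pl: "placed m n A y L" and pm: "p = 4 * m + 3" "m \<ge> 25"
    and y: "[2 * y = int m + 2 + 2 * e] (mod int p)" and e: "0 \<le> e" "e + L \<le> int m + 1"
  shows "classified m n A"
proof -
  have pi: "int p = 4 * int m + 3" using pm by simp
  have odd: "odd p" using pm by simp
  define a0 where "a0 = (- (3 * int m + 1) * modular_inverse (int p) 2) mod int p"
  have "[2 * a0 = - (3 * int m + 1)] (mod int p)" unfolding a0_def by (rule twice_half[OF odd])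
  then have "[2 * a0 + 2 * e = - (3 * int m + 1) + 2 * e] (mod int p)" by (intro cong_add) auto
  also have "[- (3 * int m + 1) + 2 * e = int m + 2 + 2 * e] (mod int p)"
    unfolding cong_iff_dvd_diff pi by (auto intro: dvdI[of _ _ "-1"])
  also have "[int m + 2 + 2 * e = 2 * y] (mod int p)" using y by (rule cong_sym)
  finally have "[2 * y = 2 * (a0 + e)] (mod int p)" by (simp add: distrib_left cong_sym_eq)
  then have y_eq: "[y = a0 + e] (mod int p)" by (rule halve_cong[OF odd])
  have "pos y q \<in> cyc_interval p a0 (a0 + int m)" if q: "q \<in> {0..<L}" for q
  proof -
    have "pos y q = pos a0 (e + q)" using pos_cong[OF y_eq] by (simp add: pos_def add.assoc)
    moreover have "cyc_interval p a0 (a0 + int m) = pos a0 ` {0..int m}"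
      using cyc_interval_pos[of "int m" 0 a0] pi by simp
    ultimately show ?thesis using q e by auto
  qed
  note pos_cyc = this
  have "A \<subseteq> cons_prod (cyc_interval p a0 (a0 + int m)) (vectors p n)"
  proof
    fix x assume x: "x \<in> A"
    then obtain i v where iv: "x = i # v" "v \<in> vectors p n" using sub_A[OF pl pm] by (auto simp: vectors_Suc)
    have "hd x \<in> pos y ` {0..<L}" using pl x unfolding placed_def by blast
    then have "i \<in> cyc_interval p a0 (a0 + int m)" using pos_cyc iv by auto
    then show "x \<in> cons_prod (cyc_interval p a0 (a0 + int m)) (vectors p n)"
      unfolding cons_prod_def using iv by blast
  qed
  then have "A \<subseteq> extremal_cuboid p m (Suc n)" unfolding extremal_cuboid_def Let_def a0_def diff_Suc_1 .
  then show ?thesis unfolding classified_def using F_isomorphic_refl by blast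
qed

lemma full_fibre:
  assumes pl: "placed m n A y L" and pm: "p = 4 * m + 3" "m \<ge> 25" and "wt A y q = p ^ n"
  shows "fib A (pos y q) = vectors p n"
  using assms(4) unfolding wt_def[OF pl pm]
  by (intro card_subset_eq[OF finite_vectors fib_sub[OF pl pm]]) (simp add: card_vectors)

text \<open>With only \<open>m\<close> places available every fibre is full, and the condition of
  type 1 on \<open>a\<close> reads \<open>2 a = m + 5\<close> modulo \<open>p\<close>.\<close>

lemma type1_case:
  assumes pl: "placed m n A y (int m)" and pm: "p = 4 * m + 3" "m \<ge> 25"
    and y: "[2 * y = int m + 5] (mod int p)"
  shows "classified m n A"
proof -
  have pi: "int p = 4 * int m + 3" using pm by simp
  have total: "m * p ^ n \<le> (\<Sum>q\<in>{0..<int m}. wt A y q)"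
    using pl card_A[OF pl pm] by (simp add: placed_def)
  have w: "wt A y q = p ^ n" if "q \<in> {0..<int m}" for q
    using weights_equality(1)[of "{0..<int m}" "wt A y" "p ^ n" "{}" 0] wt_le[OF pl pm] total that by simp
  have card: "card A = m * p ^ n" unfolding card_A[OF pl pm] using w by simp
  define a where "a = y mod int p"
  have ya: "[a = y] (mod int p)" by (simp add: a_def Cong.cong_def)
  have "cyc_interval p a (a + int m - 1) = cyc_interval p (y + 0) (y + (int m - 1))"
    using cong_add[OF ya, of "int m - 1" "int m - 1"] by (intro cyc_interval_cong) (simp_all add: ya algebra_simps)
  also have "\<dots> = pos y ` {0..int m - 1}" using pi pm(2) by (intro cyc_interval_pos) auto
  also have "{0..int m - 1} = {0..<int m}" by auto
  finally have cyc: "cyc_interval p a (a + int m - 1) = pos y ` {0..<int m}" .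
  have "(\<Union>q\<in>{0..<int m}. cons_prod {pos y q} (fib A (pos y q))) = (\<Union>q\<in>{0..<int m}. cons_prod {pos y q} (vectors p n))"
    by (rule SUP_cong[OF refl]) (simp add: full_fibre[OF pl pm w])
  then have "A = (\<Union>q\<in>{0..<int m}. cons_prod {pos y q} (vectors p n))"
    by (rule trans[OF A_eq[OF pl pm]])
  then have "A = cons_prod (cyc_interval p a (a + int m - 1)) (vectors p n)"
    unfolding cyc UN_cons_prod .
  then have "F_isomorphic p (Suc n) A (cons_prod (cyc_interval p a (a + int m - 1)) (vectors p n))"
    using F_isomorphic_refl by metis
  moreover have "[a - 3 * (a + int m - 1) = 1] (mod int p)"
  proof -
    have "[2 * a = int m + 5] (mod int p)" by (rule cong_trans[OF cong_mult[OF cong_refl ya] y])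
    then show ?thesis by (rule cong_combination[where k = "-1" and l = "-1"]) (simp add: pi)
  qed
  moreover have "a \<in> carrier (F p)" using p_pos by (simp add: carrier_F a_def)
  ultimately have "type1 p m (Suc n) A" unfolding type1_def using card by auto
  then show ?thesis by (simp add: classified_def normal_type_def)
qed

lemma type2_case_centred:
  assumes pl: "placed m n A y (int m + 1)" and pm: "p = 4 * m + 3" "m \<ge> 25"
    and y: "[2 * y = int m + 3] (mod int p)" and zero: "replicate n 0 \<in> fib A (pos y (int m))"
  shows "classified m n A"
proof -
  have pi: "int p = 4 * int m + 3" using pm by simp
  have odd: "odd p" using pm by simp
  \<comment> \<open>Here \<open>2 y + 3 m\<close> equals \<open>p\<close>: three summands from the
    last fibre land over the first. As \<open>pair\<close> must hold with equality, these two fibres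
    are complementary and the last one is a subspace.\<close>
  have c: "[0 = 2 * y + int m + int m + int m] (mod int p)"
    by (rule cong_combination[OF y, where k = "-1" and l = "-1"]) (simp add: pi)
  have pair: "wt A y 0 + wt A y (int m) \<le> p ^ n" by (rule wt_pair[OF pl pm c]) auto
  have sets: "{0..<int m + 1} = {1..int m - 1} \<union> {0, int m}" using pm by auto
  have total: "(card {1..int m - 1} + 1) * p ^ n \<le> (\<Sum>q\<in>{1..int m - 1} \<union> {0, int m}. wt A y q)"
    using pl card_A[OF pl pm] pm(2) unfolding sets by (simp add: placed_def nat_diff_distrib)
  have U: "(\<Sum>q\<in>{0, int m}. wt A y q) \<le> 1 * p ^ n" using pair pm by simp
  note eq = weights_equality[of "{1..int m - 1}" "wt A y" "p ^ n" "{0, int m}" 1, OF wt_le[OF pl pm] _ _ _ total U]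
  have w: "wt A y q = p ^ n" if "q \<in> {1..int m - 1}" for q using eq(1) that by simp
  have ends: "wt A y 0 + wt A y (int m) = p ^ n" using eq(2) pm by simp
  have "card A = (\<Sum>q\<in>{1..int m - 1}. wt A y q) + (\<Sum>q\<in>{0, int m}. wt A y q)"
    unfolding card_A[OF pl pm] sets by (rule sum.union_disjoint) auto
  also have "\<dots> = m * p ^ n" using w ends pm by (simp add: nat_diff_distrib algebra_simps)
  finally have card: "card A = m * p ^ n" .
  define V where "V = fib A (pos y (int m))"
  have comp: "additive n V \<and> fib A (pos y 0) = vectors p n - V"
    using additive_of_complement[of V n "fib A (pos y 0)"] zero ends fib_sub[OF pl pm] fib_triple[OF pl pm c]
    unfolding V_def wt_def[OF pl pm] by (simp add: add.commute)
  have ne: "fib A (pos y 0) \<noteq> {}" "V \<noteq> {}" using pl by (auto simp: placed_def V_def)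
  \<comment> \<open>For \<open>n = 0\<close> a fibre is a single point, and two inhabited end fibres
    would have total size 2 instead of 1.\<close>
  have n: "n \<ge> 1"
  proof (rule ccontr)
    assume "\<not> n \<ge> 1"
    then have "wt A y 0 + wt A y (int m) = 1" using ends by simp
    then show False using ne wt_pos[OF pl pm] by (auto simp: V_def)
  qed
  define a where "a = (3 * int m * modular_inverse (int p) (1 - 3)) mod int p"
  have ya: "[a = y] (mod int p)"
  proof -
    have "[(1 - 3) * modular_inverse (int p) (1 - 3) = 1] (mod int p)"
      using odd by (intro cong_modular_inverse1) simp
    then have "[3 * int m * ((1 - 3) * modular_inverse (int p) (1 - 3)) = 3 * int m * 1] (mod int p)"
      by (rule cong_mult[OF cong_refl])
    moreover have "[(1 - 3) * a = (1 - 3) * (3 * int m * modular_inverse (int p) (1 - 3))] (mod int p)"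
      unfolding a_def by (rule cong_mult[OF cong_refl]) (simp only: Cong.cong_def mod_mod_trivial)
    moreover have "(1 - 3) * (3 * int m * modular_inverse (int p) (1 - 3)) = 3 * int m * ((1 - 3) * modular_inverse (int p) (1 - 3))"
      by (rule mult.left_commute)
    ultimately have "[(1 - 3) * a = 3 * int m * 1] (mod int p)" by (metis cong_trans)
    then have "int p dvd (1 - 3) * a - 3 * int m * 1" by (simp only: cong_iff_dvd_diff)
    moreover have "int p dvd 2 * y - (int m + 3)" using y by (simp only: cong_iff_dvd_diff)
    ultimately have "int p dvd - (((1 - 3) * a - 3 * int m * 1) + (2 * y - (int m + 3)) + int p)"
      by (simp only: dvd_minus_iff) (intro dvd_add dvd_refl)
    moreover have "- (((1 - 3) * a - 3 * int m * 1) + (2 * y - (int m + 3)) + int p) = 2 * a - 2 * y"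
      unfolding pi by simp
    ultimately have "[2 * a = 2 * y] (mod int p)" by (simp only: cong_iff_dvd_diff)
    then show ?thesis by (rule halve_cong[OF odd])
  qed
  have a_pos: "a = pos y 0"
    using ya p_pos by (simp add: pos_def Cong.cong_def a_def)
  have am_pos: "(a + int m) mod int p = pos y (int m)"
    using pos_cong[OF ya] by (simp add: pos_def)
  have cyc: "cyc_interval p (a + 1) (a + int m - 1) = pos y ` {1..int m - 1}"
  proof -
    have "cyc_interval p (a + 1) (a + int m - 1) = cyc_interval p (a + 1) (a + (int m - 1))"
      by (simp add: algebra_simps)
    also have "\<dots> = pos a ` {1..int m - 1}" using pi pm(2) by (intro cyc_interval_pos) auto
    also have "\<dots> = pos y ` {1..int m - 1}" using pos_cong[OF ya] by simp
    finally show ?thesis .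
  qed
  have mid: "(\<Union>q\<in>{1..int m - 1}. cons_prod {pos y q} (fib A (pos y q)))
      = (\<Union>q\<in>{1..int m - 1}. cons_prod {pos y q} (vectors p n))"
    by (rule SUP_cong[OF refl]) (simp add: full_fibre[OF pl pm w])
  have "A = cons_prod {pos y 0} (fib A (pos y 0)) \<union> (\<Union>q\<in>{1..int m - 1}. cons_prod {pos y q} (fib A (pos y q)))
      \<union> cons_prod {pos y (int m)} (fib A (pos y (int m)))"
    by (rule trans[OF A_eq[OF pl pm]]) (simp only: sets UN_Un UN_insert UN_empty Un_empty_right Un_empty_left Un_ac)
  then have "A = cons_prod {pos y 0} (vectors p n - V) \<union> (\<Union>q\<in>{1..int m - 1}. cons_prod {pos y q} (vectors p n))
      \<union> cons_prod {pos y (int m)} V"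
    unfolding mid conjunct2[OF comp] V_def[symmetric] .
  then have A: "A = cons_prod {a} (vectors p n - V) \<union> cons_prod (cyc_interval p (a + 1) (a + int m - 1)) (vectors p n)
      \<union> cons_prod {(a + int m) mod int p} V"
    unfolding UN_cons_prod cyc am_pos a_pos[symmetric] .
  have "V \<noteq> vectors p n" using ne comp by auto
  moreover have "submodule V (F p) (Fvec p n)" using additive_submodule comp by blast
  moreover have "F_isomorphic p (Suc n) A (cons_prod {a} (vectors p n - V) \<union>
      cons_prod (cyc_interval p (a + 1) (a + int m - 1)) (vectors p n) \<union> cons_prod {(a + int m) mod int p} V)"
    using F_isomorphic_refl A by metis
  ultimately have "type2 p m (Suc n) A"
    unfolding type2_def Let_def a_def[symmetric] using card n by auto
  then show ?thesis by (simp add: classified_def normal_type_def)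
qed

lemma not_dvd_of_twice:
  assumes "[2 * y + 2 * q = c] (mod int p)" "0 < c" "c < int p"
  shows "\<not> int p dvd y + q"
proof
  assume "int p dvd y + q"
  then have "int p dvd 2 * (y + q)" by (rule dvd_mult)
  then have "int p dvd c" using assms(1) by (simp add: distrib_left cong_dvd_iff)
  then show False using assms zdvd_not_zless by blast
qed

text \<open>Twice \<open>y + m\<close> is \<open>3 m + 3\<close>, which is nonzero modulo
  \<open>p\<close>, so the last fibre can be sheared to contain the origin.\<close>

lemma type2_case:
  assumes pl: "placed m n A y (int m + 1)" and pm: "p = 4 * m + 3" "m \<ge> 25"
    and y: "[2 * y = int m + 3] (mod int p)"
  shows "classified m n A"
proof -
  have "[2 * y + 2 * int m = int m + 3 + 2 * int m] (mod int p)" using y by (intro cong_add) auto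
  then have nd: "\<not> int p dvd y + int m" by (rule not_dvd_of_twice) (use pm in auto)
  have "fib A (pos y (int m)) \<noteq> {}" using pl by (simp add: placed_def)
  then obtain \<phi> where \<phi>: "aut (Suc n) \<phi>" "placed m n (\<phi> ` A) y (int m + 1)"
      "replicate n 0 \<in> fib (\<phi> ` A) (pos y (int m))"
    using placed_translate[OF pl nd] by blast
  show ?thesis
    by (rule classified_aut[OF \<phi>(1) sub_A[OF pl pm] type2_case_centred[OF \<phi>(2) pm y \<phi>(3)]])
qed

lemma fib_lift_aut:
  assumes A: "A \<subseteq> vectors p (Suc n)" shows "fib (lift_aut \<theta> ` A) i = \<theta> ` fib A i"
proof (intro equalityI subsetI)
  fix w assume "w \<in> fib (lift_aut \<theta> ` A) i"
  then obtain x where x: "x \<in> A" "i # w = lift_aut \<theta> x" by (auto simp: fib_def)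
  then obtain j v where "x = j # v" using A by (auto simp: vectors_Suc)
  then show "w \<in> \<theta> ` fib A i" using x by (auto simp: fib_def)
next
  fix w assume "w \<in> \<theta> ` fib A i"
  then obtain v where "i # v \<in> A" "w = \<theta> v" by (auto simp: fib_def)
  then have "i # w = lift_aut \<theta> (i # v)" "i # v \<in> A" by simp_all
  then show "w \<in> fib (lift_aut \<theta> ` A) i" unfolding fib_def by blast
qed

text \<open>Periods in the last \<open>n - s\<close> coordinates allow the tail of a member to be
  replaced by zeros and by any other tail, so only the heads matter.\<close>

lemma periodic_set_product:
  assumes s: "s \<le> n" and Q: "Q \<subseteq> vectors p n"
    and per: "\<And>h q. h \<in> vectors p (n - s) \<Longrightarrow> q \<in> Q \<Longrightarrow> vadd p (replicate s 0 @ h) q \<in> Q"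
  shows "Q = append_prod {x \<in> vectors p s. x @ replicate (n - s) 0 \<in> Q} (vectors p (n - s))"
proof (intro equalityI subsetI)
  have sh: "vadd p (replicate s 0 @ h) (x @ g) = x @ vadd p h g" if "x \<in> vectors p s" for x h g
    using that vadd_zero[OF that] by (simp add: vadd_append vectors_length)
  {
    fix z assume z: "z \<in> Q"
    then have "z \<in> append_prod (vectors p s) (vectors p (n - s))"
      using Q append_prod_vectors[OF s] by blast
    then obtain x g where xg: "x \<in> vectors p s" "g \<in> vectors p (n - s)" "z = x @ g"
      by (auto simp: append_prod_def)
    have "vadd p (replicate s 0 @ vscale p (-1) g) (x @ g) \<in> Q"
      using per[OF vscale_closed[OF xg(2)] z] xg(3) by simp
    then have "x @ replicate (n - s) 0 \<in> Q" using sh[OF xg(1)] vadd_neg[OF xg(2)] by simp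
    then show "z \<in> append_prod {x \<in> vectors p s. x @ replicate (n - s) 0 \<in> Q} (vectors p (n - s))"
      using xg by (auto simp: append_prod_def)
  }
  fix z assume "z \<in> append_prod {x \<in> vectors p s. x @ replicate (n - s) 0 \<in> Q} (vectors p (n - s))"
  then obtain x g where xg: "x \<in> vectors p s" "x @ replicate (n - s) 0 \<in> Q" "g \<in> vectors p (n - s)" "z = x @ g"
    by (auto simp: append_prod_def)
  have "vadd p (replicate s 0 @ g) (x @ replicate (n - s) 0) \<in> Q" using per xg by blast
  moreover have "vadd p g (replicate (n - s) 0) = g" using vadd_zero[OF xg(3)] vadd_comm by metis
  ultimately show "z \<in> Q" using sh[OF xg(1)] xg(4) by simp
qed

text \<open>With \<open>2 y = m\<close> three relations are tight. Offsets 0, 0, 0 lead to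
  \<open>m\<close>: the first fibre \<open>H\<close> is a subspace and the fibre at \<open>m\<close>
  its complement. Offsets 0, 0, 1 lead to \<open>m + 1\<close>: the fibre at 1 and the last fibre
  \<open>P'\<close> are complementary and invariant under \<open>H\<close>. Three times
  \<open>m + 1\<close> leads to 0: the threefold sumset of \<open>P'\<close> misses
  \<open>H\<close>. Dividing by \<open>H\<close> leaves the set \<open>P\<close> of type 5.\<close>

lemma type5_case_centred:
  assumes pl: "placed m n A y (int m + 2)" and pm: "p = 4 * m + 3" "m \<ge> 25"
    and y: "[2 * y = int m] (mod int p)" and zero: "replicate n 0 \<in> fib A (pos y 0)"
  shows "classified m n A"
proof -
  have pi: "int p = 4 * int m + 3" using pm by simp
  have odd: "odd p" using pm by simp
  note fsub = fib_sub[OF pl pm]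
  have c0: "[int m = 2 * y + 0 + 0 + 0] (mod int p)" using y by (simp add: cong_sym_eq)
  have c1: "[int m + 1 = 2 * y + 0 + 0 + 1] (mod int p)"
    using y by (simp add: cong_sym_eq cong_add_rcancel)
  have c2: "[0 = 2 * y + (int m + 1) + (int m + 1) + (int m + 1)] (mod int p)"
    by (rule cong_combination[OF y, where k = "-1" and l = "-1"]) (simp add: pi)
  have pair0: "wt A y (int m) + wt A y 0 \<le> p ^ n" by (rule wt_pair[OF pl pm c0]) auto
  have pair1: "wt A y (int m + 1) + wt A y 1 \<le> p ^ n" by (rule wt_pair[OF pl pm c1]) auto
  let ?U = "{0, 1, int m, int m + 1}"
  have sets: "{0..<int m + 2} = {2..int m - 1} \<union> ?U" using pm by auto
  have card_mid: "card {2..int m - 1} + 2 = m" using pm(2) by simp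
  have total: "(card {2..int m - 1} + 2) * p ^ n \<le> (\<Sum>q\<in>{2..int m - 1} \<union> ?U. wt A y q)"
    unfolding card_mid sets[symmetric] card_A[OF pl pm, symmetric] using pl by (simp add: placed_def)
  have sumU: "(\<Sum>q\<in>?U. wt A y q) = (wt A y (int m) + wt A y 0) + (wt A y (int m + 1) + wt A y 1)"
    using pm by simp
  have U: "(\<Sum>q\<in>?U. wt A y q) \<le> 2 * p ^ n" unfolding sumU using pair0 pair1 by linarith
  note eq = weights_equality[of "{2..int m - 1}" "wt A y" "p ^ n" ?U 2, OF wt_le[OF pl pm] _ _ _ total U]
  have w: "wt A y q = p ^ n" if "q \<in> {2..int m - 1}" for q using eq(1) that by simp
  have "(wt A y (int m) + wt A y 0) + (wt A y (int m + 1) + wt A y 1) = 2 * p ^ n"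
    using eq(2) unfolding sumU by simp
  then have w0: "wt A y (int m) + wt A y 0 = p ^ n" and w1: "wt A y (int m + 1) + wt A y 1 = p ^ n"
    using pair0 pair1 by linarith+
  have "card A = (\<Sum>q\<in>{2..int m - 1}. wt A y q) + (\<Sum>q\<in>?U. wt A y q)"
    unfolding card_A[OF pl pm] sets by (rule sum.union_disjoint) auto
  also have "\<dots> = card {2..int m - 1} * p ^ n + 2 * p ^ n" unfolding sumU w0 w1 using w by simp
  also have "\<dots> = m * p ^ n" unfolding distrib_right[symmetric] card_mid ..
  finally have card: "card A = m * p ^ n" .
  define H where "H = fib A (pos y 0)"
  define A1 where "A1 = fib A (pos y 1)"
  define P' where "P' = fib A (pos y (int m + 1))"
  have compH: "additive n H \<and> fib A (pos y (int m)) = vectors p n - H"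
    using additive_of_complement[of H n "fib A (pos y (int m))"] zero w0 fsub fib_triple[OF pl pm c0]
    unfolding H_def wt_def[OF pl pm] by (simp add: add.commute)
  then have H: "additive n H" "H \<subseteq> vectors p n" "replicate n 0 \<in> H" by (auto simp: additive_def)
  have subA1: "A1 \<subseteq> vectors p n" and subP': "P' \<subseteq> vectors p n" unfolding A1_def P'_def by (rule fsub)+
  have HA1: "vadd p h v \<notin> P'" if hv: "h \<in> H" "v \<in> A1" for h v
  proof -
    have "vadd p (vadd p (replicate n 0) h) v \<notin> P'"
      using fib_triple[OF pl pm c1] zero hv unfolding H_def A1_def P'_def by blast
    moreover have "h \<in> vectors p n" using hv H by blast
    ultimately show ?thesis using vadd_zero[of h n] by simp
  qed
  have disjP: "A1 \<inter> P' = {}"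
    using HA1[OF H(3)] vadd_zero subA1 by fastforce
  have unP: "A1 \<union> P' = vectors p n"
  proof (rule card_subset_eq)
    have "card (A1 \<union> P') = card A1 + card P'"
      using disjP finite_subset[OF subA1] finite_subset[OF subP'] by (intro card_Un_disjoint) auto
    then show "card (A1 \<union> P') = card (vectors p n)"
      using w1 unfolding wt_def[OF pl pm] A1_def P'_def by (simp add: card_vectors)
  qed (use subA1 subP' in auto)
  have perA1: "vadd p h v \<in> A1" if hv: "h \<in> H" "v \<in> A1" for h v
    using HA1[OF hv] unP vadd_closed[of h n v] hv H(2) subA1 by blast
  have perP': "vadd p h v \<in> P'" if hv: "h \<in> H" "v \<in> P'" for h v
  proof (rule ccontr)
    assume "vadd p h v \<notin> P'"
    have V: "h \<in> vectors p n" "v \<in> vectors p n" using hv H subP' by auto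
    then have "vadd p h v \<in> A1" using unP vadd_closed[OF V] \<open>vadd p h v \<notin> P'\<close> by blast
    then have "vadd p (vscale p (-1) h) (vadd p h v) \<in> A1"
      by (rule perA1[OF additive_vscale[OF H(1) hv(1)]])
    then have "v \<in> A1" using vadd_neg[OF V(1)] vadd_zero[OF V(2)] by (simp add: vadd_assoc[symmetric])
    then show False using disjP hv by blast
  qed
  have tripleP': "vadd p (vadd p u v) w \<notin> H" if "u \<in> P'" "v \<in> P'" "w \<in> P'" for u v w
    using fib_triple[OF pl pm c2] that unfolding H_def P'_def by blast
  have "P' \<noteq> {}" using pl by (simp add: placed_def P'_def add.commute)
  \<comment> \<open>In coordinates adapted to \<open>H\<close> all five kinds of fibre become
    products with the last \<open>n - s\<close> coordinates, and the first \<open>s\<close>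
    coordinates represent the quotient by \<open>H\<close>.\<close>
  obtain \<theta> s where \<theta>: "aut n \<theta>" "s \<le> n" "\<theta> ` H = (\<lambda>v. replicate s 0 @ v) ` vectors p (n - s)"
    using subspace_normal_form[OF H(1)] by blast
  have \<theta>inj: "inj_on \<theta> (vectors p n)" and \<theta>im: "\<theta> ` vectors p n = vectors p n"
    using \<theta>(1) by (auto simp: aut_def bij_betw_def)
  have \<theta>add: "\<theta> (vadd p u v) = vadd p (\<theta> u) (\<theta> v)" if "u \<in> vectors p n" "v \<in> vectors p n" for u v
    using \<theta>(1) that by (simp add: aut_def)
  have \<theta>diff: "\<theta> ` (vectors p n - C) = vectors p n - \<theta> ` C" if "C \<subseteq> vectors p n" for C
    using inj_on_image_set_diff[OF \<theta>inj _ that, of "vectors p n"] \<theta>im by simp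
  define P where "P = {x \<in> vectors p s. x @ replicate (n - s) 0 \<in> \<theta> ` P'}"
  have Psub: "P \<subseteq> vectors p s" by (auto simp: P_def)
  let ?D = "vectors p (n - s)"
  have \<theta>P': "\<theta> ` P' = append_prod P ?D"
    unfolding P_def
  proof (rule periodic_set_product[OF \<theta>(2)])
    show "\<theta> ` P' \<subseteq> vectors p n" using \<theta>im subP' by blast
    fix g q assume g: "g \<in> ?D" and q: "q \<in> \<theta> ` P'"
    obtain h where h: "h \<in> H" "replicate s 0 @ g = \<theta> h" using g \<theta>(3) by (metis imageE imageI)
    obtain v where v: "v \<in> P'" "q = \<theta> v" using q by blast
    have "vadd p (replicate s 0 @ g) q = \<theta> (vadd p h v)"
      using h v H subP' by (simp add: \<theta>add subset_eq)
    then show "vadd p (replicate s 0 @ g) q \<in> \<theta> ` P'" using perP'[OF h(1) v(1)] by simp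
  qed
  have \<theta>H: "\<theta> ` H = append_prod {replicate s 0} ?D"
    unfolding \<theta>(3) by (auto simp: append_prod_def)
  have Pne: "P \<noteq> {}" using \<theta>P' \<open>P' \<noteq> {}\<close> by (auto simp: append_prod_def)
  \<comment> \<open>A vanishing sum of three elements of \<open>P\<close> would lift to a sum of
    three elements of \<open>P'\<close> lying in \<open>H\<close>.\<close>
  have P3: "\<zero>\<^bsub>Fvec p s\<^esub> \<notin> hfold_sumset (Fvec p s) 3 P"
  proof
    assume "\<zero>\<^bsub>Fvec p s\<^esub> \<in> hfold_sumset (Fvec p s) 3 P"
    then obtain a b c where abc: "a \<in> P" "b \<in> P" "c \<in> P" "replicate s 0 = vadd p (vadd p a b) c"
      unfolding hfold_sumset_3[OF Psub] zero_Fvec by blast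
    let ?z = "replicate (n - s) 0 :: int list"
    have zz: "vadd p ?z ?z = ?z" by (rule vadd_zero[OF zero_closed])
    have "a @ ?z \<in> \<theta> ` P'" "b @ ?z \<in> \<theta> ` P'" "c @ ?z \<in> \<theta> ` P'"
      using abc(1-3) unfolding P_def by blast+
    then obtain u v w where uvw: "u \<in> P'" "v \<in> P'" "w \<in> P'" "\<theta> u = a @ ?z" "\<theta> v = b @ ?z" "\<theta> w = c @ ?z"
      by (elim imageE) metis
    have V: "u \<in> vectors p n" "v \<in> vectors p n" "w \<in> vectors p n" using uvw subP' by auto
    have len: "length a = s" "length b = s" "length c = s" using abc Psub vectors_length by blast+
    have "\<theta> (vadd p (vadd p u v) w) = vadd p (vadd p (a @ ?z) (b @ ?z)) (c @ ?z)"
      using V uvw by (simp add: \<theta>add vadd_closed)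
    also have "\<dots> = replicate s 0 @ ?z" using abc(4) len by (simp add: vadd_append zz)
    also have "\<dots> \<in> \<theta> ` H" unfolding \<theta>(3) using zero_closed by blast
    finally have "\<theta> (vadd p (vadd p u v) w) \<in> \<theta> ` H" .
    then have "vadd p (vadd p u v) w \<in> H"
      using inj_on_image_mem_iff[OF \<theta>inj _ H(2)] V by (simp add: vadd_closed)
    then show False using tripleP' uvw by blast
  qed
  \<comment> \<open>\<open>2 a = m + 2 = 2 y + 2\<close>, so \<open>a\<close> is the residue at
    offset 1, one step after the fibre \<open>H\<close>.\<close>
  define a where "a = ((int m + 2) * modular_inverse (int p) 2) mod int p"
  have ya: "[a = y + 1] (mod int p)"
  proof -
    have "[2 * a = int m + 2] (mod int p)" unfolding a_def by (rule twice_half[OF odd])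
    also have "[int m + 2 = 2 * y + 2] (mod int p)" using y by (intro cong_add) (auto simp: cong_sym_eq)
    finally have "[2 * a = 2 * (y + 1)] (mod int p)" by simp
    then show ?thesis by (rule halve_cong[OF odd])
  qed
  have a_shift: "(a + q) mod int p = pos y (q + 1)" for q
    using pos_cong[OF ya, of q] by (simp add: pos_def algebra_simps)
  have a_pos: "a = pos y 1" using a_shift[of 0] p_pos by (simp add: a_def)
  have e0: "(a - 1) mod int p = pos y 0" using a_shift[of "-1"] by simp
  have em: "(a + int m - 1) mod int p = pos y (int m)" using a_shift[of "int m - 1"] by (simp add: algebra_simps)
  have em1: "(a + int m) mod int p = pos y (int m + 1)" using a_shift[of "int m"] by simp
  have cyc: "cyc_interval p (a + 1) (a + int m - 2) = pos y ` {2..int m - 1}"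
  proof -
    have "cyc_interval p (a + 1) (a + int m - 2) = cyc_interval p (a + 1) (a + (int m - 2))"
      by (simp add: algebra_simps)
    also have "\<dots> = cyc_interval p (y + 2) (y + (int m - 1))"
      using cong_add[OF ya, of 1 1] cong_add[OF ya, of "int m - 2" "int m - 2"]
      by (intro cyc_interval_cong) (simp_all add: algebra_simps)
    also have "\<dots> = pos y ` {2..int m - 1}" using pi pm(2) by (intro cyc_interval_pos) auto
    finally show ?thesis .
  qed
  define A' where "A' = lift_aut \<theta> ` A"
  have pl': "placed m n A' y (int m + 2)"
    unfolding A'_def by (rule placed_aut[OF pl aut_lift[OF \<theta>(1)]]) (simp add: lift_aut_def)
  have fib': "fib A' i = \<theta> ` fib A i" for i
    unfolding A'_def by (rule fib_lift_aut[OF sub_A[OF pl pm]])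
  have Vn: "vectors p n = append_prod (vectors p s) ?D" using append_prod_vectors[OF \<theta>(2)] by simp
  have f0: "fib A' (pos y 0) = append_prod {replicate s 0} ?D"
    unfolding fib' H_def[symmetric] by (rule \<theta>H)
  have f1: "fib A' (pos y 1) = append_prod (vectors p s - P) ?D"
  proof -
    have "A1 = vectors p n - P'" using unP disjP by blast
    then show ?thesis unfolding fib' A1_def[symmetric]
      using \<theta>diff[OF subP'] \<theta>P' Vn append_prod_Diff[OF order_refl Psub] by simp
  qed
  have fm: "fib A' (pos y (int m)) = append_prod (vectors p s - {replicate s 0}) ?D"
    unfolding fib' using compH \<theta>diff[OF H(2)] \<theta>H Vn
      append_prod_Diff[OF order_refl, of "{replicate s 0}" s ?D] zero_closed by simp
  have fm1: "fib A' (pos y (int m + 1)) = append_prod P ?D"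
    unfolding fib' P'_def[symmetric] by (rule \<theta>P')
  have fq: "fib A' (pos y q) = append_prod (vectors p s) ?D" if "q \<in> {2..int m - 1}" for q
    unfolding fib' using full_fibre[OF pl pm w[OF that]] \<theta>im Vn by simp
  have "A' = cons_prod {pos y 0} (fib A' (pos y 0)) \<union> cons_prod {pos y 1} (fib A' (pos y 1))
      \<union> (\<Union>q\<in>{2..int m - 1}. cons_prod {pos y q} (fib A' (pos y q)))
      \<union> cons_prod {pos y (int m)} (fib A' (pos y (int m))) \<union> cons_prod {pos y (int m + 1)} (fib A' (pos y (int m + 1)))"
    by (rule trans[OF A_eq[OF pl' pm]]) (simp only: sets UN_Un UN_insert UN_empty Un_empty_right Un_empty_left Un_ac)
  also have "(\<Union>q\<in>{2..int m - 1}. cons_prod {pos y q} (fib A' (pos y q)))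
      = (\<Union>q\<in>{2..int m - 1}. cons_prod {pos y q} (append_prod (vectors p s) ?D))"
    by (rule SUP_cong[OF refl]) (simp add: fq)
  finally have "A' = append_prod (type5_base p m s P) ?D"
    unfolding f0 f1 fm fm1 UN_cons_prod type5_base_def Let_def a_def[symmetric]
    by (simp only: append_prod_Un append_prod_cons_prod cyc e0 em em1 zero_Fvec a_pos[symmetric])
  then have "F_isomorphic p (Suc n) A (append_prod (type5_base p m s P) (vectors p (Suc n - 1 - s)))"
    using F_isomorphicI[OF aut_lift[OF \<theta>(1)] A'_def[symmetric]] by simp
  then have "type5 p m (Suc n) A"
    unfolding type5_def using card \<theta>(2) Pne Psub P3 by auto
  then show ?thesis by (simp add: classified_def)
qed

lemma type5_case:
  assumes pl: "placed m n A y (int m + 2)" and pm: "p = 4 * m + 3" "m \<ge> 25"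
    and y: "[2 * y = int m] (mod int p)"
  shows "classified m n A"
proof -
  have nd: "\<not> int p dvd y + 0" by (rule not_dvd_of_twice[of _ _ "int m"]) (use y pm in auto)
  have "fib A (pos y 0) \<noteq> {}" using pl by (simp add: placed_def)
  then obtain \<phi> where \<phi>: "aut (Suc n) \<phi>" "placed m n (\<phi> ` A) y (int m + 2)"
      "replicate n 0 \<in> fib (\<phi> ` A) (pos y 0)"
    using placed_translate[OF pl nd] by blast
  show ?thesis
    by (rule classified_aut[OF \<phi>(1) sub_A[OF pl pm] type5_case_centred[OF \<phi>(2) pm y \<phi>(3)]])
qed

lemma direct_cases:
  assumes pl: "placed m n A y L" and pm: "p = 4 * m + 3" "m \<ge> 25" and y: "[2 * y = t] (mod int p)"
    and cases: "L = int m \<and> t \<in> {int m + 2, int m + 4, int m + 5} \<or>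
      L = int m + 1 \<and> t \<in> {int m + 2, int m + 3} \<or> L = int m + 2 \<and> t = int m"
  shows "classified m n A"
proof -
  consider "L \<le> int m + 1" "t = int m + 2 + 2 * 0" | "L = int m" "t = int m + 2 + 2 * 1" | "L = int m" "t = int m + 5"
    | "L = int m + 1" "t = int m + 3" | "L = int m + 2" "t = int m" using cases by auto
  then show ?thesis
  proof cases
    case 1 then show ?thesis using trivial_case[OF pl pm, of 0] y by simp
  next
    case 2 then show ?thesis using trivial_case[OF pl pm, of 1] y by simp
  next
    case 3 then show ?thesis using type1_case[OF _ pm] pl y by simp
  next
    case 4 then show ?thesis using type2_case[OF _ pm] pl y by simp
  next
    case 5 then show ?thesis using type5_case[OF _ pm] pl y by simp
  qed
qed

text \<open>\<open>position\<close> leaves \<open>L\<close> in {m, m + 1, m + 2} with six, four and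
  two values of \<open>t\<close>. Negation replaces \<open>t\<close> by
  \<open>p - t - 2 * (L - 1)\<close>, pairing values with sum 2m + 5, 2m + 3 and 2m + 1
  respectively; \<open>direct_cases\<close> treats one member of each pair.\<close>

lemma classify_placed:
  assumes pl: "placed m n A y L" and pm: "p = 4 * m + 3" "m \<ge> 25"
  shows "classified m n A"
proof -
  have pi: "int p = 4 * int m + 3" using pm by simp
  define t where "t = (2 * y) mod int p"
  note pos = position[OF pl pm, folded t_def]
  have ct: "[2 * y = t] (mod int p)" by (simp add: t_def Cong.cong_def)
  let ?y = "- (y + (L - 1))" and ?t = "int p - t - 2 * (L - 1)"
  have ct': "[2 * ?y = ?t] (mod int p)"
  proof -
    have "int p dvd - (2 * y - t) - int p" using ct by (intro dvd_diff) (simp_all add: cong_iff_dvd_diff dvd_diff_commute)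
    moreover have "- (2 * y - t) - int p = 2 * ?y - ?t" by simp
    ultimately show ?thesis by (simp only: cong_iff_dvd_diff)
  qed
  have neg: "aut (Suc n) (vscale p (-1))" by (rule aut_scale) simp
  consider "L = int m" "t \<in> {int m + 2, int m + 4, int m + 5}" | "L = int m" "?t \<in> {int m + 2, int m + 4, int m + 5}"
    | "L = int m + 1" "t \<in> {int m + 2, int m + 3}" | "L = int m + 1" "?t \<in> {int m + 2, int m + 3}"
    | "L = int m + 2" "t = int m" | "L = int m + 2" "?t = int m"
  proof -
    have "L = int m \<or> L = int m + 1 \<or> L = int m + 2" using pos by presburger
    moreover have "t \<in> {int m + 2, int m + 4, int m + 5} \<or> ?t \<in> {int m + 2, int m + 4, int m + 5}" if "L = int m"
    proof -
      have "t = int m \<or> t = int m + 1 \<or> t = int m + 2 \<or> t = int m + 3 \<or> t = int m + 4 \<or> t = int m + 5"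
        using pos that by presburger
      then show ?thesis using that pi by auto
    qed
    moreover have "t \<in> {int m + 2, int m + 3} \<or> ?t \<in> {int m + 2, int m + 3}" if "L = int m + 1"
    proof -
      have "t = int m \<or> t = int m + 1 \<or> t = int m + 2 \<or> t = int m + 3"
        using pos that by presburger
      then show ?thesis using that pi by auto
    qed
    moreover have "t = int m \<or> ?t = int m" if "L = int m + 2"
    proof -
      have "t = int m \<or> t = int m + 1" using pos that by presburger
      then show ?thesis using that pi by auto
    qed
    ultimately show ?thesis using that by blast
  qed
  then have "classified m n A \<or> classified m n (vscale p (-1) ` A)"
    using direct_cases[OF pl pm ct] direct_cases[OF placed_negate[OF pl] pm ct'] by cases blast+
  then show ?thesis using classified_aut[OF neg sub_A[OF pl pm]] by blast
qed

theorem classify_sum_free: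
  assumes pm: "p = 4 * m + 3" "m \<ge> 25" and A: "sum_free (Suc n) A" "A \<noteq> {}" and big: "m * p ^ n \<le> card A"
  shows "classified m n A"
proof -
  have sub: "A \<subseteq> vectors p (Suc n)" using A by (simp add: sum_free_def)
  obtain \<phi> d where \<phi>: "aut (Suc n) \<phi>" and d: "\<forall>x\<in>\<phi> ` A. \<exists>j\<in>{0..int m + 7}. hd x = (d + j) mod int p"
    using exists_short_coordinates[OF pm A(1) big] by blast
  have "m * p ^ n \<le> card (\<phi> ` A)" using big aut_image(2)[OF \<phi> sub] by simp
  then obtain y L where "placed m n (\<phi> ` A) y L"
    using placed_exists[OF aut_sum_free[OF \<phi> A(1)] _ _ d] A(2) by blast
  then show ?thesis using classified_aut[OF \<phi> sub] classify_placed[OF _ pm] by blast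
qed

end

text \<open>The values 23 and 24 would make \<open>p\<close> equal to 95 and 99, which are
  composite.\<close>

lemma m_ge_25:
  assumes "Factorial_Ring.prime p" "p = 4 * m + 3" "m \<ge> 23" shows "m \<ge> (25::nat)"
proof (rule ccontr)
  assume "\<not> m \<ge> 25"
  then have "m = 23 \<or> m = 24" using assms(3) by linarith
  then have "p = 5 * 19 \<or> p = 9 * 11" using assms(2) by auto
  then show False using assms(1) prime_product by fastforce
qed

theorem theorem1p10:
  fixes p m n :: nat and A :: "int list set"
  assumes "prime p" and "p = 4 * m + 3"
    and "of_nat m \<ge> max (5 * T (1 / 4)) 23"
    and "n \<ge> 1"
    and "nontrivial_sum_free p m n A"
    and "card A \<ge> m * p ^ (n - 1)"
  shows "normal_type p m n A \<or> type5 p m n A"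
proof -
  interpret fvec p by unfold_locales (rule assms(1))
  have "(23::ennreal) \<le> of_nat m" using assms(3) by simp
  then have "m \<ge> 23" by (metis of_nat_le_iff of_nat_numeral)
  then have m: "m \<ge> 25" using m_ge_25 assms(1,2) by blast
  obtain k where n: "n = Suc k" using assms(4) by (metis Suc_le_D One_nat_def)
  have sf: "sum_free_3_1 p (Suc k) A" and nt: "\<not> trivial_sum_free p m (Suc k) A"
    using assms(5) by (simp_all add: nontrivial_sum_free_def n)
  have "classified m k A"
    by (rule classify_sum_free[OF assms(2) m sum_free_3_1_imp[OF sf]]) (use assms(6) n in simp)
  then show ?thesis using sf nt unfolding classified_def trivial_sum_free_def n by blast
qed

end
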